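(* For every integer $n\ge 1$ the sequence of $\mathbb{Q}$-vector spaces $$0 \longrightarrow \mathcal{A}_n \stackrel{I_n}{\longrightarrow} \mathbb{Q}[\mathbb{C}(t)]_n \stackrel{J_n}{\longrightarrow} \mathbb{S}_*^{n-1,1} A$$ is exact.
   Context: **Polylogarithms.** $Li_n(z)=\sum_{k\ge1} z^k/k^n$ for $|z|<1$, continued analytically (as a multivalued function) to $\mathbb{CP}^1\setminus\{0,1,\infty\}$ by $Li_1(z)=-\log(1-z)$, $Li_n(z)=\int_0^z Li_{n-1}(t)\frac{dt}{t}$. Zagier's polylogarithm is $\mathcal{L}i_1(z)=\log|z|$ and, for $n\ge2$, $$\mathcal{L}i_n(z)=\Re_n\Big(\sum_{k=0}^{n-1}\beta_k \log^k|z|\cdot Li_{n-k}(z)\Big),\qquad \frac{2x}{e^{2x}-1}=\sum_{k\ge0}\beta_kx^k,$$ where $\Re_n$ is the real part for $n$ odd and the imaginary part for $n$ even. For $n\ge 2$ it is single-valued and extends continuously to $\mathbb{CP}^1$, and it is real analytic on $\mathbb{CP}^1\setminus\{0,1,\infty\}$. **The group $\mathcal{A}_n$.** For a set $S$, $\mathbb{Q}[S]$ is the $\mathbb{Q}$-vector space with basis $[s]$, $s\in S$. $\mathbb{Q}[\mathbb{C}(t)]_n$ is just $\mathbb{Q}[\mathbb{C}(t)]$ (the subscript records the weight). $\mathcal{A}_n\subset\mathbb{Q}[\mathbb{C}(t)]_n$ is the subspace of all $\sum_i n_i[\varphi_i]$ ($n_i\in\mathbb{Q}$, $\varphi_i\in\mathbb{C}(t)$)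 such that $\sum_i n_i\,\mathcal{L}i_n(\varphi_i(t))$ is constant as a function of $t$ (where defined); $I_n$ is the inclusion. Convention: constant $\varphi$ (including $\varphi=0,1$) give elements $[\varphi]\in\mathcal{A}_n$. **Divisors.** $A$ is the $\mathbb{Q}$-vector space of degree zero divisors on $\mathbb{CP}^1$, written inhomogeneously: we put $[\infty]=0$, so $A$ has basis $[p]$, $p\in\mathbb{C}$. For nonzero $\varphi\in\mathbb{C}(t)$, $(\varphi)\in A$ is its divisor. **$\mathbb{S}_*^{n-1,1}$ and $J_n$.** For a $\mathbb{Q}$-vector space $V$ and $n\ge2$, $\mathbb{S}_*^{n-1,1}V=(Sym^{n-1}V\otimes V)/Sym^nV$, where $Sym^nV$ is embedded by $x_1\cdots x_n\mapsto\sum_i x_1\cdots\widehat{x_i}\cdots x_n\otimes x_i$; for $n=1$, $\mathbb{S}_*^{0,1}V=V$. In particular $\mathbb{S}_*^{1,1}V=V\wedge V$. The linear map $J_n$ is given by $J_n([\varphi])=(\varphi)^{n-1}\otimes(1-\varphi)$ for $n\ge2$ (here $(1-\varphi)$ is the divisor of $1-\varphi$) and $J_1([\varphi])=(\varphi)$; by convention $J_n([0])=J_n([1])=0$. *)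

theory Defs
  imports
    "HOL-Complex_Analysis.Complex_Analysis"
    "HOL-Computational_Algebra.Computational_Algebra"
    "HOL-Computational_Algebra.Field_as_Ring"
    "HOL-Library.Poly_Mapping"
    "HOL-Library.Multiset"
    "HOL-Algebra.Elementary_Groups"
begin

text \<open>
  The branch of the multivalued polylogarithm obtained by integrating along the straight
  segment from 0 to z. Off the ray [1, \<infinity>) this is the principal branch. For z > 1 the
  segment runs through the integrable logarithmic singularity at 1, where Ln of a negative
  real has imaginary part pi; the value is then the limit of the principal branch from
  the lower half plane, so it is again a branch value of the continuation. The integrand is
  0 at t = 0, which does not affect the integral. The case of index 0 is never used.
\<close>
fun polylog :: "nat \<Rightarrow> complex \<Rightarrow> complex" where
  "polylog 0 z = z / (1 - z)"
| "polylog (Suc 0) z = - Ln (1 - z)"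
| "polylog (Suc (Suc n)) z = contour_integral (linepath 0 z) (\<lambda>t. polylog (Suc n) t / t)"

text \<open>Agreement with the defining series in the unit disc (the term of index 0 is 0).\<close>
lemma polylog_series:
  assumes "norm z < 1" "n \<ge> 1"
  shows "(\<lambda>k. z ^ k / of_nat k ^ n) sums polylog n z"
  using assms(2,1)
proof (induction n arbitrary: z rule: dec_induct)
  case base
  have "(\<lambda>k. - (- (z ^ k / of_nat k))) sums - ln (1 + (-z))"
    using sums_minus[OF Ln_series'[of "-z"]] base by simp
  then show ?case by simp
next
  case (step n)
  define a :: "nat \<Rightarrow> complex" where "a k = 1 / of_nat k ^ Suc n" for k
  define F where "F w = suminf (\<lambda>k. a k * w ^ k)" for w
  define G where "G w = suminf (\<lambda>k. diffs a k * w ^ k)" for w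
  obtain m where n: "n = Suc m" using step.hyps by (cases n) auto
  have sa: "summable (\<lambda>k. a k * w ^ k)" if "norm w < 1" for w
  proof (rule summable_comparison_test')
    show "summable (\<lambda>k. norm w ^ k)" using that by (simp add: summable_geometric)
    fix k :: nat assume "k \<ge> 0"
    have "norm (a k) \<le> 1"
      by (cases "k = 0") (auto simp: a_def norm_divide norm_power norm_mult divide_simps mult_ge1_I
        simp del: power_Suc)
    then show "norm (a k * w ^ k) \<le> norm w ^ k"
      by (simp add: norm_mult norm_power mult_left_le_one_le)
  qed
  have der: "(F has_field_derivative G w) (at w within ball 0 1)" if w: "w \<in> ball 0 1" for w
  proof -
    obtain r where r: "norm w < r" "r < 1" using w dense[of "norm w" 1] by (auto simp: dist_norm)
    have "0 < r" using r by (meson norm_ge_zero order_le_less_trans)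
    have "DERIV F w :> G w"
      unfolding F_def G_def
      by (rule termdiffs_strong[of _ "of_real r"]) (use r \<open>0 < r\<close> in \<open>auto intro!: sa\<close>)
    then show ?thesis by (rule has_field_derivative_at_within)
  qed
  have G: "G w = polylog n w / w" if "norm w < 1" "w \<noteq> 0" for w
  proof -
    have "(\<lambda>k. w ^ Suc k / of_nat (Suc k) ^ n) sums polylog n w"
      using step.IH[OF that(1)] n by (subst sums_Suc_iff) simp
    from sums_divide[OF this, of w]
    have "(\<lambda>k. diffs a k * w ^ k) sums (polylog n w / w)"
      by (rule back_subst[where P="\<lambda>f. f sums _"])
         (use that in \<open>auto simp: diffs_def a_def fun_eq_iff simp del: of_nat_Suc\<close>)
    then show ?thesis by (simp add: G_def sums_iff)
  qed
  have "(G has_contour_integral F z - F 0) (linepath 0 z)"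
    using contour_integral_primitive[of "ball 0 1" F G "linepath 0 z", OF der] step.prems
    by (simp add: closed_segment_subset)
  moreover have "F 0 = 0" unfolding F_def by (subst powser_zero) (simp add: a_def)
  ultimately have *: "((\<lambda>x. G (linepath 0 z x) * (z - 0)) has_integral F z) {0..1}"
    by (simp add: has_contour_integral_linepath)
  have "((\<lambda>x. (polylog n (linepath 0 z x) / linepath 0 z x) * (z - 0)) has_integral F z) {0..1}"
  proof (rule has_integral_spike_finite[OF _ _ *, of "{0}"])
    fix x :: real assume x: "x \<in> {0..1} - {0}"
    then have "norm (linepath 0 z x) < 1"
      using step.prems mult_le_one[of x "norm z"] mult_left_le_one_le[of "norm z" x]
      by (auto simp: linepath_def)
    then show "(polylog n (linepath 0 z x) / linepath 0 z x) * (z - 0) = G (linepath 0 z x) * (z - 0)"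
      using x by (cases "z = 0") (auto simp: G linepath_def)
  qed auto
  then have "contour_integral (linepath 0 z) (\<lambda>t. polylog n t / t) = F z"
    by (intro contour_integral_unique) (simp add: has_contour_integral_linepath)
  then have "polylog (Suc n) z = F z" using n by simp
  moreover have "(\<lambda>k. a k * z ^ k) sums F z"
    unfolding F_def by (rule summable_sums[OF sa[OF step.prems]])
  ultimately show ?case by (simp add: a_def)
qed

definition zagier_beta :: "nat \<Rightarrow> real" where
  "zagier_beta k = fps_nth (2 * fps_X / (fps_exp 2 - 1)) k"

definition Re_Im :: "nat \<Rightarrow> complex \<Rightarrow> real" where
  "Re_Im n w = (if odd n then Re w else Im w)"

text \<open>
  Only meant for z different from 0 and 1. Since the function is single-valued, the choice of
  branches in \<^const>\<open>polylog\<close> is immaterial.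
\<close>
definition zagier_polylog :: "nat \<Rightarrow> complex \<Rightarrow> real" where
  "zagier_polylog n z =
     (if n = 1 then ln (cmod z)
      else Re_Im n (\<Sum>k<n. of_real (zagier_beta k * ln (cmod z) ^ k) * polylog (n - k) z))"

text \<open>
  The space Q[S] on all elements of a type 's is \<^typ>\<open>'s \<Rightarrow>\<^sub>0 rat\<close>, with basis vectors [s].
\<close>
abbreviation basis :: "'s \<Rightarrow> ('s \<Rightarrow>\<^sub>0 rat)" where
  "basis s \<equiv> Poly_Mapping.single s 1"

definition qscale :: "rat \<Rightarrow> ('s \<Rightarrow>\<^sub>0 rat) \<Rightarrow> ('s \<Rightarrow>\<^sub>0 rat)" where
  "qscale c x = Poly_Mapping.map (\<lambda>a. c * a) x"

definition lin_ext :: "('s \<Rightarrow> ('r \<Rightarrow>\<^sub>0 rat)) \<Rightarrow> ('s \<Rightarrow>\<^sub>0 rat) \<Rightarrow> ('r \<Rightarrow>\<^sub>0 rat)" where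
  "lin_ext f x = (\<Sum>s\<in>Poly_Mapping.keys x. qscale (Poly_Mapping.lookup x s) (f s))"

definition qspan :: "'s set \<Rightarrow> ('s \<Rightarrow>\<^sub>0 rat) set" where
  "qspan S = {x. Poly_Mapping.keys x \<subseteq> S}"

definition add_group :: "'v::ab_group_add set \<Rightarrow> 'v monoid" where
  "add_group U = \<lparr>carrier = U, monoid.mult = (+), one = 0\<rparr>"

text \<open>
  Exactness of F \<rightarrow> G \<rightarrow> H at G. (An additive map between vector spaces over the rationals is
  automatically linear.) The library's \<open>exact_seq\<close> does not apply, because it wants all groups
  of the sequence to have the same element type.
\<close>
definition exact_at ::
  "('a, 'c) monoid_scheme \<Rightarrow> ('a \<Rightarrow> 'b) \<Rightarrow> ('b, 'd) monoid_scheme \<Rightarrow> ('b \<Rightarrow> 'e) \<Rightarrow>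
   ('e, 'f) monoid_scheme \<Rightarrow> bool" where
  "exact_at F f G g H \<longleftrightarrow>
     group_hom F G f \<and> group_hom G H g \<and> f ` carrier F = kernel G H g"

text \<open>
  For a vector space V = Q[P] the symmetric algebra is the polynomial ring in the elements of P,
  that is \<^typ>\<open>'p multiset \<Rightarrow>\<^sub>0 rat\<close> with its convolution product: the monomial
  x1 ... xk is the basis vector of the multiset {#x1, ..., xk#}. Using Q[S] \<otimes> Q[T] = Q[S \<times> T],
  the tensor product of the symmetric algebra with V is \<^typ>\<open>'p multiset \<times> 'p \<Rightarrow>\<^sub>0 rat\<close>.
\<close>

definition to_sym :: "('p \<Rightarrow>\<^sub>0 rat) \<Rightarrow> ('p multiset \<Rightarrow>\<^sub>0 rat)" where
  "to_sym = lin_ext (\<lambda>p. basis {#p#})"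

definition tensor :: "('s \<Rightarrow>\<^sub>0 rat) \<Rightarrow> ('r \<Rightarrow>\<^sub>0 rat) \<Rightarrow> ('s \<times> 'r \<Rightarrow>\<^sub>0 rat)" (infixl "\<otimes>\<^sub>Q" 70) where
  "x \<otimes>\<^sub>Q y = lin_ext (\<lambda>s. lin_ext (\<lambda>r. basis (s, r)) y) x"

definition Sym :: "nat \<Rightarrow> ('p multiset \<Rightarrow>\<^sub>0 rat) set" where
  "Sym k = qspan {m. size m = k}"

definition Sym_tensor :: "nat \<Rightarrow> ('p multiset \<times> 'p \<Rightarrow>\<^sub>0 rat) set" where
  "Sym_tensor k = qspan ({m. size m = k} \<times> UNIV)"

text \<open>On monomials: x1 ... xn is sent to the sum over i of x1 ... (xi omitted) ... xn \<otimes> xi.\<close>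
definition sym_embed :: "('p multiset \<Rightarrow>\<^sub>0 rat) \<Rightarrow> ('p multiset \<times> 'p \<Rightarrow>\<^sub>0 rat)" where
  "sym_embed = lin_ext (\<lambda>m. \<Sum>p\<in>#m. basis (m - {#p#}) \<otimes>\<^sub>Q basis p)"

definition S_relations :: "nat \<Rightarrow> ('p multiset \<times> 'p \<Rightarrow>\<^sub>0 rat) set" where
  "S_relations n = (if n = 1 then {0} else sym_embed ` Sym n)"

text \<open>
  For n = 1 there is no quotient and the space is V, in the guise of Sym^0 V \<otimes> V = Q \<otimes> V.
\<close>
definition S_star :: "nat \<Rightarrow> ('p multiset \<times> 'p \<Rightarrow>\<^sub>0 rat) set monoid" where
  "S_star n = add_group (Sym_tensor (n - 1)) Mod S_relations n"

type_synonym ratfun = "complex poly fract"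

definition ratfun_num :: "ratfun \<Rightarrow> complex poly" where
  "ratfun_num \<phi> = fst (quot_of_fract \<phi>)"

definition ratfun_denom :: "ratfun \<Rightarrow> complex poly" where
  "ratfun_denom \<phi> = snd (quot_of_fract \<phi>)"

definition ratfun_pole :: "ratfun \<Rightarrow> complex \<Rightarrow> bool" where
  "ratfun_pole \<phi> t \<longleftrightarrow> poly (ratfun_denom \<phi>) t = 0"

definition ratfun_eval :: "ratfun \<Rightarrow> complex \<Rightarrow> complex" where
  "ratfun_eval \<phi> t = poly (ratfun_num \<phi>) t / poly (ratfun_denom \<phi>) t"

definition poly_divisor :: "complex poly \<Rightarrow> (complex \<Rightarrow>\<^sub>0 rat)" where
  "poly_divisor f = (\<Sum>p | poly f p = 0. Poly_Mapping.single p (of_nat (Polynomial.order p f)))"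

text \<open>
  A degree zero divisor on the Riemann sphere is determined by its part on the affine line;
  this is the convention that the class of \<infinity> is 0. Only meant for nonzero functions.
\<close>
definition ratfun_divisor :: "ratfun \<Rightarrow> (complex \<Rightarrow>\<^sub>0 rat)" where
  "ratfun_divisor \<phi> = poly_divisor (ratfun_num \<phi>) - poly_divisor (ratfun_denom \<phi>)"

text \<open>
  The constant functions 0 and 1 contribute nothing, by the convention that they give elements
  of the group. The remaining sum is required to be constant where every term is given by the
  defining formula of the polylogarithm, i.e. where no function takes a value
  in {0, 1, \<infinity>}. This excludes finitely many t only, so
  by continuity it does not matter that for n \<ge> 2 the polylogarithm extends to the whole sphere,
  and that for n = 1 it is defined at 1.
\<close>
definition regular_points :: "ratfun set \<Rightarrow> complex set" where
  "regular_points \<Phi> = {t. \<forall>\<phi>\<in>\<Phi>. \<not> ratfun_pole \<phi> t \<and> ratfun_eval \<phi> t \<notin> {0, 1}}"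

definition A_space :: "nat \<Rightarrow> (ratfun \<Rightarrow>\<^sub>0 rat) set" where
  "A_space n = {x. let \<Phi> = Poly_Mapping.keys x - {0, 1} in
     (\<lambda>t. \<Sum>\<phi>\<in>\<Phi>. of_rat (Poly_Mapping.lookup x \<phi>) * zagier_polylog n (ratfun_eval \<phi> t))
       constant_on regular_points \<Phi>}"

definition I_map :: "nat \<Rightarrow> (ratfun \<Rightarrow>\<^sub>0 rat) \<Rightarrow> (ratfun \<Rightarrow>\<^sub>0 rat)" where
  "I_map n x = x"

text \<open>For n = 1 the first factor is the unit of Sym^0, so that the value is the divisor of \<phi>.\<close>
definition J_gen :: "nat \<Rightarrow> ratfun \<Rightarrow> (complex multiset \<times> complex \<Rightarrow>\<^sub>0 rat)" where
  "J_gen n \<phi> =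
     (if \<phi> = 0 \<or> \<phi> = 1 then 0
      else if n = 1 then 1 \<otimes>\<^sub>Q ratfun_divisor \<phi>
      else to_sym (ratfun_divisor \<phi>) ^ (n - 1) \<otimes>\<^sub>Q ratfun_divisor (1 - \<phi>))"

definition J_map :: "nat \<Rightarrow> (ratfun \<Rightarrow>\<^sub>0 rat) \<Rightarrow> (complex multiset \<times> complex \<Rightarrow>\<^sub>0 rat) set" where
  "J_map n x = S_relations n #>\<^bsub>add_group (Sym_tensor (n - 1))\<^esub> lin_ext (J_gen n) x"

end

theory Submission
  imports Defs "HOL-Real_Asymp.Real_Asymp"
begin

text \<open>
  For a rational function \<open>\<phi>\<close> write x and x' for the logarithms of the absolute values of \<open>\<phi>\<close> and
  \<open>1 - \<phi>\<close>, and M n for the single-valued polylogarithm of weight n evaluated at \<open>\<phi>\<close>, with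
  \<open>M 1 = - x'\<close>. The proof compares a differential identity for M n with a description of the kernel of the
  map to the symmetric powers. Only exactness in the middle has content.

  Analytic side. The recurrence for the coefficients of the generating series and the vanishing of those of odd index at
  least 3 give the differential of M n: up to sign it is \<open>M (n - 1) Im dlog \<phi>\<close>, plus multiples of
  \<open>x ^ (k - 1) M (n - k) Re dlog \<phi>\<close>, plus a multiple of
  \<open>x ^ (n - 2) (x Re dlog (1 - \<phi>) - x' Re dlog \<phi>)\<close>; in weight 2 it is
  \<open>x Im dlog (1 - \<phi>) - x' Im dlog \<phi>\<close> (\<open>has_derivative_Re_Im_zagier_sum\<close>). The inversion
  formula extends this across the cut (\<open>sv_polylog_has_derivative\<close>) and shows that M n tends to 0 where
  \<open>\<phi>\<close> tends to 0 or infinity.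

  Algebraic side. The tensor product of the symmetric algebra with the divisors consists of polynomial 1-forms, and the
  relations are the exact forms. By the Poincare lemma (\<open>in_sym_embed_image_iff\<close>) a combination with weights w lies
  in the kernel if and only if the sum of \<open>w l ^ (n - 2) dl \<and> dl'\<close> vanishes, where l and l' are the linear forms
  given by the divisors of \<open>\<phi>\<close> and \<open>1 - \<phi>\<close>. Call such weights integrable. Now x and x' are affine
  functions L and L' with linear parts l and l', taken at the point with coordinates \<open>log|t - p|\<close>. The constant parts
  of L and L' are not visible in the divisors, but they are controlled by the triviality of the tame symbol of
  \<open>\<phi>\<close> and \<open>1 - \<phi>\<close> at every point: for integrable weights the sum of
  \<open>w L ^ (n - 2) (L dl' - L' dl)\<close> vanishes identically (\<open>symbol_1_form_vanishes\<close>).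

  Integrable weights give constant sums, by induction over n (\<open>integrable_symbol_imp_constant\<close>). The last part of the
  differential vanishes by the identity just mentioned. In the other parts the coefficient of \<open>dlog (t - p)\<close> is a
  sum of lower weight in which every summand carries the order of \<open>\<phi>\<close> at p as a factor. Freezing the powers of x, it
  is constant by induction, and the constant is 0 because the polylogarithms involved tend to 0 at p.

  Conversely (\<open>constant_imp_integrable_symbol\<close>), all functions M n and x are iterated primitives of logarithmic forms.
  Such functions are linearly independent over the rational functions as soon as they are over the complex numbers
  (\<open>flag_rational_independent\<close>). So if a sum of polylogarithms is constant, the coefficient of each
  \<open>1 / (t - p)\<close> in its derivative vanishes separately. For n at least 3 the imaginary part of this coefficient is, up
  to sign, the sum of the \<open>M (n - 1)\<close> with weights multiplied by the orders at p, and induction applies; for n equal to 2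
  it is a relation between logarithms, which is treated in the same way once more. In
  weight 1 the same independence applied to the sum of the x shows that the total divisor is 0.
\<close>

section \<open>The coefficients of the generating series and the total derivative\<close>

definition beta_fps :: "real fps" where
  "beta_fps = 2 * fps_X / (fps_exp 2 - 1)"

lemma beta_fps_nth: "fps_nth beta_fps k = zagier_beta k"
  by (simp add: beta_fps_def zagier_beta_def)

lemma fps_exp_2_minus_1_nz: "fps_exp 2 - 1 \<noteq> (0 :: real fps)"
proof
  assume "fps_exp 2 - 1 = (0 :: real fps)"
  then have "fps_nth (fps_exp 2 - 1 :: real fps) 1 = 0" by simp
  then show False by simp
qed

lemma beta_fps_times: "beta_fps * (fps_exp 2 - 1) = 2 * fps_X"
proof -
  have sub: "subdegree (fps_exp 2 - 1 :: real fps) = 1"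
    by (rule subdegreeI) auto
  have "(fps_exp 2 - 1 :: real fps) dvd 2 * fps_X"
  proof (subst fps_dvd_iff)
    show "fps_exp 2 - 1 \<noteq> (0 :: real fps)" by (rule fps_exp_2_minus_1_nz)
    show "2 * fps_X \<noteq> (0 :: real fps)" by simp
    have "subdegree (2 * fps_X :: real fps) = 1" by (rule subdegreeI) (auto simp: numeral_fps_const)
    then show "subdegree (fps_exp 2 - 1 :: real fps) \<le> subdegree (2 * fps_X :: real fps)"
      using sub by simp
  qed
  then show ?thesis unfolding beta_fps_def by simp
qed

text \<open>
  Differentiating B (E - 1) = 2 X, where E = exp (2 X) has derivative 2 E, and eliminating E gives a
  Riccati equation for B; its coefficients are the recurrence below.
\<close>

lemma beta_fps_differential_equation:
  "fps_X * (fps_deriv beta_fps + beta_fps) = beta_fps * (1 - beta_fps - fps_X)"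
proof -
  let ?B = beta_fps and ?E = "fps_exp 2 :: real fps" and ?X = "fps_X :: real fps"
  have "fps_deriv (?B * (?E - 1)) = 2"
    by (simp add: beta_fps_times numeral_fps_const)
  then have d: "fps_deriv ?B * (?E - 1) + 2 * ?B * ?E = 2"
    by (simp add: algebra_simps numeral_fps_const)
  have "?X * (fps_deriv ?B + ?B) * (?E - 1)
      = ?X * (fps_deriv ?B * (?E - 1) + 2 * ?B * ?E) - 2 * ?X * (?B * (?E - 1)) - 2 * ?X * ?B
        + ?X * (?B * (?E - 1))"
    by (simp add: algebra_simps)
  also have "\<dots> = 2 * ?X * (1 - ?B - ?X)"
    unfolding d beta_fps_times by (simp add: algebra_simps)
  also have "\<dots> = ?B * (?E - 1) * (1 - ?B - ?X)"
    by (simp add: beta_fps_times)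
  also have "\<dots> = ?B * (1 - ?B - ?X) * (?E - 1)"
    by (simp add: algebra_simps)
  finally show ?thesis
    using fps_exp_2_minus_1_nz by (metis mult_right_cancel)
qed

lemma zagier_beta_0 [simp]: "zagier_beta 0 = 1"
proof -
  have "fps_nth (beta_fps * (fps_exp 2 - 1)) 1 = 2"
    by (simp add: beta_fps_times numeral_fps_const)
  then show ?thesis by (simp add: fps_mult_nth beta_fps_nth)
qed

lemma zagier_beta_convolution:
  "real (Suc l) * zagier_beta (Suc l) + zagier_beta l
     = zagier_beta (Suc l) - zagier_beta l - (\<Sum>k = 0..Suc l. zagier_beta k * zagier_beta (Suc l - k))"
proof -
  have "fps_nth (fps_X * (fps_deriv beta_fps + beta_fps)) (Suc l)
      = fps_nth (beta_fps - fps_X * beta_fps - beta_fps * beta_fps) (Suc l)"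
    by (subst beta_fps_differential_equation) (simp add: algebra_simps)
  then show ?thesis
    by (simp add: beta_fps_nth fps_mult_nth[of beta_fps beta_fps] del: of_nat_Suc sum.cl_ivl_Suc)
qed

lemma zagier_beta_1 [simp]: "zagier_beta (Suc 0) = -1"
  using zagier_beta_convolution[of 0] by simp

text \<open>
  This quadratic recurrence is the identity that makes the derivative of the polylogarithm close up
  on polylogarithms of lower weight.
\<close>

lemma zagier_beta_recurrence:
  assumes "m \<ge> 1"
  shows "real m * zagier_beta m + zagier_beta (m - 1)
       = - (\<Sum>k = 2..m. zagier_beta k * zagier_beta (m - k))"
proof -
  obtain l where m: "m = Suc l" using assms by (cases m) auto
  have "(\<Sum>k = 0..m. zagier_beta k * zagier_beta (m - k))
      = zagier_beta m + (- zagier_beta l + (\<Sum>k = 2..m. zagier_beta k * zagier_beta (m - k)))"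
    by (simp add: m sum.atLeast_Suc_atMost numeral_2_eq_2 del: sum.cl_ivl_Suc)
  with zagier_beta_convolution[of l] show ?thesis by (simp add: m del: sum.cl_ivl_Suc of_nat_Suc)
qed

lemma zagier_beta_odd_eq_0:
  assumes "odd m" "m \<ge> 3"
  shows "zagier_beta m = 0"
  using assms
proof (induction m rule: less_induct)
  case (less m)
  obtain l where m: "m = Suc (Suc (Suc l))"
    using less.prems le_Suc_ex[of 3 m] by (auto simp: numeral_3_eq_3)
  have "(\<Sum>k = 2..Suc l. zagier_beta k * zagier_beta (m - k)) = 0"
  proof (rule sum.neutral, rule ballI)
    fix k assume k: "k \<in> {2..Suc l}"
    show "zagier_beta k * zagier_beta (m - k) = 0"
    proof (cases "odd k")
      case True
      then have "k \<ge> 3" using k by (cases "k = 2") auto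
      then show ?thesis using less.IH[of k] True k m by simp
    next
      case False
      then have "odd (m - k)" "m - k \<noteq> 1" using less.prems k m by auto
      then have "m - k \<ge> 3" by presburger
      then show ?thesis using less.IH[of "m - k"] \<open>odd (m - k)\<close> k m by simp
    qed
  qed
  then have "(\<Sum>k = 2..m. zagier_beta k * zagier_beta (m - k)) = zagier_beta m - zagier_beta (m - 1)"
    by (simp add: m)
  with zagier_beta_recurrence[of m] have "(real m + 1) * zagier_beta m = 0"
    by (simp add: m algebra_simps)
  moreover have "real m + 1 \<noteq> 0" by linarith
  ultimately show ?case by simp
qed

text \<open>
  The expression under the real or imaginary part in the polylogarithm of weight n, with free
  symbols x for \<open>log|z|\<close> and P k for the value of the k-th polylogarithm. Keeping
  P abstract lets the same differentiation serve on the slit plane and along the ray beyond 1.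
\<close>

definition zagier_sum :: "nat \<Rightarrow> real \<Rightarrow> (nat \<Rightarrow> complex) \<Rightarrow> complex" where
  "zagier_sum n x P = (\<Sum>k<n. of_real (zagier_beta k * x ^ k) * P (n - k))"

lemma zagier_sum_1 [simp]: "zagier_sum (Suc 0) x P = P (Suc 0)"
  by (simp add: zagier_sum_def)

text \<open>
  The left side collects what arises from differentiating along \<open>log|z|\<close>: the
  polylogarithms drop in weight and the powers of \<open>log|z|\<close> drop in degree. Replacing
  the coefficients by the quadratic recurrence and exchanging the order of summation turns the result into
  complete sums of lower weight.
\<close>

lemma zagier_sum_resummation:
  "zagier_sum N x P + (\<Sum>j<N. of_real (real (Suc j) * zagier_beta (Suc j) * x ^ j) * P (N - j))
     = - (\<Sum>k = 2..N. of_real (zagier_beta k * x ^ (k - 1)) * zagier_sum (Suc N - k) x P)"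
proof -
  define T where "T j = of_real (x ^ j) * P (N - j)" for j
  have "zagier_sum N x P + (\<Sum>j<N. of_real (real (Suc j) * zagier_beta (Suc j) * x ^ j) * P (N - j))
      = (\<Sum>j<N. of_real (zagier_beta j + real (Suc j) * zagier_beta (Suc j)) * T j)"
    by (simp add: zagier_sum_def T_def sum.distrib[symmetric] algebra_simps del: of_nat_Suc)
  also have "\<dots> = (\<Sum>j<N. of_real (- (\<Sum>k = 2..Suc j. zagier_beta k * zagier_beta (Suc j - k))) * T j)"
  proof (rule sum.cong[OF refl])
    fix j
    show "of_real (zagier_beta j + real (Suc j) * zagier_beta (Suc j)) * T j
        = of_real (- (\<Sum>k = 2..Suc j. zagier_beta k * zagier_beta (Suc j - k))) * T j"
      using zagier_beta_recurrence[of "Suc j"] by (simp add: algebra_simps)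
  qed
  also have "\<dots> = - (\<Sum>j<N. \<Sum>k = 2..Suc j. of_real (zagier_beta k * zagier_beta (Suc j - k)) * T j)"
    by (simp add: sum_negf sum_distrib_right del: sum.cl_ivl_Suc)
  also have "(\<Sum>j<N. \<Sum>k = 2..Suc j. of_real (zagier_beta k * zagier_beta (Suc j - k)) * T j)
      = (\<Sum>(j,k)\<in>(SIGMA j:{..<N}. {2..Suc j}). of_real (zagier_beta k * zagier_beta (Suc j - k)) * T j)"
    by (simp add: sum.Sigma del: sum.cl_ivl_Suc)
  also have "\<dots> = (\<Sum>(k,i)\<in>(SIGMA k:{2..N}. {..<Suc N - k}). of_real (zagier_beta k * zagier_beta i) * T (k + i - 1))"
    by (rule sum.reindex_bij_witness[of _ "\<lambda>(k,i). (k + i - 1, k)" "\<lambda>(j,k). (k, Suc j - k)"]) auto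
  also have "\<dots> = (\<Sum>k = 2..N. \<Sum>i<Suc N - k. of_real (zagier_beta k * zagier_beta i) * T (k + i - 1))"
    by (simp add: sum.Sigma)
  also have "\<dots> = (\<Sum>k = 2..N. of_real (zagier_beta k * x ^ (k - 1)) * zagier_sum (Suc N - k) x P)"
  proof (rule sum.cong[OF refl])
    fix k assume k: "k \<in> {2..N}"
    have "N - (k + i - 1) = Suc N - k - i" "k + i - 1 = (k - 1) + i" for i using k by auto
    then show "(\<Sum>i<Suc N - k. of_real (zagier_beta k * zagier_beta i) * T (k + i - 1))
        = of_real (zagier_beta k * x ^ (k - 1)) * zagier_sum (Suc N - k) x P"
      by (simp add: zagier_sum_def sum_distrib_left T_def power_add algebra_simps)
  qed
  finally show ?thesis .
qed

text \<open>
  Here \<open>\<omega>\<close> and \<open>\<omega>'\<close> stand for the forms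
  dlog z and dlog (1 - z). Splitting \<open>\<omega>\<close> into its real part, which is dx, and its imaginary
  part, the imaginary part multiplies the sum of the next lower weight, and the real part is handled by
  \<open>zagier_sum_resummation\<close>.
\<close>

lemma has_derivative_zagier_sum:
  fixes x :: "'a::real_normed_vector \<Rightarrow> real" and P :: "nat \<Rightarrow> 'a \<Rightarrow> complex"
  assumes x: "(x has_derivative (\<lambda>h. Re (\<omega> h))) (at a within A)"
    and P1: "(P 1 has_derivative (\<lambda>h. - \<omega>' h)) (at a within A)"
    and P: "\<And>k. 2 \<le> k \<Longrightarrow> k \<le> n \<Longrightarrow> (P k has_derivative (\<lambda>h. P (k - 1) a * \<omega> h)) (at a within A)"
    and n: "n \<ge> 2"
  shows "((\<lambda>b. zagier_sum n (x b) (\<lambda>k. P k b)) has_derivative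
     (\<lambda>h. \<i> * of_real (Im (\<omega> h)) * zagier_sum (n - 1) (x a) (\<lambda>k. P k a)
        - (\<Sum>k = 2..<n. of_real (zagier_beta k * x a ^ (k - 1) * Re (\<omega> h)) * zagier_sum (n - k) (x a) (\<lambda>k. P k a))
        - of_real (zagier_beta (n - 1) * x a ^ (n - 1)) * \<omega>' h)) (at a within A)"
proof -
  obtain N where N: "n = Suc N" "N \<ge> 1" using n by (cases n) auto
  define dP where "dP k h = (if k = 1 then - \<omega>' h else P (k - 1) a * \<omega> h)" for k h
  have dP: "(P k has_derivative dP k) (at a within A)" if "1 \<le> k" "k \<le> n" for k
    using P1 P[of k] that by (cases "k = 1") (auto simp: dP_def[abs_def])
  have "((\<lambda>b. of_real (zagier_beta k * x b ^ k) * P (n - k) b) has_derivative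
      (\<lambda>h. of_real (zagier_beta k * (real k * Re (\<omega> h) * x a ^ (k - 1))) * P (n - k) a
          + of_real (zagier_beta k * x a ^ k) * dP (n - k) h)) (at a within A)" if "k < n" for k
    using that by (auto intro!: derivative_eq_intros x dP simp: fun_eq_iff algebra_simps)
  then have "((\<lambda>b. zagier_sum n (x b) (\<lambda>k. P k b)) has_derivative
      (\<lambda>h. \<Sum>k<n. of_real (zagier_beta k * (real k * Re (\<omega> h) * x a ^ (k - 1))) * P (n - k) a
          + of_real (zagier_beta k * x a ^ k) * dP (n - k) h)) (at a within A)"
    unfolding zagier_sum_def by (intro has_derivative_sum) auto
  moreover have "(\<Sum>k<n. of_real (zagier_beta k * (real k * Re (\<omega> h) * x a ^ (k - 1))) * P (n - k) a
          + of_real (zagier_beta k * x a ^ k) * dP (n - k) h)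
     = \<i> * of_real (Im (\<omega> h)) * zagier_sum (n - 1) (x a) (\<lambda>k. P k a)
        - (\<Sum>k = 2..<n. of_real (zagier_beta k * x a ^ (k - 1) * Re (\<omega> h)) * zagier_sum (n - k) (x a) (\<lambda>k. P k a))
        - of_real (zagier_beta (n - 1) * x a ^ (n - 1)) * \<omega>' h" for h
  proof -
    let ?Z = "\<lambda>m. zagier_sum m (x a) (\<lambda>k. P k a)"
    have A: "(\<Sum>k<n. of_real (zagier_beta k * (real k * Re (\<omega> h) * x a ^ (k - 1))) * P (n - k) a)
        = of_real (Re (\<omega> h)) * (\<Sum>j<N. of_real (real (Suc j) * zagier_beta (Suc j) * x a ^ j) * P (N - j) a)"
      by (simp add: N sum.lessThan_Suc_shift sum_distrib_left algebra_simps del: of_nat_Suc sum.lessThan_Suc)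
    have B: "(\<Sum>k<n. of_real (zagier_beta k * x a ^ k) * dP (n - k) h)
        = \<omega> h * ?Z N - of_real (zagier_beta N * x a ^ N) * \<omega>' h"
    proof -
      have "(\<Sum>k<n. of_real (zagier_beta k * x a ^ k) * dP (n - k) h)
        = (\<Sum>k<N. of_real (zagier_beta k * x a ^ k) * dP (n - k) h) + of_real (zagier_beta N * x a ^ N) * dP 1 h"
        by (simp add: N)
      also have "(\<Sum>k<N. of_real (zagier_beta k * x a ^ k) * dP (n - k) h) = \<omega> h * ?Z N"
        unfolding zagier_sum_def sum_distrib_left
        by (rule sum.cong) (auto simp: dP_def N algebra_simps Suc_diff_le)
      finally show ?thesis by (simp add: dP_def)
    qed
    have C: "r * S + (w * Z - c) = r * (Z + S) + i * Z - c" if "w = r + i" for r S w Z c i :: complex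
      unfolding that by (simp add: algebra_simps)
    have "(\<Sum>k<n. of_real (zagier_beta k * (real k * Re (\<omega> h) * x a ^ (k - 1))) * P (n - k) a
          + of_real (zagier_beta k * x a ^ k) * dP (n - k) h)
       = of_real (Re (\<omega> h)) * (?Z N + (\<Sum>j<N. of_real (real (Suc j) * zagier_beta (Suc j) * x a ^ j) * P (N - j) a))
         + \<i> * of_real (Im (\<omega> h)) * ?Z N - of_real (zagier_beta N * x a ^ N) * \<omega>' h"
      unfolding sum.distrib A B by (rule C) (rule complex_eq)
    also have "\<dots> = \<i> * of_real (Im (\<omega> h)) * ?Z N
        - (\<Sum>k = 2..N. of_real (zagier_beta k * x a ^ (k - 1) * Re (\<omega> h)) * ?Z (n - k))
        - of_real (zagier_beta N * x a ^ N) * \<omega>' h"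
      unfolding zagier_sum_resummation[of N "x a" "\<lambda>k. P k a"]
      by (simp add: N sum_distrib_left algebra_simps)
    finally show ?thesis by (simp add: N atLeastLessThanSuc_atLeastAtMost)
  qed
  ultimately show ?thesis by simp
qed

text \<open>
  The sign in the passage from \<open>Re_Im n\<close> of \<open>\<i> w\<close> to the complementary part of w.
\<close>

definition Re_Im_sign :: "nat \<Rightarrow> real" where
  "Re_Im_sign n = (if odd n then - 1 else 1)"

lemma bounded_linear_Re_Im: "bounded_linear (Re_Im n)"
  by (cases "odd n") (auto simp: Re_Im_def[abs_def] bounded_linear_Re bounded_linear_Im)

lemma Re_Im_diff: "Re_Im n (u - w) = Re_Im n u - Re_Im n w"
  by (simp add: Re_Im_def)

lemma Re_Im_sum: "Re_Im n (sum f K) = (\<Sum>k\<in>K. Re_Im n (f k))"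
  by (simp add: Re_Im_def)

lemma Re_Im_of_real_mult: "Re_Im n (of_real c * w) = c * Re_Im n w"
  by (simp add: Re_Im_def)

lemma Re_Im_ii_mult: "n \<ge> 1 \<Longrightarrow> Re_Im n (\<i> * w) = Re_Im_sign n * Re_Im (n - 1) w"
  by (auto simp: Re_Im_def Re_Im_sign_def)

text \<open>
  The differential of the single-valued polylogarithm of weight n, where x is the value of
  \<open>log|z|\<close>, M lists the values in the lower weights (with M 1 equal to
  \<open>- log|1 - z|\<close>), and \<open>\<omega>\<close>, \<open>\<omega>'\<close> are
  the values of dlog z and dlog (1 - z) on a tangent vector. In the last summand x and M 1 occur in the
  antisymmetric combination of (z) and (1 - z) that the relations defining the target of the sequence detect.
\<close>

definition polylog_form :: "nat \<Rightarrow> real \<Rightarrow> (nat \<Rightarrow> real) \<Rightarrow> complex \<Rightarrow> complex \<Rightarrow> real" where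
  "polylog_form n x M \<omega> \<omega>' =
     (if n = 2 then x * Im \<omega>' + M 1 * Im \<omega>
      else Re_Im_sign n * M (n - 1) * Im \<omega>
         - (\<Sum>k = 2..<n - 1. zagier_beta k * x ^ (k - 1) * M (n - k)) * Re \<omega>
         - zagier_beta (n - 1) * x ^ (n - 2) * (x * Re \<omega>' + M 1 * Re \<omega>))"

text \<open>
  The sums of lower weight n - k come with the real or imaginary part belonging to n. Since the
  coefficient of index k vanishes for odd k at least 3, this is the part belonging to n - k wherever it
  matters, so that only the single-valued functions of lower weight remain.
\<close>

lemma has_derivative_Re_Im_zagier_sum:
  fixes x :: "'a::real_normed_vector \<Rightarrow> real" and P :: "nat \<Rightarrow> 'a \<Rightarrow> complex"
  assumes x: "(x has_derivative (\<lambda>h. Re (\<omega> h))) (at a within A)"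
    and P1: "(P 1 has_derivative (\<lambda>h. - \<omega>' h)) (at a within A)"
    and P: "\<And>k. 2 \<le> k \<Longrightarrow> k \<le> n \<Longrightarrow> (P k has_derivative (\<lambda>h. P (k - 1) a * \<omega> h)) (at a within A)"
    and n: "n \<ge> 2"
  shows "((\<lambda>b. Re_Im n (zagier_sum n (x b) (\<lambda>k. P k b))) has_derivative
     (\<lambda>h. polylog_form n (x a) (\<lambda>m. Re_Im m (zagier_sum m (x a) (\<lambda>k. P k a))) (\<omega> h) (\<omega>' h)))
     (at a within A)"
proof -
  let ?Z = "\<lambda>m. zagier_sum m (x a) (\<lambda>k. P k a)"
  let ?M = "\<lambda>m. Re_Im m (?Z m)"
  have "Re_Im n (\<i> * of_real (Im (\<omega> h)) * ?Z (n - 1)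
        - (\<Sum>k = 2..<n. of_real (zagier_beta k * x a ^ (k - 1) * Re (\<omega> h)) * ?Z (n - k))
        - of_real (zagier_beta (n - 1) * x a ^ (n - 1)) * \<omega>' h)
      = polylog_form n (x a) ?M (\<omega> h) (\<omega>' h)" (is "?L = ?R") for h
  proof -
    have "Re_Im n (\<i> * of_real (Im (\<omega> h)) * ?Z (n - 1)) = Re_Im_sign n * ?M (n - 1) * Im (\<omega> h)"
      using Re_Im_ii_mult[of n "of_real (Im (\<omega> h)) * ?Z (n - 1)"] n
      by (simp add: Re_Im_of_real_mult mult.assoc)
    moreover have "Re_Im n (\<Sum>k = 2..<n. of_real (zagier_beta k * x a ^ (k - 1) * Re (\<omega> h)) * ?Z (n - k))
        = (\<Sum>k = 2..<n. zagier_beta k * x a ^ (k - 1) * Re (\<omega> h) * Re_Im n (?Z (n - k)))"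
      by (simp add: Re_Im_sum Re_Im_of_real_mult del: of_real_mult)
    moreover have "Re_Im n (of_real (zagier_beta (n - 1) * x a ^ (n - 1)) * \<omega>' h)
        = zagier_beta (n - 1) * x a ^ (n - 1) * Re_Im n (\<omega>' h)"
      by (rule Re_Im_of_real_mult)
    ultimately have L: "?L = Re_Im_sign n * ?M (n - 1) * Im (\<omega> h)
        - (\<Sum>k = 2..<n. zagier_beta k * x a ^ (k - 1) * Re (\<omega> h) * Re_Im n (?Z (n - k)))
        - zagier_beta (n - 1) * x a ^ (n - 1) * Re_Im n (\<omega>' h)"
      by (simp add: Re_Im_diff)
    \<comment> \<open>The parities of n and n - k agree unless the coefficient is 0.\<close>
    have parity: "zagier_beta k * Re_Im n w = zagier_beta k * Re_Im (n - k) w" if "2 \<le> k" "k < n" for k w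
    proof (cases "even k")
      case True then show ?thesis using that by (simp add: Re_Im_def)
    next
      case False
      then have "k \<ge> 3" using that by (cases "k = 2") auto
      then show ?thesis using False by (simp add: zagier_beta_odd_eq_0)
    qed
    have "(\<Sum>k = 2..<n. zagier_beta k * x a ^ (k - 1) * Re (\<omega> h) * Re_Im n (?Z (n - k)))
        = (\<Sum>k = 2..<n. zagier_beta k * x a ^ (k - 1) * ?M (n - k)) * Re (\<omega> h)"
      unfolding sum_distrib_right
    proof (rule sum.cong[OF refl])
      fix k assume "k \<in> {2..<n}"
      then show "zagier_beta k * x a ^ (k - 1) * Re (\<omega> h) * Re_Im n (?Z (n - k))
          = zagier_beta k * x a ^ (k - 1) * ?M (n - k) * Re (\<omega> h)"
        using parity[of k "?Z (n - k)"] by (simp add: algebra_simps) (metis mult.left_commute)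
    qed
    note L = L[unfolded this]
    show ?thesis
    proof (cases "n = 2")
      case True
      then show ?thesis unfolding L by (simp add: polylog_form_def Re_Im_sign_def Re_Im_def)
    next
      case False
      then have n3: "n \<ge> 3" using n by simp
      then have split: "{2..<n} = insert (n - 1) {2..<n - 1}" by auto
      have "x a ^ (n - 1) = x a * x a ^ (n - 2)"
        using n by (simp add: power_Suc[symmetric] del: power_Suc) (simp add: Suc_diff_Suc numeral_2_eq_2)
      moreover have "zagier_beta (n - 1) * Re_Im n (\<omega>' h) = zagier_beta (n - 1) * Re (\<omega>' h)"
        using parity[of "n - 1" "\<omega>' h"] n3 by (simp add: Re_Im_def)
      moreover have "n - 1 - 1 = n - 2" "n - (n - 1) = 1" using n by auto
      ultimately show ?thesis
        using n3 unfolding L by (auto simp: split polylog_form_def algebra_simps)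
    qed
  qed
  with bounded_linear.has_derivative[OF bounded_linear_Re_Im has_derivative_zagier_sum[OF assms], of n] show ?thesis
    by simp
qed

section \<open>Symmetric powers and closed polynomial forms\<close>

lemma lookup_qscale [simp]: "Poly_Mapping.lookup (qscale c x) k = c * Poly_Mapping.lookup x k"
  by (simp add: qscale_def Poly_Mapping.map.rep_eq when_def)

lemma lookup_lin_ext:
  "Poly_Mapping.lookup (lin_ext f x) k = (\<Sum>s\<in>Poly_Mapping.keys x. Poly_Mapping.lookup x s * Poly_Mapping.lookup (f s) k)"
  by (simp add: lin_ext_def lookup_sum)

lemma lookup_lin_ext_superset:
  assumes "finite K" "Poly_Mapping.keys x \<subseteq> K"
  shows "Poly_Mapping.lookup (lin_ext f x) k = (\<Sum>s\<in>K. Poly_Mapping.lookup x s * Poly_Mapping.lookup (f s) k)"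
  unfolding lookup_lin_ext using assms
  by (intro sum.mono_neutral_left) (auto simp: in_keys_iff)

lemma lin_ext_add: "lin_ext f (x + y) = lin_ext f x + lin_ext f y"
proof (rule poly_mapping_eqI)
  fix k
  let ?K = "Poly_Mapping.keys x \<union> Poly_Mapping.keys y"
  have "Poly_Mapping.keys (x + y) \<subseteq> ?K" by (rule Poly_Mapping.keys_add)
  then show "Poly_Mapping.lookup (lin_ext f (x + y)) k = Poly_Mapping.lookup (lin_ext f x + lin_ext f y) k"
    by (simp add: lookup_lin_ext_superset[of ?K] lookup_add sum.distrib distrib_right)
qed

lemma lookup_tensor: "Poly_Mapping.lookup (x \<otimes>\<^sub>Q y) (s, r) = Poly_Mapping.lookup x s * Poly_Mapping.lookup y r"
proof -
  have "Poly_Mapping.lookup (lin_ext (\<lambda>r. basis (s', r)) y) (s, r) = (if s' = s then Poly_Mapping.lookup y r else 0)" for s'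
    by (auto simp: lookup_lin_ext lookup_single when_def in_keys_iff if_distrib cong: if_cong)
  then have "Poly_Mapping.lookup (x \<otimes>\<^sub>Q y) (s, r)
      = (\<Sum>s'\<in>Poly_Mapping.keys x. if s' = s then Poly_Mapping.lookup x s * Poly_Mapping.lookup y r else 0)"
    unfolding tensor_def lookup_lin_ext[of _ x] by (intro sum.cong) auto
  then show ?thesis by (simp add: in_keys_iff)
qed

lemma lookup_to_sym: "Poly_Mapping.lookup (to_sym x) m = (\<Sum>p\<in>Poly_Mapping.keys x. if m = {#p#} then Poly_Mapping.lookup x p else 0)"
  by (simp add: to_sym_def lookup_lin_ext lookup_single when_def if_distrib eq_commute cong: if_cong)

lemma lookup_to_sym_mult:
  "Poly_Mapping.lookup (to_sym x * f) m = (\<Sum>p\<in>set_mset m. Poly_Mapping.lookup x p * Poly_Mapping.lookup f (m - {#p#}))"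
proof -
  have "to_sym x = (\<Sum>p\<in>Poly_Mapping.keys x. Poly_Mapping.single {#p#} (Poly_Mapping.lookup x p))"
    by (rule poly_mapping_eqI)
      (auto simp: lookup_to_sym lookup_sum lookup_single when_def intro!: sum.cong)
  then have "Poly_Mapping.lookup (to_sym x * f) m = (\<Sum>p\<in>Poly_Mapping.keys x. Poly_Mapping.lookup (Poly_Mapping.single {#p#} (Poly_Mapping.lookup x p) * f) m)"
    by (simp add: sum_distrib_right lookup_sum)
  also have "\<dots> = (\<Sum>p\<in>Poly_Mapping.keys x. if p \<in># m then Poly_Mapping.lookup x p * Poly_Mapping.lookup f (m - {#p#}) else 0)"
  proof (rule sum.cong[OF refl])
    fix p
    have "Poly_Mapping.lookup (Poly_Mapping.single {#p#} c * f) m = (if p \<in># m then c * Poly_Mapping.lookup f (m - {#p#}) else 0)" for c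
    proof -
      have "Poly_Mapping.lookup (Poly_Mapping.single {#p#} c * f) m
          = (\<Sum>l. (c * (\<Sum>q. Poly_Mapping.lookup f q when m = l + q)) when {#p#} = l)"
        unfolding lookup_mult by (simp add: lookup_single mult_when when_mult)
      also have "\<dots> = c * (\<Sum>q. Poly_Mapping.lookup f q when m = {#p#} + q)"
        by simp
      also have "(\<Sum>q. Poly_Mapping.lookup f q when m = {#p#} + q) = (if p \<in># m then Poly_Mapping.lookup f (m - {#p#}) else 0)"
      proof (cases "p \<in># m")
        case True
        then have "(m = {#p#} + q) = (q = m - {#p#})" for q by auto
        then show ?thesis using True by simp
      next
        case False
        then have "m \<noteq> {#p#} + q" for q by auto
        then show ?thesis using False by simp
      qed
      finally show ?thesis by simp
    qed
    then show "Poly_Mapping.lookup (Poly_Mapping.single {#p#} (Poly_Mapping.lookup x p) * f) m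
        = (if p \<in># m then Poly_Mapping.lookup x p * Poly_Mapping.lookup f (m - {#p#}) else 0)" .
  qed
  also have "\<dots> = (\<Sum>p\<in>Poly_Mapping.keys x \<inter> set_mset m. Poly_Mapping.lookup x p * Poly_Mapping.lookup f (m - {#p#}))"
    by (simp add: sum.If_cases)
  also have "\<dots> = (\<Sum>p\<in>set_mset m. Poly_Mapping.lookup x p * Poly_Mapping.lookup f (m - {#p#}))"
    by (rule sum.mono_neutral_left) (auto simp: in_keys_iff)
  finally show ?thesis .
qed

text \<open>
  The product of the factorials of the multiplicities. Multiplied by it, the coefficients of the power of
  a linear form lose their multinomial denominators, so that no division by multinomials is needed.
\<close>

definition mset_fact :: "'p multiset \<Rightarrow> rat" where
  "mset_fact m = (\<Prod>p\<in>set_mset m. fact (count m p))"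

lemma mset_fact_nz: "mset_fact m \<noteq> 0"
  by (simp add: mset_fact_def)

lemma mset_fact_add_mset: "mset_fact (add_mset p m) = of_nat (count m p + 1) * mset_fact m"
proof -
  have "mset_fact (add_mset p m) = fact (count m p + 1) * (\<Prod>q\<in>set_mset m - {p}. fact (count m q))"
    unfolding mset_fact_def
    by (simp add: prod.insert_remove) (intro arg_cong2[where f = "(*)"] prod.cong, auto)
  also have "\<dots> = of_nat (count m p + 1) * (fact (count m p) * (\<Prod>q\<in>set_mset m - {p}. fact (count m q)))"
    by (simp add: algebra_simps)
  also have "fact (count m p) * (\<Prod>q\<in>set_mset m - {p}. fact (count m q)) = mset_fact m"
    by (cases "p \<in># m") (simp_all add: mset_fact_def prod.remove[of "set_mset m" p] not_in_iff[THEN iffD1])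
  finally show ?thesis .
qed

text \<open>
  The multinomial theorem, by induction over the exponent: each p in m contributes as often as it occurs
  in m, and these multiplicities add up to the size of m.
\<close>

lemma lookup_to_sym_power:
  "mset_fact m * Poly_Mapping.lookup (to_sym x ^ N) m
     = (if size m = N then fact N * (\<Prod>p\<in>#m. Poly_Mapping.lookup x p) else 0)"
proof (induction N arbitrary: m)
  case 0
  then show ?case by (auto simp: lookup_one when_def mset_fact_def)
next
  case (Suc N)
  have "mset_fact m * Poly_Mapping.lookup (to_sym x ^ Suc N) m
      = (\<Sum>p\<in>set_mset m. mset_fact m * (Poly_Mapping.lookup x p * Poly_Mapping.lookup (to_sym x ^ N) (m - {#p#})))"
    by (simp add: lookup_to_sym_mult sum_distrib_left)
  also have "\<dots> = (\<Sum>p\<in>set_mset m. of_nat (count m p) *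
      (if size m = Suc N then fact N * (\<Prod>p\<in>#m. Poly_Mapping.lookup x p) else 0))"
  proof (rule sum.cong[OF refl])
    fix p assume "p \<in> set_mset m"
    then obtain m' where m: "m = add_mset p m'" by (meson mset_add)
    show "mset_fact m * (Poly_Mapping.lookup x p * Poly_Mapping.lookup (to_sym x ^ N) (m - {#p#}))
        = of_nat (count m p) * (if size m = Suc N then fact N * (\<Prod>p\<in>#m. Poly_Mapping.lookup x p) else 0)"
    proof (cases "size m' = N")
      case True
      then show ?thesis using Suc[of m'] by (simp add: m mset_fact_add_mset algebra_simps)
    next
      case False
      then show ?thesis using Suc[of m'] by (simp add: m mset_fact_nz)
    qed
  qed
  also have "\<dots> = of_nat (size m) * (if size m = Suc N then fact N * (\<Prod>p\<in>#m. Poly_Mapping.lookup x p) else 0)"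
    by (simp add: sum_distrib_right[symmetric] size_multiset_overloaded_eq)
  also have "\<dots> = (if size m = Suc N then fact (Suc N) * (\<Prod>p\<in>#m. Poly_Mapping.lookup x p) else 0)"
    by simp
  finally show ?case .
qed

lemma lookup_sym_embed:
  "Poly_Mapping.lookup (sym_embed f) (m, p) = of_nat (count m p + 1) * Poly_Mapping.lookup f (add_mset p m)"
proof -
  have "Poly_Mapping.lookup (\<Sum>q\<in>#m'. basis (m' - {#q#}) \<otimes>\<^sub>Q basis q) (m, p)
      = (if m' = add_mset p m then of_nat (count m p + 1) else 0)" for m' :: "'a multiset"
  proof -
    have l: "Poly_Mapping.lookup (\<Sum>q\<in>#M. h q) k = (\<Sum>q\<in>#M. Poly_Mapping.lookup (h q) k)"
      for h :: "'a \<Rightarrow> 'a multiset \<times> 'a \<Rightarrow>\<^sub>0 rat" and M k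
      by (induction M) (auto simp: lookup_add)
    have "Poly_Mapping.lookup (\<Sum>q\<in>#m'. basis (m' - {#q#}) \<otimes>\<^sub>Q basis q) (m, p)
        = (\<Sum>q\<in>#m'. if q = p \<and> m' - {#q#} = m then 1 else 0)"
      unfolding l by (auto simp: lookup_tensor lookup_single when_def intro!: arg_cong[where f = sum_mset] image_mset_cong)
    also have "\<dots> = (\<Sum>q\<in>#m'. if q = p then (if m' - {#p#} = m then 1 else 0) else 0)"
      by (intro arg_cong[where f = sum_mset] image_mset_cong) auto
    also have "\<dots> = (if m' - {#p#} = m then of_nat (count m' p) else 0)"
      by (simp add: sum_mset_delta)
    also have "\<dots> = (if m' = add_mset p m then of_nat (count m p + 1) else 0)"
    proof (cases "p \<in># m'")
      case True
      then obtain m'' where "m' = add_mset p m''" by (meson mset_add)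
      then show ?thesis by simp
    next
      case False
      then have "count m' p = 0" "m' \<noteq> add_mset p m" by (auto simp: not_in_iff)
      then show ?thesis by simp
    qed
    finally show ?thesis .
  qed
  then have "Poly_Mapping.lookup (sym_embed f) (m, p)
      = (\<Sum>m'\<in>Poly_Mapping.keys f. if m' = add_mset p m
           then of_nat (count m p + 1) * Poly_Mapping.lookup f (add_mset p m) else 0)"
    unfolding sym_embed_def lookup_lin_ext by (intro sum.cong) auto
  then show ?thesis by (simp add: in_keys_iff)
qed

text \<open>
  An element of the tensor product of the symmetric algebra with V is a differential 1-form with polynomial
  coefficients on the dual of V, and \<open>sym_embed\<close> is the exterior derivative of polynomials. The right side
  says that the form z is closed, so this is the Poincare lemma. A primitive of a closed form of degree n is obtained by
  contracting with the Euler vector field and dividing by n.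
\<close>

lemma in_sym_embed_image_iff:
  assumes n: "n \<ge> 2" and z: "z \<in> Sym_tensor (n - 1)"
  shows "z \<in> sym_embed ` Sym n \<longleftrightarrow>
    (\<forall>m p q. size m = n - 2 \<longrightarrow>
       of_nat (count m q + 1) * Poly_Mapping.lookup z (add_mset q m, p)
         = of_nat (count m p + 1) * Poly_Mapping.lookup z (add_mset p m, q))" (is "_ \<longleftrightarrow> ?closed")
proof
  assume "z \<in> sym_embed ` Sym n"
  then obtain f where "z = sym_embed f" by auto
  then show ?closed by (auto simp: lookup_sym_embed algebra_simps add_mset_commute)
next
  assume closed: ?closed
  \<comment> \<open>The contraction of z with the Euler field, divided by the total degree n.\<close>
  define Q where "Q m = (if size m = n then (\<Sum>p\<in>set_mset m. Poly_Mapping.lookup z (m - {#p#}, p)) / of_nat n else 0)" for m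
  have Q_nz: "\<exists>p. p \<in># m \<and> (m - {#p#}, p) \<in> Poly_Mapping.keys z" if "Q m \<noteq> 0" for m
  proof -
    have "(\<Sum>p\<in>set_mset m. Poly_Mapping.lookup z (m - {#p#}, p)) \<noteq> 0"
      using that by (auto simp: Q_def split: if_splits)
    from sum.not_neutral_contains_not_neutral[OF this] show ?thesis by (auto simp: in_keys_iff)
  qed
  have "finite {m. Q m \<noteq> 0}"
  proof (rule finite_subset)
    show "{m. Q m \<noteq> 0} \<subseteq> (\<lambda>(m, p). add_mset p m) ` Poly_Mapping.keys z"
    proof
      fix m assume "m \<in> {m. Q m \<noteq> 0}"
      then obtain p where "p \<in># m" "(m - {#p#}, p) \<in> Poly_Mapping.keys z" using Q_nz by blast
      then show "m \<in> (\<lambda>(m, p). add_mset p m) ` Poly_Mapping.keys z"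
        by (intro image_eqI[of _ _ "(m - {#p#}, p)"]) auto
    qed
  qed auto
  then have lookup_Q: "Poly_Mapping.lookup (Abs_poly_mapping Q) = Q" by simp
  have "sym_embed (Abs_poly_mapping Q) = z"
  proof (rule poly_mapping_eqI, safe)
    fix m p
    show "Poly_Mapping.lookup (sym_embed (Abs_poly_mapping Q)) (m, p) = Poly_Mapping.lookup z (m, p)"
    proof (cases "size m = n - 1")
      case False
      then have "Poly_Mapping.lookup z (m, p) = 0"
        using z by (auto simp: Sym_tensor_def qspan_def in_keys_iff)
      then show ?thesis using False n by (auto simp: lookup_sym_embed lookup_Q Q_def)
    next
      case True
      have swap: "of_nat (count m p + 1) * Poly_Mapping.lookup z (add_mset p m - {#q#}, q)
          = of_nat (count (add_mset p m) q) * Poly_Mapping.lookup z (m, p)"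
        if q: "q \<in># add_mset p m" for q
      proof (cases "q = p")
        case False
        then obtain m' where m: "m = add_mset q m'" using q by (auto dest: mset_add)
        have "size m' = n - 2" using True m n by simp
        then have "of_nat (count m' q + 1) * Poly_Mapping.lookup z (add_mset q m', p)
           = of_nat (count m' p + 1) * Poly_Mapping.lookup z (add_mset p m', q)"
          using closed by blast
        then show ?thesis using False by (simp add: m)
      qed auto
      have "Poly_Mapping.lookup (sym_embed (Abs_poly_mapping Q)) (m, p)
          = (\<Sum>q\<in>set_mset (add_mset p m). of_nat (count m p + 1) * Poly_Mapping.lookup z (add_mset p m - {#q#}, q)) / of_nat n"
        using True n by (simp add: lookup_sym_embed lookup_Q Q_def sum_distrib_left)
      also have "(\<Sum>q\<in>set_mset (add_mset p m). of_nat (count m p + 1) * Poly_Mapping.lookup z (add_mset p m - {#q#}, q))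
          = (\<Sum>q\<in>set_mset (add_mset p m). of_nat (count (add_mset p m) q) * Poly_Mapping.lookup z (m, p))"
        by (rule sum.cong[OF refl], rule swap)
      also have "\<dots> = of_nat (size (add_mset p m)) * Poly_Mapping.lookup z (m, p)"
        by (simp only: sum_distrib_right[symmetric] size_multiset_overloaded_eq of_nat_sum)
      finally show ?thesis using True n by simp
    qed
  qed
  moreover have "Abs_poly_mapping Q \<in> Sym n"
    by (auto simp: Sym_def qspan_def in_keys_iff lookup_Q Q_def split: if_splits)
  ultimately show "z \<in> sym_embed ` Sym n" by blast
qed

lemma J_gen_in_Sym_tensor: "n \<ge> 1 \<Longrightarrow> J_gen n \<phi> \<in> Sym_tensor (n - 1)"
proof -
  have "size m = N" if "Poly_Mapping.lookup (to_sym x ^ N) m \<noteq> 0" for x :: "complex \<Rightarrow>\<^sub>0 rat" and N m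
    using that lookup_to_sym_power[of m x N] mset_fact_nz[of m] by (auto split: if_splits)
  then show "n \<ge> 1 \<Longrightarrow> ?thesis"
    by (auto simp: J_gen_def Sym_tensor_def qspan_def in_keys_iff lookup_tensor lookup_one when_def
        split: if_splits)
qed

lemma qspan_lin_ext:
  assumes "\<And>s. f s \<in> qspan S"
  shows "lin_ext f x \<in> qspan S"
proof -
  have "Poly_Mapping.lookup (lin_ext f x) k = 0" if "k \<notin> S" for k
    using assms that unfolding lookup_lin_ext qspan_def
    by (intro sum.neutral) (auto simp: in_keys_iff subset_iff)
  then show ?thesis by (auto simp: qspan_def in_keys_iff)
qed

lemma lin_ext_J_gen_in_Sym_tensor: "n \<ge> 1 \<Longrightarrow> lin_ext (J_gen n) x \<in> Sym_tensor (n - 1)"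
  using J_gen_in_Sym_tensor[of n] by (auto simp: Sym_tensor_def intro!: qspan_lin_ext)

text \<open>
  The form attached to \<open>\<phi>\<close> is \<open>l ^ (n - 1) dl'\<close>, where l and
  l' are the linear forms given by the divisors of \<open>\<phi>\<close> and of \<open>1 - \<phi>\<close>.
  Up to the factor n - 1 its exterior derivative is \<open>l ^ (n - 2) dl \<and> dl'\<close>. The right side lists, up to
  multinomial factors, the coefficients of the weighted sum of these 2-forms.
\<close>

lemma lin_ext_J_gen_in_S_relations_iff:
  fixes x :: "ratfun \<Rightarrow>\<^sub>0 rat"
  defines "\<Phi> \<equiv> Poly_Mapping.keys x - {0, 1}"
  assumes n: "n \<ge> 2"
  shows "lin_ext (J_gen n) x \<in> S_relations n \<longleftrightarrow>
    (\<forall>m p q. size m = n - 2 \<longrightarrow>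
      (\<Sum>\<phi>\<in>\<Phi>. Poly_Mapping.lookup x \<phi> * (\<Prod>r\<in>#m. Poly_Mapping.lookup (ratfun_divisor \<phi>) r)
         * (Poly_Mapping.lookup (ratfun_divisor \<phi>) p * Poly_Mapping.lookup (ratfun_divisor (1 - \<phi>)) q
            - Poly_Mapping.lookup (ratfun_divisor \<phi>) q * Poly_Mapping.lookup (ratfun_divisor (1 - \<phi>)) p)) = 0)"
proof -
  let ?D = "\<lambda>\<phi>. Poly_Mapping.lookup (ratfun_divisor \<phi>)" and ?D' = "\<lambda>\<phi>. Poly_Mapping.lookup (ratfun_divisor (1 - \<phi>))"
  let ?z = "lin_ext (J_gen n) x"
  have z: "Poly_Mapping.lookup ?z (m, p) = (\<Sum>\<phi>\<in>\<Phi>. Poly_Mapping.lookup x \<phi> * (Poly_Mapping.lookup (to_sym (ratfun_divisor \<phi>) ^ (n - 1)) m * ?D' \<phi> p))" for m p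
    unfolding lookup_lin_ext \<Phi>_def using n
    by (intro sum.mono_neutral_cong_right) (auto simp: J_gen_def lookup_tensor)
  have coeff: "mset_fact m * (of_nat (count m q + 1) * Poly_Mapping.lookup ?z (add_mset q m, p))
      = fact (n - 1) * (\<Sum>\<phi>\<in>\<Phi>. Poly_Mapping.lookup x \<phi> * (\<Prod>r\<in>#m. ?D \<phi> r) * (?D \<phi> q * ?D' \<phi> p))"
    if m: "size m = n - 2" for m p q
  proof -
    have "mset_fact m * (of_nat (count m q + 1) * Poly_Mapping.lookup ?z (add_mset q m, p))
        = mset_fact (add_mset q m) * Poly_Mapping.lookup ?z (add_mset q m, p)"
      by (simp only: mset_fact_add_mset mult_ac)
    also have "\<dots> = (\<Sum>\<phi>\<in>\<Phi>. Poly_Mapping.lookup x \<phi> * (mset_fact (add_mset q m) * Poly_Mapping.lookup (to_sym (ratfun_divisor \<phi>) ^ (n - 1)) (add_mset q m)) * ?D' \<phi> p)"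
      by (simp add: z sum_distrib_left algebra_simps)
    also have "\<dots> = fact (n - 1) * (\<Sum>\<phi>\<in>\<Phi>. Poly_Mapping.lookup x \<phi> * (\<Prod>r\<in>#m. ?D \<phi> r) * (?D \<phi> q * ?D' \<phi> p))"
    proof -
      have "size (add_mset q m) = n - 1" using m n by simp
      then show ?thesis
        unfolding lookup_to_sym_power by (simp add: sum_distrib_left algebra_simps)
    qed
    finally show ?thesis .
  qed
  have eq: "of_nat (count m q + 1) * Poly_Mapping.lookup ?z (add_mset q m, p) = of_nat (count m p + 1) * Poly_Mapping.lookup ?z (add_mset p m, q)
      \<longleftrightarrow> (\<Sum>\<phi>\<in>\<Phi>. Poly_Mapping.lookup x \<phi> * (\<Prod>r\<in>#m. ?D \<phi> r) * (?D \<phi> p * ?D' \<phi> q - ?D \<phi> q * ?D' \<phi> p)) = 0"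
    (is "?l = ?r \<longleftrightarrow> ?s = 0") if m: "size m = n - 2" for m p q
  proof -
    have "?l = ?r \<longleftrightarrow> mset_fact m * ?r - mset_fact m * ?l = 0" using mset_fact_nz[of m] by auto
    also have "mset_fact m * ?r - mset_fact m * ?l = fact (n - 1) * ?s"
      unfolding coeff[OF m] by (simp add: sum_subtractf algebra_simps)
    finally show ?thesis by simp
  qed
  have "?z \<in> S_relations n \<longleftrightarrow> ?z \<in> sym_embed ` Sym n" using n by (simp add: S_relations_def)
  also have "\<dots> \<longleftrightarrow> (\<forall>m p q. size m = n - 2 \<longrightarrow>
       of_nat (count m q + 1) * Poly_Mapping.lookup ?z (add_mset q m, p) = of_nat (count m p + 1) * Poly_Mapping.lookup ?z (add_mset p m, q))"
    using n by (intro in_sym_embed_image_iff lin_ext_J_gen_in_Sym_tensor) auto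
  finally show ?thesis using eq by blast
qed

section \<open>Polylogarithms on the slit plane and along the ray beyond 1\<close>

definition slit_plane :: "complex set" where
  "slit_plane = {z. Im z = 0 \<longrightarrow> Re z < 1}"

lemma open_slit_plane: "open slit_plane"
proof -
  have "slit_plane = - ({z. Im z = 0} \<inter> {z. Re z \<ge> 1})" by (auto simp: slit_plane_def)
  moreover have "closed ({z. Im z = 0} \<inter> {z. Re z \<ge> 1})"
    by (intro closed_Int closed_Collect_eq closed_Collect_le continuous_intros)
  ultimately show ?thesis by (metis open_Compl)
qed

lemma closed_segment_0_slit_plane:
  assumes "z \<in> slit_plane"
  shows "closed_segment 0 z \<subseteq> slit_plane"
proof
  fix w assume "w \<in> closed_segment 0 z"
  then obtain u where u: "0 \<le> u" "u \<le> 1" "w = of_real u * z"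
    by (auto simp: in_segment scaleR_conv_of_real)
  show "w \<in> slit_plane"
  proof (cases "u = 0 \<or> Im z \<noteq> 0")
    case True
    then show ?thesis using u by (auto simp: slit_plane_def)
  next
    case False
    then have "Re z < 1" using assms by (auto simp: slit_plane_def)
    moreover have "u * Re z \<le> max 0 (Re z)"
      using u by (cases "Re z \<le> 0") (auto simp: mult_nonneg_nonpos mult_left_le_one_le)
    ultimately have "u * Re z < 1" by linarith
    then show ?thesis using u by (auto simp: slit_plane_def)
  qed
qed

lemma zero_in_slit_plane [simp]: "0 \<in> slit_plane"
  by (simp add: slit_plane_def)

lemma starlike_slit_plane: "starlike slit_plane"
  unfolding starlike_def using closed_segment_0_slit_plane zero_in_slit_plane by blast

lemma polylog_0: "n \<ge> 1 \<Longrightarrow> polylog n 0 = 0"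
  by (cases n; cases "n - 1") auto

lemma one_minus_notin_nonpos_Reals: "z \<in> slit_plane \<Longrightarrow> 1 - z \<notin> \<real>\<^sub>\<le>\<^sub>0"
  by (auto simp: slit_plane_def complex_nonpos_Reals_iff)

lemma polylog_1_has_field_derivative:
  assumes "z \<in> slit_plane"
  shows "(polylog 1 has_field_derivative 1 / (1 - z)) (at z)"
proof -
  have "((\<lambda>z. - Ln (1 - z)) has_field_derivative 1 / (1 - z)) (at z)"
    using one_minus_notin_nonpos_Reals[OF assms]
    by (auto intro!: derivative_eq_intros simp: field_simps)
  moreover have "polylog 1 = (\<lambda>z. - Ln (1 - z))" by (simp add: fun_eq_iff)
  ultimately show ?thesis by simp
qed

lemma has_contour_integral_linepath_cong_start:
  assumes "(F has_contour_integral I) (linepath 0 z)"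
    and "\<And>t. t \<in> closed_segment 0 z \<Longrightarrow> t \<noteq> 0 \<Longrightarrow> f t = F t"
  shows "(f has_contour_integral I) (linepath 0 z)"
proof -
  have "((\<lambda>x. F (linepath 0 z x) * (z - 0)) has_integral I) {0..1}"
    using assms(1) by (simp add: has_contour_integral_linepath)
  then have "((\<lambda>x. f (linepath 0 z x) * (z - 0)) has_integral I) {0..1}"
  proof (rule has_integral_spike_finite[of "{0}", rotated 2])
    fix x :: real assume x: "x \<in> {0..1} - {0}"
    have "linepath 0 z x \<in> closed_segment 0 z" using x linepath_in_path[of x 0 z] by auto
    then show "f (linepath 0 z x) * (z - 0) = F (linepath 0 z x) * (z - 0)"
      using assms(2)[of "linepath 0 z x"] x by (cases "z = 0") (auto simp: linepath_def)
  qed auto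
  then show ?thesis by (simp add: has_contour_integral_linepath)
qed

text \<open>
  The integrand has a removable singularity at 0, and the slit plane is starlike about 0, so a
  holomorphic primitive exists and the integral along the segment from 0 computes it.
\<close>

lemma polylog_slit_plane_step:
  assumes n: "n \<ge> 1" and hol: "polylog n holomorphic_on slit_plane"
  shows "polylog (Suc n) holomorphic_on slit_plane"
    and "\<And>z. z \<in> slit_plane \<Longrightarrow> z \<noteq> 0 \<Longrightarrow> (polylog (Suc n) has_field_derivative polylog n z / z) (at z)"
    and "\<And>z. z \<in> slit_plane \<Longrightarrow> (\<lambda>t. polylog n t / t) contour_integrable_on linepath 0 z"
proof -
  define F where "F z = (if z = 0 then deriv (polylog n) 0 else polylog n z / z)" for z
  have "(\<lambda>z. if z = 0 then deriv (polylog n) 0 else (polylog n z - polylog n 0) / (z - 0)) holomorphic_on slit_plane"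
    by (rule pole_lemma_open[OF hol open_slit_plane])
  then have F: "F holomorphic_on slit_plane"
    by (rule holomorphic_transform) (simp add: F_def polylog_0[OF n])
  obtain G where G: "\<And>z. z \<in> slit_plane \<Longrightarrow> (G has_field_derivative F z) (at z)"
    using holomorphic_starlike_primitive[OF holomorphic_on_imp_continuous_on[OF F] starlike_slit_plane
        open_slit_plane, of "{}"] F open_slit_plane
    by (auto simp: holomorphic_on_imp_differentiable_at)
  have int: "((\<lambda>t. polylog n t / t) has_contour_integral G z - G 0) (linepath 0 z)" if z: "z \<in> slit_plane" for z
  proof (rule has_contour_integral_linepath_cong_start)
    show "(F has_contour_integral G z - G 0) (linepath 0 z)"
      using contour_integral_primitive[of slit_plane G F "linepath 0 z"] G closed_segment_0_slit_plane[OF z]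
      by (auto intro: has_field_derivative_at_within)
  qed (auto simp: F_def)
  obtain l where l: "n = Suc l" using n by (cases n) auto
  have eq: "polylog (Suc n) z = G z - G 0" if "z \<in> slit_plane" for z
    using contour_integral_unique[OF int[OF that]] by (simp add: l)
  show int': "\<And>z. z \<in> slit_plane \<Longrightarrow> (\<lambda>t. polylog n t / t) contour_integrable_on linepath 0 z"
    using int by (auto simp: contour_integrable_on_def)
  have der: "(polylog (Suc n) has_field_derivative F z) (at z)" if z: "z \<in> slit_plane" for z
  proof (rule has_field_derivative_transform_within_open[OF _ open_slit_plane z])
    show "((\<lambda>z. G z - G 0) has_field_derivative F z) (at z)"
      using G[OF z] by (auto intro!: derivative_eq_intros)
  qed (simp add: eq)
  then show "polylog (Suc n) holomorphic_on slit_plane"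
    using open_slit_plane by (auto simp: holomorphic_on_open)
  show "(polylog (Suc n) has_field_derivative polylog n z / z) (at z)" if "z \<in> slit_plane" "z \<noteq> 0" for z
    using der[OF that(1)] that(2) by (simp add: F_def)
qed

lemma polylog_holomorphic: "n \<ge> 1 \<Longrightarrow> polylog n holomorphic_on slit_plane"
proof (induction n rule: dec_induct)
  case base
  show ?case using polylog_1_has_field_derivative open_slit_plane by (auto simp: holomorphic_on_open simp del: polylog.simps One_nat_def)
next
  case (step n)
  then show ?case by (intro polylog_slit_plane_step) auto
qed

lemma polylog_has_field_derivative:
  assumes "n \<ge> 2" "z \<in> slit_plane" "z \<noteq> 0"
  shows "(polylog n has_field_derivative polylog (n - 1) z / z) (at z)"
  using polylog_slit_plane_step(2)[of "n - 1" z] polylog_holomorphic[of "n - 1"] assms by simp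

lemma polylog_contour_integrable:
  assumes "n \<ge> 1" "z \<in> slit_plane"
  shows "(\<lambda>t. polylog n t / t) contour_integrable_on linepath 0 z"
  using polylog_slit_plane_step(3)[of n z] polylog_holomorphic[of n] assms by simp

lemma polylog_of_real_eq_integral:
  assumes "n \<ge> 2" "r > 0"
  shows "polylog n (of_real r) = integral {0..r} (\<lambda>t. polylog (n - 1) (of_real t) / of_real t)"
proof -
  obtain l where "n = Suc (Suc l)" using assms(1) by (metis Suc_le_D numeral_2_eq_2 Suc_le_D Suc_le_mono)
  then show ?thesis
    using contour_integral_linepath_Reals_eq[of 0 "of_real r"] assms(2) by simp
qed

text \<open>
  The dilogarithm on the closed unit interval, where the value at the endpoint 1 is given by the series. It
  serves to write down primitives that are continuous at 1.
\<close>

definition Li2_series :: "real \<Rightarrow> real" where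
  "Li2_series t = suminf (\<lambda>k. t ^ k / real k ^ 2)"

lemma continuous_on_Li2_series: "continuous_on {0..1} Li2_series"
proof -
  have "uniform_limit {0..1} (\<lambda>n t. \<Sum>k<n. t ^ k / real k ^ 2) Li2_series sequentially"
    unfolding Li2_series_def[abs_def]
  proof (rule Weierstrass_m_test)
    show "summable (\<lambda>k. 1 / real k ^ 2)" using inverse_power_summable[of 2, where 'a = real] by (simp add: inverse_eq_divide)
    show "norm (t ^ k / real k ^ 2) \<le> 1 / real k ^ 2" if "t \<in> {0..1}" for k and t :: real
      using that by (auto simp: power_le_one intro!: divide_right_mono)
  qed
  then show ?thesis
    by (rule uniform_limit_theorem[rotated])
      (auto intro!: always_eventually continuous_intros simp: divide_inverse)
qed

lemma Li2_series_eq_polylog: "t \<in> {0..<1} \<Longrightarrow> complex_of_real (Li2_series t) = polylog 2 (of_real t)"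
proof -
  assume "t \<in> {0..<1}"
  then have "(\<lambda>k. of_real t ^ k / of_nat k ^ 2) sums polylog 2 (of_real t)"
    by (intro polylog_series) auto
  then have s: "(\<lambda>k. of_real (t ^ k / real k ^ 2)) sums polylog 2 (of_real t)" by simp
  then have "(\<lambda>k. t ^ k / real k ^ 2) sums Re (polylog 2 (of_real t))"
    by (rule sums_Re[where X = "\<lambda>k. of_real (_ k)", simplified])
  then have "Li2_series t = Re (polylog 2 (of_real t))" by (simp add: Li2_series_def sums_iff)
  moreover have "Im (polylog 2 (of_real t)) = 0"
    using sums_Im[OF s] by (simp add: sums_iff)
  ultimately show ?thesis by (simp add: complex_eq_iff)
qed

lemma polylog_1_of_real_gt_1:
  assumes "t > 1"
  shows "polylog 1 (of_real t) = - of_real (ln (t - 1)) - \<i> * of_real pi"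
proof -
  have "Ln (1 - of_real t) = Ln (of_real (1 - t))" by simp
  also have "\<dots> = of_real (ln (t - 1)) + \<i> * of_real pi"
    using assms Ln_minus[of "of_real (t - 1)"] Ln_of_real[of "t - 1"] by (simp add: algebra_simps)
  finally show ?thesis by simp
qed

lemma Li2_series_has_real_derivative:
  assumes t: "t \<in> {0<..<1}"
  shows "(Li2_series has_real_derivative - ln (1 - t) / t) (at t)"
proof -
  have "of_real t \<in> slit_plane" using t by (auto simp: slit_plane_def)
  then have "(polylog 2 has_field_derivative polylog 1 (of_real t) / of_real t) (at (of_real t))"
    using polylog_has_field_derivative[of 2 "of_real t"] t by simp
  moreover have "polylog 1 (of_real t) = of_real (- ln (1 - t))"
    using t Ln_of_real[of "1 - t"] by simp
  ultimately have "(polylog 2 has_field_derivative of_real (- ln (1 - t) / t)) (at (of_real t))" by simp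
  from bounded_linear.has_vector_derivative[OF bounded_linear_Re has_vector_derivative_real_field[OF this]]
  have "((\<lambda>t. Re (polylog 2 (of_real t))) has_real_derivative - ln (1 - t) / t) (at t)"
    unfolding has_real_derivative_iff_has_vector_derivative by simp
  then show ?thesis
  proof (rule has_field_derivative_transform_within_open[of _ _ _ "{0<..<1}"])
    fix s :: real assume "s \<in> {0<..<1}"
    then show "Re (polylog 2 (of_real s)) = Li2_series s" by (simp flip: Li2_series_eq_polylog)
  qed (use t in auto)
qed

text \<open>
  The integrand is singular at 1, so the fundamental theorem is applied on both sides of 1 with
  primitives that are continuous there: the dilogarithm series up to 1, and its inversion beyond 1.
\<close>

lemma polylog_1_integrable_on_ray:
  assumes "R > 1"
  shows "(\<lambda>t. polylog 1 (of_real t) / of_real t) integrable_on {0..R}"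
proof -
  define f where "f t = polylog 1 (of_real t) / complex_of_real t" for t
  have "(\<lambda>t. polylog 1 t / t) contour_integrable_on linepath 0 (of_real (1/2))"
    by (intro polylog_contour_integrable) (auto simp: slit_plane_def)
  then have 1: "f integrable_on {0..1/2}"
    using contour_integrable_linepath_Reals_iff[of 0 "of_real (1/2)" "\<lambda>t. polylog 1 t / t"]
    by (simp add: f_def[abs_def])
  have "(f has_integral of_real (Li2_series 1) - of_real (Li2_series (1/2))) {1/2..1}"
  proof (rule fundamental_theorem_of_calculus_interior_strong[of "{}"])
    show "continuous_on {1/2..1} (\<lambda>t. complex_of_real (Li2_series t))"
      by (intro continuous_intros continuous_on_subset[OF continuous_on_Li2_series]) auto
    fix t :: real assume "t \<in> {1/2<..<1} - {}"
    then have t: "t \<in> {0<..<1}" by auto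
    then have "f t = of_real (- ln (1 - t) / t)"
      using Ln_of_real[of "1 - t"] by (simp add: f_def)
    then show "((\<lambda>t. complex_of_real (Li2_series t)) has_vector_derivative f t) (at t)"
      by (simp only: has_vector_derivative_of_real[OF Li2_series_has_real_derivative[OF t]])
  qed auto
  then have 2: "f integrable_on {1/2..1}" by blast
  \<comment> \<open>Inversion of the dilogarithm; the last term comes from the constant imaginary part of Ln on the negative reals.\<close>
  define Q where "Q t = complex_of_real (- (ln t)\<^sup>2 / 2 - Li2_series (1 / t)) - \<i> * of_real (pi * ln t)" for t
  have "(f has_integral Q R - Q 1) {1..R}"
  proof (rule fundamental_theorem_of_calculus_interior_strong[of "{}"])
    show "continuous_on {1..R} Q"
      unfolding Q_def[abs_def]
      by (intro continuous_intros continuous_on_compose2[OF continuous_on_Li2_series, of "{1..R}" "\<lambda>t. 1 / t"])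
        auto
    fix t :: real assume "t \<in> {1<..<R} - {}"
    then have t: "t > 1" by auto
    have "((\<lambda>t. - (ln t)\<^sup>2 / 2 - Li2_series (1 / t)) has_real_derivative - ln (t - 1) / t) (at t)"
    proof -
      have "((\<lambda>t. Li2_series (1 / t)) has_real_derivative (- ln (1 - 1 / t) / (1 / t)) * (- 1 / t\<^sup>2)) (at t)"
        using t by (intro DERIV_chain2[OF Li2_series_has_real_derivative])
          (auto intro!: derivative_eq_intros simp: power2_eq_square)
      moreover have "(- ln (1 - 1 / t) / (1 / t)) * (- 1 / t\<^sup>2) = (ln (t - 1) - ln t) / t"
      proof -
        have "ln (1 - 1 / t) = ln (t - 1) - ln t"
          using t ln_div[of "t - 1" t] by (simp add: field_simps)
        then show ?thesis using t by (simp add: power2_eq_square diff_divide_distrib)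
      qed
      ultimately have *: "((\<lambda>t. Li2_series (1 / t)) has_real_derivative (ln (t - 1) - ln t) / t) (at t)"
        by simp
      have "((\<lambda>t. - (ln t)\<^sup>2 / 2) has_real_derivative - ln t / t) (at t)"
        using t by (auto intro!: derivative_eq_intros)
      from DERIV_diff[OF this *] show ?thesis
        by (simp add: diff_divide_distrib)
    qed
    moreover have "((\<lambda>t. pi * ln t) has_real_derivative pi / t) (at t)"
      using t by (auto intro!: derivative_eq_intros)
    ultimately have "(Q has_vector_derivative of_real (- ln (t - 1) / t) - \<i> * of_real (pi / t)) (at t)"
      unfolding Q_def[abs_def]
      by (intro has_vector_derivative_diff has_vector_derivative_of_real
          has_vector_derivative_mult_right)
    then show "(Q has_vector_derivative f t) (at t)"
      using polylog_1_of_real_gt_1[OF t] by (simp add: f_def diff_divide_distrib)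
  qed (use assms in auto)
  then have 3: "f integrable_on {1..R}" by blast
  have 4: "f integrable_on {0..1}"
    by (rule Henstock_Kurzweil_Integration.integrable_combine[OF _ _ 1 2]) auto
  have "f integrable_on {0..R}"
    by (rule Henstock_Kurzweil_Integration.integrable_combine[OF _ _ 4 3]) (use assms in auto)
  then show ?thesis by (simp add: f_def[abs_def])
qed

lemma polylog_continuous_on_ray_step:
  assumes n: "n \<ge> 1" and int: "(\<lambda>t. polylog n (of_real t) / of_real t) integrable_on {0..R}"
  shows "continuous_on {0..R} (\<lambda>t. polylog (Suc n) (of_real t))"
proof -
  have "continuous_on {0..R} (\<lambda>r. integral {0..r} (\<lambda>t. polylog n (of_real t) / of_real t))"
    by (rule indefinite_integral_continuous_1[OF int])
  then show ?thesis
  proof (rule continuous_on_eq)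
    fix r assume "r \<in> {0..R}"
    then show "integral {0..r} (\<lambda>t. polylog n (of_real t) / of_real t) = polylog (Suc n) (of_real r)"
      using polylog_of_real_eq_integral[of "Suc n" r] polylog_0[of "Suc n"] n
      by (cases "r = 0") auto
  qed
qed

lemma polylog_integrable_on_ray:
  assumes "n \<ge> 1" and R: "R > 1"
  shows "(\<lambda>t. polylog n (of_real t) / of_real t) integrable_on {0..R}"
  using assms(1)
proof (induction n rule: dec_induct)
  case base
  show ?case by (rule polylog_1_integrable_on_ray[OF R])
next
  case (step n)
  have "(\<lambda>t. polylog (Suc n) t / t) contour_integrable_on linepath 0 (of_real (1/2))"
    by (intro polylog_contour_integrable) (auto simp: slit_plane_def)
  then have 1: "(\<lambda>t. polylog (Suc n) (of_real t) / of_real t) integrable_on {0..1/2}"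
    using contour_integrable_linepath_Reals_iff[of 0 "of_real (1/2)" "\<lambda>t. polylog (Suc n) t / t"] by simp
  have "continuous_on {1/2..R} (\<lambda>t. polylog (Suc n) (of_real t) / of_real t)"
    by (intro continuous_intros continuous_on_subset[OF polylog_continuous_on_ray_step[OF step.hyps(1) step.IH]]) auto
  then have 2: "(\<lambda>t. polylog (Suc n) (of_real t) / of_real t) integrable_on {1/2..R}"
    by (rule integrable_continuous_real)
  show ?case
    by (rule Henstock_Kurzweil_Integration.integrable_combine[OF _ _ 1 2]) (use R in auto)
qed

lemma polylog_continuous_on_ray:
  assumes "n \<ge> 2" "R > 1"
  shows "continuous_on {0..R} (\<lambda>t. polylog n (of_real t))"
  using polylog_continuous_on_ray_step[of "n - 1" R] polylog_integrable_on_ray[of "n - 1" R] assms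
  by simp

lemma polylog_has_vector_derivative_ray:
  assumes n: "n \<ge> 2" and r: "r > 1"
  shows "((\<lambda>t. polylog n (of_real t)) has_vector_derivative polylog (n - 1) (of_real r) / of_real r) (at r)"
proof -
  define f where "f t = polylog (n - 1) (of_real t) / complex_of_real t" for t
  define R where "R = r + 1"
  have R: "R > 1" using r by (simp add: R_def)
  have int: "f integrable_on {0..R}"
    using polylog_integrable_on_ray[of "n - 1" R] n R by (simp add: f_def[abs_def])
  have cont: "continuous_on {1<..<R} f"
  proof (cases "n = 2")
    case True
    have "continuous_on {1<..<R} (\<lambda>t. (- of_real (ln (t - 1)) - \<i> * of_real pi) / complex_of_real t)"
      by (intro continuous_intros) auto
    then show ?thesis
      by (rule continuous_on_eq) (use polylog_1_of_real_gt_1 True in \<open>simp add: f_def\<close>)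
  next
    case False
    then have "continuous_on {0..R} (\<lambda>t. polylog (n - 1) (of_real t))"
      using n R by (intro polylog_continuous_on_ray) auto
    then have "continuous_on {1<..<R} (\<lambda>t. polylog (n - 1) (of_real t))"
      by (rule continuous_on_subset) auto
    then show ?thesis unfolding f_def[abs_def] by (intro continuous_intros) auto
  qed
  have rin: "r \<in> {1<..<R}" using r by (simp add: R_def)
  then have "isCont f r" using cont by (simp add: continuous_on_eq_continuous_at)
  then have "((\<lambda>u. integral {0..u} f) has_vector_derivative f r) (at r within {0..R} - {})"
    using rin int continuous_at_imp_continuous_at_within[of r f "{0..R} - {}"]
    by (intro integral_has_vector_derivative_continuous_at) auto
  then have "((\<lambda>u. integral {0..u} f) has_vector_derivative f r) (at r within {1<..<R})"
    by (rule has_vector_derivative_within_subset) auto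
  then have "((\<lambda>u. integral {0..u} f) has_vector_derivative f r) (at r)"
    using rin at_within_open[of r "{1<..<R}"] by simp
  then show ?thesis
    unfolding f_def
  proof (rule has_vector_derivative_transform_within_open[of _ _ _ "{1<..<R}"])
    fix t assume "t \<in> {1<..<R}"
    then show "integral {0..t} (\<lambda>t. polylog (n - 1) (of_real t) / of_real t) = polylog n (of_real t)"
      using n by (simp add: polylog_of_real_eq_integral)
  qed (use rin in auto)
qed

lemma polylog_of_real_in_Reals:
  assumes n: "n \<ge> 1" and t: "-1 < t" "t < 1"
  shows "Im (polylog n (of_real t)) = 0"
proof -
  have "(\<lambda>k. of_real t ^ k / of_nat k ^ n) sums polylog n (of_real t)"
    using t n by (intro polylog_series) auto
  then have "(\<lambda>k. of_real (t ^ k / real k ^ n)) sums polylog n (of_real t)" by simp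
  from sums_Im[OF this] show ?thesis by (simp add: sums_iff)
qed

text \<open>
  On the interval below 1 the series is real, and the polylogarithm is continuous at 1 along the ray.
\<close>

lemma Im_polylog_1: "n \<ge> 2 \<Longrightarrow> Im (polylog n 1) = 0"
proof -
  assume n: "n \<ge> 2"
  have "((\<lambda>t. Im (polylog n (of_real t))) \<longlongrightarrow> Im (polylog n (of_real 1))) (at 1 within {0..2})"
    using bspec[OF polylog_continuous_on_ray[OF n, of 2, unfolded continuous_on_def], of 1]
    by (intro tendsto_Im) simp
  then have A: "((\<lambda>t. Im (polylog n (of_real t))) \<longlongrightarrow> Im (polylog n (of_real 1))) (at 1 within {0<..<1})"
    by (rule tendsto_within_subset) auto
  have B: "((\<lambda>t. Im (polylog n (of_real t))) \<longlongrightarrow> 0) (at 1 within {0<..<1})"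
    by (rule tendsto_eventually) (use n polylog_of_real_in_Reals in \<open>auto simp: eventually_at_filter\<close>)
  have "at (1::real) within {0<..<1} \<noteq> bot"
    by (simp add: at_within_eq_bot_iff closure_greaterThanLessThan)
  from tendsto_unique[OF this A B] show "Im (polylog n 1) = 0" by simp
qed

lemma Im_polylog_minus_1: "n \<ge> 1 \<Longrightarrow> Im (polylog n (-1)) = 0"
proof -
  assume n: "n \<ge> 1"
  have "isCont (polylog n) (-1)"
    using polylog_holomorphic[OF n] open_slit_plane
    by (intro continuous_on_interior[of slit_plane] holomorphic_on_imp_continuous_on)
      (auto simp: interior_open slit_plane_def)
  then have "isCont (\<lambda>t. polylog n (of_real t)) (-1)"
    by (intro isCont_o2[of "-1" of_real "polylog n"]) auto
  then have "isCont (\<lambda>t. Im (polylog n (of_real t))) (-1)"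
    by (rule isCont_Im)
  then have A: "((\<lambda>t. Im (polylog n (of_real t))) \<longlongrightarrow> Im (polylog n (of_real (-1)))) (at (-1) within {-1<..<0})"
    unfolding isCont_def by (rule tendsto_within_subset) simp
  have B: "((\<lambda>t. Im (polylog n (of_real t))) \<longlongrightarrow> 0) (at (-1) within {-1<..<0})"
    by (rule tendsto_eventually) (use n polylog_of_real_in_Reals in \<open>auto simp: eventually_at_filter\<close>)
  have "at (-1::real) within {-1<..<0} \<noteq> bot"
    by (simp add: at_within_eq_bot_iff closure_greaterThanLessThan)
  from tendsto_unique[OF this A B] show "Im (polylog n (-1)) = 0" by simp
qed

section \<open>The single-valued polylogarithm\<close>

text \<open>
  In weight 1 this is \<open>- log|1 - z|\<close>, the real part of the first polylogarithm, and not
  \<open>log|z|\<close>; with this convention the differential formula holds uniformly in lower weights.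
\<close>

definition sv_polylog :: "nat \<Rightarrow> complex \<Rightarrow> real" where
  "sv_polylog n z = Re_Im n (zagier_sum n (ln (cmod z)) (\<lambda>k. polylog k z))"

lemma zagier_polylog_eq_sv_polylog: "n \<ge> 2 \<Longrightarrow> zagier_polylog n z = sv_polylog n z"
  by (simp add: zagier_polylog_def sv_polylog_def zagier_sum_def)

lemma sv_polylog_1: "z \<noteq> 1 \<Longrightarrow> sv_polylog 1 z = - ln (cmod (1 - z))"
  by (simp add: sv_polylog_def Re_Im_def)

lemma has_derivative_ln_cmod:
  assumes "z \<noteq> 0"
  shows "((\<lambda>z. ln (cmod z)) has_derivative (\<lambda>h. Re (h / z))) (at z within A)"
proof -
  have "((\<lambda>z. ln (cmod z)) has_derivative (\<lambda>h. (h \<bullet> sgn z) * inverse (cmod z))) (at z within A)"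
    using assms by (auto intro!: derivative_eq_intros has_derivative_at_withinI[OF has_derivative_norm] )
  moreover have "(h \<bullet> sgn z) * inverse (cmod z) = Re (h / z)" for h
    by (simp add: inner_complex_def sgn_div_norm Re_divide flip: cmod_power2)
      (simp add: power2_eq_square add_divide_distrib divide_inverse algebra_simps)
  ultimately show ?thesis by simp
qed

lemma sv_polylog_has_derivative_slit_plane:
  assumes "n \<ge> 2" "z \<in> slit_plane" "z \<noteq> 0"
  shows "(sv_polylog n has_derivative
    (\<lambda>h. polylog_form n (ln (cmod z)) (\<lambda>m. sv_polylog m z) (h / z) (- h / (1 - z)))) (at z)"
  unfolding sv_polylog_def[abs_def]
proof (rule has_derivative_Re_Im_zagier_sum)
  show "((\<lambda>z. ln (cmod z)) has_derivative (\<lambda>h. Re (h / z))) (at z)"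
    by (rule has_derivative_ln_cmod) fact
  show "(polylog 1 has_derivative (\<lambda>h. - (- h / (1 - z)))) (at z)"
    using polylog_1_has_field_derivative[OF assms(2)]
    by (rule has_derivative_eq_rhs[OF has_field_derivative_imp_has_derivative]) (simp add: fun_eq_iff)
  show "(polylog k has_derivative (\<lambda>h. polylog (k - 1) z * (h / z))) (at z)" if "2 \<le> k" for k
    using polylog_has_field_derivative[OF that assms(2,3)]
    by (rule has_derivative_eq_rhs[OF has_field_derivative_imp_has_derivative]) (simp add: fun_eq_iff)
qed fact

lemma sv_polylog_has_derivative_ray:
  assumes n: "n \<ge> 2" and r: "r > 1"
  shows "((\<lambda>t. sv_polylog n (of_real t)) has_derivative
    (\<lambda>h. polylog_form n (ln (cmod (of_real r))) (\<lambda>m. sv_polylog m (of_real r))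
       (of_real h / of_real r) (- of_real h / (1 - of_real r)))) (at r)"
  unfolding sv_polylog_def[abs_def]
proof (rule has_derivative_Re_Im_zagier_sum)
  show "((\<lambda>t. ln (cmod (of_real t))) has_derivative (\<lambda>h. Re (of_real h / of_real r))) (at r)"
    using r by (intro has_derivative_compose[OF _ has_derivative_ln_cmod, of of_real of_real])
      (auto intro!: derivative_eq_intros)
  have "((\<lambda>t. - of_real (ln (t - 1)) - \<i> * of_real pi) has_derivative (\<lambda>h. - (- of_real h / (1 - complex_of_real r)))) (at r)"
    using r by (auto intro!: derivative_eq_intros simp: fun_eq_iff divide_simps) (simp add: algebra_simps)
  then show "((\<lambda>t. polylog 1 (of_real t)) has_derivative (\<lambda>h. - (- of_real h / (1 - complex_of_real r)))) (at r)"
    by (rule has_derivative_transform_within_open[of _ _ _ _ "{1<..}"]) (use r polylog_1_of_real_gt_1 in auto)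
  show "((\<lambda>t. polylog k (of_real t)) has_derivative
      (\<lambda>h. polylog (k - 1) (of_real r) * (of_real h / of_real r))) (at r)" if "2 \<le> k" for k
    using polylog_has_vector_derivative_ray[OF that r]
    by (simp add: has_vector_derivative_def scaleR_conv_of_real mult_ac)
qed fact

text \<open>
  Inversion of z changes dlog z into its negative, dlog (1 - z) into
  dlog (1 - z) - dlog z, and adds \<open>log|z|\<close> to the function of weight 1. All signs then combine
  into the factor \<open>(-1) ^ (n - 1)\<close>.
\<close>

lemma polylog_form_inversion:
  assumes n: "n \<ge> 2" and 1: "N 1 = M 1 + x"
    and N: "\<And>k. 2 \<le> k \<Longrightarrow> k < n \<Longrightarrow> N k = (-1) ^ (k - 1) * M k"
  shows "polylog_form n (- x) N (- \<omega>) (\<omega>' - \<omega>) = (-1) ^ (n - 1) * polylog_form n x M \<omega> \<omega>'"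
proof (cases "n = 2")
  case True
  then show ?thesis using 1 by (simp add: polylog_form_def algebra_simps)
next
  case False
  then obtain l where l: "n = Suc (Suc (Suc l))" using n le_Suc_ex[of 3 n] by (auto simp: numeral_3_eq_3)
  have "N (n - 1) = - ((-1) ^ (n - 1)) * M (n - 1)"
    using N[of "n - 1"] by (simp add: l)
  moreover have "(\<Sum>k = 2..<n - 1. zagier_beta k * (- x) ^ (k - 1) * N (n - k))
      = - ((-1) ^ (n - 1)) * (\<Sum>k = 2..<n - 1. zagier_beta k * x ^ (k - 1) * M (n - k))"
    unfolding sum_distrib_left
  proof (rule sum.cong[OF refl])
    fix k assume k: "k \<in> {2..<n - 1}"
    have "N (n - k) = (-1) ^ (n - k - 1) * M (n - k)" using k by (intro N) auto
    then have "(- x) ^ (k - 1) * N (n - k) = ((-1) ^ (k - 1) * (-1) ^ (n - k - 1)) * (x ^ (k - 1) * M (n - k))"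
      by (simp add: power_minus[of x] mult_ac)
    also have "(-1::real) ^ (k - 1) * (-1) ^ (n - k - 1) = (-1) ^ (n - 2)"
      unfolding power_add[symmetric] using k by (intro arg_cong[where f = "power _"]) auto
    finally have "(- x) ^ (k - 1) * N (n - k) = (-1) ^ (n - 2) * (x ^ (k - 1) * M (n - k))" .
    then show "zagier_beta k * (- x) ^ (k - 1) * N (n - k)
        = - ((-1) ^ (n - 1)) * (zagier_beta k * x ^ (k - 1) * M (n - k))"
      by (simp add: l mult_ac)
  qed
  moreover have "(- x) ^ (n - 2) = - ((-1) ^ (n - 1)) * x ^ (n - 2)"
    by (simp add: l power_minus[of x])
  ultimately show ?thesis
    using False 1 by (simp add: polylog_form_def algebra_simps)
qed

lemma sv_polylog_1_inversion:
  assumes "z \<noteq> 0" "z \<noteq> 1"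
  shows "sv_polylog 1 (1 / z) = sv_polylog 1 z + ln (cmod z)"
proof -
  have "cmod (1 - 1 / z) = cmod (1 - z) / cmod z"
    using assms(1) by (simp add: norm_divide[symmetric] diff_divide_distrib norm_minus_commute)
  then show ?thesis
    using assms by (simp add: sv_polylog_1 ln_div del: One_nat_def)
qed

lemma has_derivative_compose_inverse:
  assumes "(f has_derivative f') (at (1 / z))" "z \<noteq> (0::complex)"
  shows "((\<lambda>z. f (1 / z)) has_derivative (\<lambda>h. f' (- h / z\<^sup>2))) (at z)"
  using assms(2)
  by (intro has_derivative_compose[of "\<lambda>z. 1 / z" "\<lambda>h. - h / z\<^sup>2" z UNIV f f', OF _ assms(1)])
    (auto intro!: derivative_eq_intros simp: power2_eq_square)

lemma sv_polylog_form_inversion: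
  assumes n: "n \<ge> 2" and z: "z \<noteq> 0" "z \<noteq> 1"
    and N: "\<And>k. 2 \<le> k \<Longrightarrow> k < n \<Longrightarrow> sv_polylog k (1 / z) = (-1) ^ (k - 1) * sv_polylog k z"
  shows "polylog_form n (ln (cmod (1 / z))) (\<lambda>m. sv_polylog m (1 / z))
           ((- h / z\<^sup>2) / (1 / z)) (- (- h / z\<^sup>2) / (1 - 1 / z))
       = (-1) ^ (n - 1) * polylog_form n (ln (cmod z)) (\<lambda>m. sv_polylog m z) (h / z) (- h / (1 - z))"
proof -
  have "(- h / z\<^sup>2) / (1 / z) = - (h / z)" "ln (cmod (1 / z)) = - ln (cmod z)"
    using z by (auto simp: power2_eq_square norm_divide ln_div)
  moreover have "- (- h / z\<^sup>2) / (1 - 1 / z) = - h / (1 - z) - h / z"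
  proof -
    have "z\<^sup>2 * (1 - 1 / z) = z * (z - 1)" using z by (simp add: power2_eq_square field_simps)
    then have "- (- h / z\<^sup>2) / (1 - 1 / z) = h / (z * (z - 1))" by simp
    also have "\<dots> = - h / (1 - z) - h / z" using z by (simp add: divide_simps) (simp add: algebra_simps)
    finally show ?thesis .
  qed
  ultimately show ?thesis
    using polylog_form_inversion[OF n sv_polylog_1_inversion[OF z] N] by simp
qed

lemma off_nonneg_Reals:
  assumes "z \<notin> \<real>\<^sub>\<ge>\<^sub>0"
  shows "z \<in> slit_plane" "z \<noteq> 0" "z \<noteq> 1" "1 / z \<notin> \<real>\<^sub>\<ge>\<^sub>0"
proof -
  show "z \<in> slit_plane" "z \<noteq> 0" "z \<noteq> 1"
    using assms by (auto simp: slit_plane_def complex_nonneg_Reals_iff)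
  show "1 / z \<notin> \<real>\<^sub>\<ge>\<^sub>0"
  proof
    assume "1 / z \<in> \<real>\<^sub>\<ge>\<^sub>0"
    then have "inverse (1 / z) \<in> \<real>\<^sub>\<ge>\<^sub>0" by (rule nonneg_Reals_inverse_I)
    then show False using assms by simp
  qed
qed

lemma connected_minus_nonneg_Reals: "connected (- \<real>\<^sub>\<ge>\<^sub>0 :: complex set)"
proof -
  have eq: "z \<in> - \<real>\<^sub>\<ge>\<^sub>0 \<longleftrightarrow> z + 1 \<in> slit_plane" for z
    by (auto simp: slit_plane_def complex_nonneg_Reals_iff)
  have "(- \<real>\<^sub>\<ge>\<^sub>0 :: complex set) = (\<lambda>z. z - 1) ` slit_plane"
  proof (intro equalityI subsetI)
    fix z :: complex assume "z \<in> - \<real>\<^sub>\<ge>\<^sub>0"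
    then show "z \<in> (\<lambda>z. z - 1) ` slit_plane"
      using eq[of z] by (intro image_eqI[of _ _ "z + 1"]) auto
  next
    fix z assume "z \<in> (\<lambda>z. z - 1) ` slit_plane"
    then obtain w where "w \<in> slit_plane" "z = w - 1" by blast
    then show "z \<in> - \<real>\<^sub>\<ge>\<^sub>0" using eq[of z] by simp
  qed
  moreover have "connected ((\<lambda>z. z - 1) ` slit_plane)"
    by (intro connected_continuous_image continuous_intros starlike_imp_connected starlike_slit_plane)
  ultimately show ?thesis by simp
qed

text \<open>
  Both sides have the same differential by induction over n, the complement of the nonnegative reals is connected, and they
  agree at -1, which inversion fixes: for even n both values are 0, since the polylogarithm is real there.
\<close>

lemma sv_polylog_inversion_off_nonneg_Reals:
  assumes "n \<ge> 2" "z \<notin> \<real>\<^sub>\<ge>\<^sub>0"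
  shows "sv_polylog n (1 / z) = (-1) ^ (n - 1) * sv_polylog n z"
  using assms
proof (induction n arbitrary: z rule: less_induct)
  case (less n)
  let ?W = "- \<real>\<^sub>\<ge>\<^sub>0 :: complex set"
  define D where "D z = sv_polylog n (1 / z) - (-1) ^ (n - 1) * sv_polylog n z" for z
  have D': "(D has_derivative (\<lambda>h. 0)) (at z)" if "z \<in> ?W" for z
  proof -
    have z: "z \<in> slit_plane" "z \<noteq> 0" "z \<noteq> 1" "1 / z \<notin> \<real>\<^sub>\<ge>\<^sub>0" "1 / z \<in> slit_plane"
      using that off_nonneg_Reals[of z] off_nonneg_Reals[of "1 / z"] by simp_all
    have "(D has_derivative (\<lambda>h.
        polylog_form n (ln (cmod (1 / z))) (\<lambda>m. sv_polylog m (1 / z))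
           ((- h / z\<^sup>2) / (1 / z)) (- (- h / z\<^sup>2) / (1 - 1 / z))
       - (-1) ^ (n - 1) * polylog_form n (ln (cmod z)) (\<lambda>m. sv_polylog m z) (h / z) (- h / (1 - z)))) (at z)"
      unfolding D_def[abs_def] using z
      by (intro has_derivative_diff has_derivative_mult_right sv_polylog_has_derivative_slit_plane
          has_derivative_compose_inverse[OF sv_polylog_has_derivative_slit_plane] less.prems) auto
    moreover have "polylog_form n (ln (cmod (1 / z))) (\<lambda>m. sv_polylog m (1 / z))
           ((- h / z\<^sup>2) / (1 / z)) (- (- h / z\<^sup>2) / (1 - 1 / z))
       = (-1) ^ (n - 1) * polylog_form n (ln (cmod z)) (\<lambda>m. sv_polylog m z) (h / z) (- h / (1 - z))" for h
      using less.IH that by (intro sv_polylog_form_inversion less.prems(1) z) auto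
    ultimately show ?thesis by simp
  qed
  have W: "open ?W" by (rule open_Compl) (rule closed_nonneg_Reals_complex)
  have "continuous_on ?W D"
    using D' by (intro continuous_at_imp_continuous_on ballI) (rule has_derivative_continuous)
  then have "D constant_on ?W"
    using D' by (intro has_derivative_zero_connected_constant_on[of _ "{}"] connected_minus_nonneg_Reals W)
      (simp_all add: has_derivative_at_withinI)
  moreover have "-1 \<in> ?W" by (simp add: complex_nonneg_Reals_iff)
  ultimately have "D z = D (-1)" using less.prems(2) unfolding constant_on_def by auto
  also have "D (-1) = 0"
  proof (cases "odd n")
    case True
    then show ?thesis by (simp add: D_def)
  next
    case False
    have "zagier_sum n 0 P = P n" for P
      using less.prems(1) by (cases n) (simp_all add: zagier_sum_def sum.lessThan_Suc_shift del: sum.lessThan_Suc)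
    then have "sv_polylog n (-1) = 0"
      using False Im_polylog_minus_1[of n] less.prems(1) by (simp add: sv_polylog_def Re_Im_def)
    then show ?thesis by (simp add: D_def)
  qed
  finally show ?case by (simp add: D_def)
qed

text \<open>
  The first polylogarithm has a logarithmic singularity at 1, but it only occurs multiplied by a positive
  power of \<open>log|z|\<close>, which kills it.
\<close>

lemma zagier_sum_tendsto_at_1:
  assumes n: "n \<ge> 2" and F: "F = at_right 1 \<or> F = at_left (1::real)"
  shows "((\<lambda>t. zagier_sum n (ln (cmod (of_real t))) (\<lambda>k. polylog k (of_real t))) \<longlongrightarrow> polylog n 1) F"
proof -
  have ln: "((\<lambda>t. ln (cmod (of_real t))) \<longlongrightarrow> 0) F"
  proof -
    have "((\<lambda>t::real. ln \<bar>t\<bar>) \<longlongrightarrow> ln \<bar>1\<bar>) (at 1)"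
      by (intro tendsto_intros) auto
    then show ?thesis using F by (auto intro: tendsto_mono at_within_le_at)
  qed
  have P: "((\<lambda>t. polylog k (of_real t)) \<longlongrightarrow> polylog k 1) F" if "k \<ge> 2" for k
  proof -
    have "continuous_on {0<..<2} (\<lambda>t. polylog k (of_real t))"
      by (rule continuous_on_subset[OF polylog_continuous_on_ray[OF that, of 2]]) auto
    then have "isCont (\<lambda>t. polylog k (of_real t)) 1" by (simp add: continuous_on_eq_continuous_at)
    then have "((\<lambda>t. polylog k (of_real t)) \<longlongrightarrow> polylog k 1) (at 1)" by (simp add: isCont_def)
    then show ?thesis using F by (auto intro: tendsto_mono at_within_le_at)
  qed
  have P1: "((\<lambda>t. of_real (ln (cmod (of_real t))) * polylog 1 (of_real t)) \<longlongrightarrow> 0) F"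
    using F
  proof
    assume F: "F = at_right 1"
    have "((\<lambda>t::real. ln t * ln (t - 1)) \<longlongrightarrow> 0) (at_right 1)" by real_asymp
    then have "((\<lambda>t::real. - of_real (ln t * ln (t - 1)) - of_real (ln t) * (\<i> * of_real pi)) \<longlongrightarrow> - of_real 0 - of_real (ln 1) * (\<i> * of_real pi)) (at_right 1)"
      by (intro tendsto_intros) auto
    then have "((\<lambda>t::real. - of_real (ln t * ln (t - 1)) - of_real (ln t) * (\<i> * of_real pi)) \<longlongrightarrow> 0) (at_right 1)"
      by simp
    then show ?thesis unfolding F
      by (rule Lim_transform_eventually)
        (auto simp: eventually_at_filter polylog_1_of_real_gt_1 algebra_simps simp del: polylog.simps One_nat_def)
  next
    assume F: "F = at_left 1"
    have "((\<lambda>t::real. - ln t * ln (1 - t)) \<longlongrightarrow> 0) (at_left 1)" by real_asymp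
    from tendsto_of_real[OF this]
    have "((\<lambda>t::real. complex_of_real (- ln t * ln (1 - t))) \<longlongrightarrow> 0) (at_left 1)"
      by simp
    moreover have "\<forall>\<^sub>F t in at_left (1::real). t \<in> {0<..<1}"
      by (intro eventually_at_leftI[of 0]) auto
    then have "\<forall>\<^sub>F t in at_left 1. complex_of_real (- ln t * ln (1 - t)) = of_real (ln (cmod (of_real t))) * polylog 1 (of_real t)"
      by (rule eventually_mono) (use Ln_of_real[of "1 - _"] in auto)
    ultimately show ?thesis unfolding F
      by (rule Lim_transform_eventually)
  qed
  have "((\<lambda>t. zagier_sum n (ln (cmod (of_real t))) (\<lambda>k. polylog k (of_real t))) \<longlongrightarrow>
      (\<Sum>k<n. if k = 0 then polylog n 1 else 0)) F"
    unfolding zagier_sum_def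
  proof (rule tendsto_sum)
    fix k assume "k \<in> {..<n}"
    then consider "k = 0" | "k \<ge> 1" "n - k \<ge> 2" | "k = n - 1" "k \<ge> 1" using n by force
    then show "((\<lambda>t. of_real (zagier_beta k * ln (cmod (of_real t)) ^ k) * polylog (n - k) (of_real t))
        \<longlongrightarrow> (if k = 0 then polylog n 1 else 0)) F"
    proof cases
      case 1
      then show ?thesis using P[OF n] by simp
    next
      case 2
      have "((\<lambda>t. of_real (zagier_beta k * ln (cmod (of_real t)) ^ k) * polylog (n - k) (of_real t))
        \<longlongrightarrow> of_real (zagier_beta k * 0 ^ k) * polylog (n - k) 1) F"
        by (intro tendsto_intros ln P 2)
      then show ?thesis using 2 by (simp add: power_0_left)
    next
      case 3
      then obtain l where l: "k = Suc l" "n = Suc (Suc l)"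
        using n le_Suc_ex[of 2 n] by (auto simp: numeral_2_eq_2)
      have "((\<lambda>t. of_real (zagier_beta k * ln (cmod (of_real t)) ^ l) * (of_real (ln (cmod (of_real t))) * polylog 1 (of_real t)))
        \<longlongrightarrow> of_real (zagier_beta k * 0 ^ l) * 0) F"
        by (intro tendsto_intros ln P1)
      then show ?thesis using l by (simp add: mult_ac del: polylog.simps)
    qed
  qed
  then show ?thesis using n by simp
qed

lemma sv_polylog_tendsto_at_1:
  assumes "n \<ge> 2" "F = at_right 1 \<or> F = at_left (1::real)"
  shows "((\<lambda>t. sv_polylog n (of_real t)) \<longlongrightarrow> Re_Im n (polylog n 1)) F"
  unfolding sv_polylog_def
  by (rule bounded_linear.tendsto[OF bounded_linear_Re_Im zagier_sum_tendsto_at_1[OF assms]])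

text \<open>
  The derivative of the difference along the ray vanishes by induction over n, so the difference is constant, and the
  constant is found by letting r tend to 1.
\<close>

lemma sv_polylog_inversion_ray:
  assumes "n \<ge> 2" "r > 1"
  shows "sv_polylog n (1 / of_real r) = (-1) ^ (n - 1) * sv_polylog n (of_real r)"
  using assms
proof (induction n arbitrary: r rule: less_induct)
  case (less n)
  define D where "D t = sv_polylog n (1 / of_real t) - (-1) ^ (n - 1) * sv_polylog n (of_real t)" for t
  have D': "(D has_derivative (\<lambda>h. 0)) (at t within {1<..})" if t: "t \<in> {1<..}" for t
  proof -
    let ?z = "complex_of_real t"
    have "1 / ?z = of_real (1 / t)" by simp
    moreover have "of_real (1 / t) \<in> slit_plane" using t by (simp add: slit_plane_def del: of_real_divide)
    ultimately have z: "?z \<noteq> 0" "?z \<noteq> 1" "1 / ?z \<in> slit_plane" "1 / ?z \<noteq> 0"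
      using t by (simp_all del: of_real_divide)
    have "((\<lambda>z. sv_polylog n (1 / z)) has_derivative
        (\<lambda>h. polylog_form n (ln (cmod (1 / ?z))) (\<lambda>m. sv_polylog m (1 / ?z))
           ((- h / ?z\<^sup>2) / (1 / ?z)) (- (- h / ?z\<^sup>2) / (1 - 1 / ?z)))) (at ?z)"
      by (rule has_derivative_compose_inverse[OF sv_polylog_has_derivative_slit_plane])
        (use less.prems z in auto)
    then have "((\<lambda>t. sv_polylog n (1 / of_real t)) has_derivative
        (\<lambda>h. polylog_form n (ln (cmod (1 / ?z))) (\<lambda>m. sv_polylog m (1 / ?z))
           ((- of_real h / ?z\<^sup>2) / (1 / ?z)) (- (- of_real h / ?z\<^sup>2) / (1 - 1 / ?z)))) (at t)"
      by (rule has_derivative_compose[of of_real of_real, rotated]) (auto intro!: derivative_eq_intros)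
    then have "(D has_derivative (\<lambda>h.
        polylog_form n (ln (cmod (1 / ?z))) (\<lambda>m. sv_polylog m (1 / ?z))
           ((- of_real h / ?z\<^sup>2) / (1 / ?z)) (- (- of_real h / ?z\<^sup>2) / (1 - 1 / ?z))
       - (-1) ^ (n - 1) * polylog_form n (ln (cmod ?z)) (\<lambda>m. sv_polylog m ?z) (of_real h / ?z) (- of_real h / (1 - ?z)))) (at t)"
      unfolding D_def[abs_def] using less.prems t
      by (intro has_derivative_diff has_derivative_mult_right sv_polylog_has_derivative_ray) auto
    moreover have "polylog_form n (ln (cmod (1 / ?z))) (\<lambda>m. sv_polylog m (1 / ?z))
           ((- of_real h / ?z\<^sup>2) / (1 / ?z)) (- (- of_real h / ?z\<^sup>2) / (1 - 1 / ?z))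
       = (-1) ^ (n - 1) * polylog_form n (ln (cmod ?z)) (\<lambda>m. sv_polylog m ?z) (of_real h / ?z) (- of_real h / (1 - ?z))" for h
      using less.IH t by (intro sv_polylog_form_inversion less.prems(1) z) auto
    ultimately have "(D has_derivative (\<lambda>h. 0)) (at t)" by simp
    then show ?thesis by (rule has_derivative_at_withinI)
  qed
  obtain c where c: "\<And>t. t > 1 \<Longrightarrow> D t = c"
    using has_derivative_zero_constant[of "{1<..}" D] D' by auto
  have "((\<lambda>t. sv_polylog n (of_real (1 / t))) \<longlongrightarrow> Re_Im n (polylog n 1)) (at_right 1)"
  proof (rule filterlim_compose[OF sv_polylog_tendsto_at_1[of n "at_left 1"]])
    show "filterlim (\<lambda>t::real. 1 / t) (at_left 1) (at_right 1)" by real_asymp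
  qed (use less.prems in auto)
  then have A: "(D \<longlongrightarrow> Re_Im n (polylog n 1) - (-1) ^ (n - 1) * Re_Im n (polylog n 1)) (at_right 1)"
    unfolding D_def[abs_def] using sv_polylog_tendsto_at_1[of n "at_right 1"] less.prems
    by (intro tendsto_intros) auto
  \<comment> \<open>For odd n the two terms cancel; for even n both are the imaginary part of a real number.\<close>
  have B: "Re_Im n (polylog n 1) - (-1) ^ (n - 1) * Re_Im n (polylog n 1) = 0"
    using Im_polylog_1[of n] less.prems by (cases "odd n") (auto simp: Re_Im_def)
  have "(D \<longlongrightarrow> c) (at_right 1)"
    by (rule tendsto_eventually) (auto simp: eventually_at_filter c)
  then have "c = 0"
    using tendsto_unique[OF _ _ A[unfolded B], of c] by simp
  then show ?case using c[of r] less.prems by (simp add: D_def)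
qed

lemma sv_polylog_inversion:
  assumes n: "n \<ge> 2" and z: "z \<noteq> 0" "z \<noteq> 1"
  shows "sv_polylog n (1 / z) = (-1) ^ (n - 1) * sv_polylog n z"
proof (cases "z \<in> \<real>\<^sub>\<ge>\<^sub>0")
  case False
  then show ?thesis by (rule sv_polylog_inversion_off_nonneg_Reals[OF n])
next
  case True
  then obtain r where r: "z = of_real r" "r \<ge> 0" by (auto elim: nonneg_Reals_cases)
  then consider "r > 1" | "0 < r" "r < 1" using z by (metis of_real_0 of_real_1 linorder_neqE_linordered_idom order_le_less)
  then show ?thesis
  proof cases
    case 1
    then show ?thesis using sv_polylog_inversion_ray[OF n 1] r by simp
  next
    case 2
    then have "1 / r > 1" by simp
    from sv_polylog_inversion_ray[OF n this] r
    have "sv_polylog n z = (-1) ^ (n - 1) * sv_polylog n (1 / z)" by simp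
    then show ?thesis by simp
  qed
qed

text \<open>
  On the cut beyond 1 the branch of the polylogarithm jumps, but inversion maps a neighbourhood of the cut
  into the slit plane, where the differential is known; the inversion formula transports it back.
  This is where single-valuedness is used.
\<close>

lemma sv_polylog_has_derivative:
  assumes n: "n \<ge> 2" and z: "z \<noteq> 0" "z \<noteq> 1"
  shows "(sv_polylog n has_derivative
    (\<lambda>h. polylog_form n (ln (cmod z)) (\<lambda>m. sv_polylog m z) (h / z) (- h / (1 - z)))) (at z)"
proof (cases "z \<in> slit_plane")
  case True
  then show ?thesis using sv_polylog_has_derivative_slit_plane n z by blast
next
  case False
  then have z': "Im z = 0" "Re z > 1" using z by (auto simp: slit_plane_def complex_eq_iff)
  then have eq: "1 / z = of_real (1 / Re z)" by (simp add: complex_eq_iff Re_divide Im_divide power2_eq_square)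
  have sl: "1 / z \<in> slit_plane" unfolding eq using z' by (simp add: slit_plane_def del: of_real_divide)
  have "((\<lambda>w. (-1) ^ (n - 1) * sv_polylog n (1 / w)) has_derivative
        (\<lambda>h. (-1) ^ (n - 1) * polylog_form n (ln (cmod (1 / z))) (\<lambda>m. sv_polylog m (1 / z))
           ((- h / z\<^sup>2) / (1 / z)) (- (- h / z\<^sup>2) / (1 - 1 / z)))) (at z)"
    by (intro has_derivative_mult_right has_derivative_compose_inverse[OF sv_polylog_has_derivative_slit_plane])
      (use n z sl in auto)
  moreover have "(-1) ^ (n - 1) * polylog_form n (ln (cmod (1 / z))) (\<lambda>m. sv_polylog m (1 / z))
           ((- h / z\<^sup>2) / (1 / z)) (- (- h / z\<^sup>2) / (1 - 1 / z))
     = polylog_form n (ln (cmod z)) (\<lambda>m. sv_polylog m z) (h / z) (- h / (1 - z))" for h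
    using z sv_polylog_inversion by (subst sv_polylog_form_inversion) (auto simp: n)
  ultimately have "((\<lambda>w. (-1) ^ (n - 1) * sv_polylog n (1 / w)) has_derivative
    (\<lambda>h. polylog_form n (ln (cmod z)) (\<lambda>m. sv_polylog m z) (h / z) (- h / (1 - z)))) (at z)"
    by simp
  then show ?thesis
    by (rule has_derivative_transform_within_open[of _ _ _ _ "- {0, 1}"])
      (use n z sv_polylog_inversion in auto)
qed

lemma polylog_div_tendsto_0: 
  assumes "n \<ge> 1"
  shows "((\<lambda>z. polylog n z / z) \<longlongrightarrow> deriv (polylog n) 0) (at 0)"
proof -
  have "(polylog n has_field_derivative deriv (polylog n) 0) (at 0)"
    using polylog_holomorphic[OF assms] open_slit_plane by (intro holomorphic_derivI[of _ slit_plane]) auto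
  then show ?thesis using polylog_0[OF assms] by (simp add: has_field_derivative_iff)
qed

text \<open>
  Each term is a power of \<open>log|z|\<close> times a function that vanishes at 0 to first order.
\<close>

lemma sv_polylog_tendsto_0: "(sv_polylog n \<longlongrightarrow> 0) (at 0)"
proof -
  have "((\<lambda>z. zagier_sum n (ln (cmod z)) (\<lambda>k. polylog k z)) \<longlongrightarrow> (\<Sum>k<n. 0)) (at 0)"
    unfolding zagier_sum_def
  proof (rule tendsto_sum)
    fix k assume k: "k \<in> {..<n}"
    have "((\<lambda>r::real. r * ln r ^ k) \<longlongrightarrow> 0) (at_right 0)" by real_asymp
    then have "((\<lambda>z::complex. cmod z * ln (cmod z) ^ k) \<longlongrightarrow> 0) (at 0)"
      by (rule filterlim_compose) (auto simp: filterlim_at intro!: tendsto_eq_intros simp: eventually_at_filter)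
    then have "((\<lambda>z. z * of_real (ln (cmod z) ^ k)) \<longlongrightarrow> 0) (at 0)"
      by (subst tendsto_norm_zero_iff[symmetric]) (simp add: norm_mult norm_power tendsto_rabs_zero_iff abs_mult
          flip: power_abs tendsto_rabs_zero_iff[of "\<lambda>z. cmod z * ln (cmod z) ^ k"])
    then have "((\<lambda>z. of_real (zagier_beta k) * (z * of_real (ln (cmod z) ^ k)) * (polylog (n - k) z / z))
        \<longlongrightarrow> of_real (zagier_beta k) * 0 * deriv (polylog (n - k)) 0) (at 0)"
      using k by (intro tendsto_intros polylog_div_tendsto_0) auto
    then have "((\<lambda>z. of_real (zagier_beta k) * (z * of_real (ln (cmod z) ^ k)) * (polylog (n - k) z / z)) \<longlongrightarrow> 0) (at 0)"
      by simp
    then show "((\<lambda>z. of_real (zagier_beta k * ln (cmod z) ^ k) * polylog (n - k) z) \<longlongrightarrow> 0) (at 0)"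
      by (rule Lim_transform_eventually) (auto simp: eventually_at_filter)
  qed
  from bounded_linear.tendsto[OF bounded_linear_Re_Im this, of n] show ?thesis
    by (simp add: sv_polylog_def[abs_def] Re_Im_of_real_mult[of n 0 0, simplified])
qed

lemma sv_polylog_tendsto_infinity:
  assumes n: "n \<ge> 2"
  shows "(sv_polylog n \<longlongrightarrow> 0) at_infinity"
proof -
  have "filterlim (\<lambda>z::complex. 1 / z) (at 0) at_infinity"
    unfolding filterlim_at using tendsto_inverse_0[where 'a = complex]
    by (auto simp: inverse_eq_divide[abs_def] eventually_at_infinity intro!: exI[of _ 1])
  from filterlim_compose[OF sv_polylog_tendsto_0 this]
  have "((\<lambda>z. (-1) ^ (n - 1) * sv_polylog n (1 / z)) \<longlongrightarrow> (-1) ^ (n - 1) * 0) at_infinity"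
    by (intro tendsto_intros)
  moreover have "\<forall>\<^sub>F z in at_infinity. (-1) ^ (n - 1) * sv_polylog n (1 / z) = sv_polylog n z"
    unfolding eventually_at_infinity
  proof (intro exI[of _ 2] allI impI)
    fix z :: complex assume "2 \<le> cmod z"
    then have "z \<noteq> 0" "z \<noteq> 1" by auto
    then show "(-1) ^ (n - 1) * sv_polylog n (1 / z) = sv_polylog n z"
      using sv_polylog_inversion[OF n] by simp
  qed
  ultimately show ?thesis by (simp add: Lim_transform_eventually)
qed

section \<open>Rational functions and functions with unipotent derivatives\<close>

text \<open>
  Equality with a quotient of polynomials is only required outside a finite set, which makes the rational
  functions closed under all field operations without bookkeeping of poles.
\<close>

definition rational :: "(complex \<Rightarrow> complex) \<Rightarrow> bool" where
  "rational r \<longleftrightarrow> (\<exists>p q. q \<noteq> 0 \<and> (\<forall>\<^sub>F t in cofinite. r t = poly p t / poly q t))"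

lemma eventually_cofinite_poly_nz: "q \<noteq> 0 \<Longrightarrow> \<forall>\<^sub>F t in cofinite. poly q t \<noteq> (0::complex)"
  using poly_roots_finite[of q] by (simp add: eventually_cofinite)

lemma rationalI:
  assumes "q \<noteq> 0" "\<forall>\<^sub>F t in cofinite. r t = poly p t / poly q t"
  shows "rational r"
  using assms unfolding rational_def by blast

lemma rationalE:
  assumes "rational r"
  obtains p q where "q \<noteq> 0" "\<forall>\<^sub>F t in cofinite. poly q t \<noteq> 0 \<and> r t = poly p t / poly q t"
proof -
  obtain p q where "q \<noteq> 0" "\<forall>\<^sub>F t in cofinite. r t = poly p t / poly q t"
    using assms unfolding rational_def by blast
  then show ?thesis
    using that eventually_conj[OF eventually_cofinite_poly_nz] by blast
qed

lemma rational_const: "rational (\<lambda>_. c)"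
  by (rule rationalI[of 1 _ "[:c:]"]) auto

lemma rational_add:
  assumes "rational r" "rational s"
  shows "rational (\<lambda>t. r t + s t)"
proof -
  obtain p q where 1: "q \<noteq> 0" "\<forall>\<^sub>F t in cofinite. poly q t \<noteq> 0 \<and> r t = poly p t / poly q t"
    using assms(1) by (rule rationalE)
  obtain a b where 2: "b \<noteq> 0" "\<forall>\<^sub>F t in cofinite. poly b t \<noteq> 0 \<and> s t = poly a t / poly b t"
    using assms(2) by (rule rationalE)
  show ?thesis
  proof (rule rationalI[of "q * b"])
    show "\<forall>\<^sub>F t in cofinite. r t + s t = poly (p * b + a * q) t / poly (q * b) t"
      using 1(2) 2(2) by eventually_elim (simp add: add_frac_eq)
  qed (use 1 2 in auto)
qed

lemma rational_mult:
  assumes "rational r" "rational s"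
  shows "rational (\<lambda>t. r t * s t)"
proof -
  obtain p q where 1: "q \<noteq> 0" "\<forall>\<^sub>F t in cofinite. poly q t \<noteq> 0 \<and> r t = poly p t / poly q t"
    using assms(1) by (rule rationalE)
  obtain a b where 2: "b \<noteq> 0" "\<forall>\<^sub>F t in cofinite. poly b t \<noteq> 0 \<and> s t = poly a t / poly b t"
    using assms(2) by (rule rationalE)
  show ?thesis
  proof (rule rationalI[of "q * b"])
    show "\<forall>\<^sub>F t in cofinite. r t * s t = poly (p * a) t / poly (q * b) t"
      using 1(2) 2(2) by eventually_elim simp
  qed (use 1 2 in auto)
qed

lemma rational_sum: "(\<And>j. j \<in> J \<Longrightarrow> rational (r j)) \<Longrightarrow> rational (\<lambda>t. \<Sum>j\<in>J. r j t)"
  by (induction J rule: infinite_finite_induct) (simp_all add: rational_const rational_add)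

lemma rational_inverse_linear: "rational (\<lambda>t. c / (t - p))"
  by (rule rationalI[of "[:-p, 1:]" _ "[:c:]"]) auto

lemma rational_inverse:
  assumes "rational r" "\<not> (\<forall>\<^sub>F t in cofinite. r t = 0)"
  shows "rational (\<lambda>t. inverse (r t))" "\<forall>\<^sub>F t in cofinite. r t \<noteq> 0"
proof -
  obtain p q where 1: "q \<noteq> 0" "\<forall>\<^sub>F t in cofinite. poly q t \<noteq> 0 \<and> r t = poly p t / poly q t"
    using assms(1) by (rule rationalE)
  have p: "p \<noteq> 0"
  proof
    assume "p = 0"
    then have "\<forall>\<^sub>F t in cofinite. r t = 0" using 1(2) by (auto elim: eventually_mono)
    then show False using assms(2) by simp
  qed
  show "rational (\<lambda>t. inverse (r t))"
    by (rule rationalI[of p _ q]) (use 1(2) p in \<open>auto elim!: eventually_mono\<close>)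
  show "\<forall>\<^sub>F t in cofinite. r t \<noteq> 0"
    using 1(2) eventually_cofinite_poly_nz[OF p] by eventually_elim simp
qed

lemma eventually_cofinite_nhds:
  assumes "\<forall>\<^sub>F t in cofinite. P (t::complex)"
  shows "\<forall>\<^sub>F t in cofinite. \<forall>\<^sub>F s in nhds t. P s"
proof -
  have "open (- {t. \<not> P t})"
    using assms by (intro open_Compl finite_imp_closed) (simp add: eventually_cofinite)
  then have op: "open {t. P t}" by (simp add: Collect_neg_eq)
  show ?thesis using assms by (rule eventually_mono) (use op in \<open>auto simp: eventually_nhds\<close>)
qed

lemma rational_has_derivative:
  assumes "rational r"
  obtains r' where "rational r'" "\<forall>\<^sub>F t in cofinite. (r has_field_derivative r' t) (at t)"
proof -
  obtain p q where 1: "q \<noteq> 0" "\<forall>\<^sub>F t in cofinite. poly q t \<noteq> 0 \<and> r t = poly p t / poly q t"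
    using assms by (rule rationalE)
  define r' where "r' t = poly (pderiv p * q - p * pderiv q) t / poly (q * q) t" for t
  have "rational r'" by (rule rationalI[of "q * q" _ "pderiv p * q - p * pderiv q"]) (use 1(1) in \<open>auto simp: r'_def\<close>)
  moreover have "\<forall>\<^sub>F t in cofinite. (r has_field_derivative r' t) (at t)"
    using eventually_cofinite_nhds[OF 1(2)]
  proof (rule eventually_mono)
    fix t assume t: "\<forall>\<^sub>F s in nhds t. poly q s \<noteq> 0 \<and> r s = poly p s / poly q s"
    then have q: "poly q t \<noteq> 0" using eventually_nhds_x_imp_x by fastforce
    have "((\<lambda>s. poly p s / poly q s) has_field_derivative r' t) (at t)"
      using q by (auto intro!: derivative_eq_intros simp: r'_def)
    moreover have "\<forall>\<^sub>F s in nhds t. poly p s / poly q s = r s"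
      using t by (auto elim: eventually_mono)
    ultimately show "(r has_field_derivative r' t) (at t)"
      using DERIV_cong_ev[of t t "\<lambda>s. poly p s / poly q s" r "r' t" "r' t"] by simp
  qed
  ultimately show ?thesis by (rule that)
qed

text \<open>
  The integral of a derivative over a small circle around q vanishes, while the
  integral of the right side is its residue c q up to a factor.
\<close>

lemma residue_of_rational_derivative:
  assumes r: "rational r" and S: "finite S"
    and d: "\<forall>\<^sub>F t in cofinite. (r has_field_derivative (\<Sum>p\<in>S. c p / (t - p))) (at t)"
    and q: "q \<in> S"
  shows "c q = (0::complex)"
proof -
  define F where "F = {t. \<not> (r has_field_derivative (\<Sum>p\<in>S. c p / (t - p))) (at t)}"
  have "finite (S \<union> F)" using d S by (simp add: F_def eventually_cofinite)
  then obtain R where R: "R > 0" "\<And>t. t \<in> S \<union> F \<Longrightarrow> t \<noteq> q \<Longrightarrow> R \<le> dist q t"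
    using finite_set_avoid[of "S \<union> F" q] by auto
  let ?g = "circlepath q (R / 2)"
  have img: "path_image ?g \<subseteq> ball q R" "q \<notin> path_image ?g"
    using R(1) by (auto simp: dist_norm)
  have "((\<lambda>t. \<Sum>p\<in>S. c p / (t - p)) has_contour_integral r (pathfinish ?g) - r (pathstart ?g)) ?g"
  proof (rule contour_integral_primitive[of "path_image ?g"])
    fix t assume t: "t \<in> path_image ?g"
    then have "dist q t < R" "t \<noteq> q" using img by (auto simp only: subset_iff mem_ball)
    then have "t \<notin> F" using R(2)[of t] by auto
    then show "(r has_field_derivative (\<Sum>p\<in>S. c p / (t - p))) (at t within path_image ?g)"
      by (auto simp: F_def intro: has_field_derivative_at_within)
  qed auto
  then have "((\<lambda>t. \<Sum>p\<in>S. c p / (t - p)) has_contour_integral 0) ?g" by simp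
  moreover have "((\<lambda>t. \<Sum>p\<in>S. c p / (t - p)) has_contour_integral
      (\<Sum>p\<in>S. if p = q then 2 * of_real pi * \<i> * c q else 0)) ?g"
  proof (rule has_contour_integral_sum[OF S])
    fix p assume p: "p \<in> S"
    show "((\<lambda>t. c p / (t - p)) has_contour_integral (if p = q then 2 * of_real pi * \<i> * c q else 0)) ?g"
    proof (cases "p = q")
      case True
      then show ?thesis
        using Cauchy_integral_circlepath_simple[of "\<lambda>_. c q" q "R / 2" q] R(1) by simp
    next
      case False
      then have "p \<notin> ball q R" using R(2)[of p] p by auto
      then have "(\<lambda>t. c p / (t - p)) holomorphic_on ball q R"
        by (intro holomorphic_intros) auto
      then show ?thesis
        using Cauchy_theorem_disc_simple[of "\<lambda>t. c p / (t - p)" q R ?g] img False by simp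
    qed
  qed
  ultimately have "(\<Sum>p\<in>S. if p = q then 2 * of_real pi * \<i> * c q else 0) = 0"
    using has_contour_integral_unique by blast
  then show ?thesis using S q by simp
qed

lemma rational_log_derivative_imp_const:
  assumes r: "rational r" and S: "finite S"
    and d: "\<forall>\<^sub>F t in cofinite. (r has_field_derivative (\<Sum>p\<in>S. c p / (t - p))) (at t)"
  shows "\<exists>k. \<forall>\<^sub>F t in cofinite. r t = k"
proof -
  have "c p = 0" if "p \<in> S" for p using residue_of_rational_derivative[OF r S d that] .
  then have d0: "\<forall>\<^sub>F t in cofinite. (r has_field_derivative 0) (at t)"
    using d by simp
  define F where "F = {t. \<not> (r has_field_derivative 0) (at t)}"
  have F: "finite F" using d0 by (simp add: F_def eventually_cofinite)
  have con: "connected (UNIV - F)"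
    by (rule connected_open_diff_countable) (use F in \<open>auto simp: countable_finite connected_UNIV\<close>)
  have op: "open (UNIV - F)" using F by (simp add: finite_imp_closed open_Diff)
  have "r constant_on (UNIV - F)"
    by (rule DERIV_zero_connected_constant_on[OF con op, of "{}"])
      (auto simp: F_def intro!: continuous_at_imp_continuous_on intro: DERIV_isCont[of r 0])
  then obtain k where "\<And>t. t \<notin> F \<Longrightarrow> r t = k" by (auto simp: constant_on_def)
  then have "\<forall>\<^sub>F t in cofinite. r t = k"
    unfolding eventually_cofinite by (intro finite_subset[OF _ F]) auto
  then show ?thesis ..
qed

text \<open>
  The derivative with respect to t, as opposed to the one with respect to the conjugate of t. It satisfies the product rule,
  annihilates constants, and agrees with the complex derivative on holomorphic functions, but it also applies to the
  real-valued polylogarithms.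
\<close>

definition has_wirtinger :: "(complex \<Rightarrow> complex) \<Rightarrow> complex \<Rightarrow> complex \<Rightarrow> bool" where
  "has_wirtinger g a t \<longleftrightarrow> (\<exists>b. (g has_derivative (\<lambda>h. a * h + b * cnj h)) (at t))"

lemma has_wirtinger_unique:
  assumes "has_wirtinger g a t" "has_wirtinger g a' t"
  shows "a = a'"
proof -
  obtain b b' where "(g has_derivative (\<lambda>h. a * h + b * cnj h)) (at t)"
      "(g has_derivative (\<lambda>h. a' * h + b' * cnj h)) (at t)"
    using assms by (auto simp: has_wirtinger_def)
  from has_derivative_unique[OF this] have eq: "a * h + b * cnj h = a' * h + b' * cnj h" for h
    by (rule fun_cong)
  from eq[of 1] eq[of \<i>] have "a + b = a' + b'" "\<i> * (a - b) = \<i> * (a' - b')"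
    by (simp_all add: algebra_simps)
  then have "a + b = a' + b'" "a - b = a' - b'" by auto
  then have "(a + b) + (a - b) = (a' + b') + (a' - b')" by simp
  then show ?thesis by simp
qed

lemma has_wirtinger_transform:
  assumes "has_wirtinger g a t" "\<forall>\<^sub>F s in nhds t. g s = k s"
  shows "has_wirtinger k a t"
proof -
  obtain b where "(g has_derivative (\<lambda>h. a * h + b * cnj h)) (at t)"
    using assms by (auto simp: has_wirtinger_def)
  moreover have "\<forall>\<^sub>F s in at t. g s = k s" "g t = k t"
    using assms(2) eventually_nhds_x_imp_x by (auto simp: eventually_nhds_conv_at)
  ultimately have "(k has_derivative (\<lambda>h. a * h + b * cnj h)) (at t)"
    by (intro has_derivative_transform_eventually[of g _ t UNIV k]) auto
  then show ?thesis by (auto simp: has_wirtinger_def)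
qed

lemma has_wirtinger_field_derivative:
  assumes "(r has_field_derivative d) (at t)"
  shows "has_wirtinger r d t"
  unfolding has_wirtinger_def
  by (rule exI[of _ 0]) (use assms in \<open>simp add: has_field_derivative_def\<close>)

lemma has_wirtinger_const: "has_wirtinger (\<lambda>_. c) 0 t"
  by (intro has_wirtinger_field_derivative) simp

lemma has_wirtinger_add:
  assumes "has_wirtinger g a t" "has_wirtinger k c t"
  shows "has_wirtinger (\<lambda>t. g t + k t) (a + c) t"
proof -
  obtain b d where "(g has_derivative (\<lambda>h. a * h + b * cnj h)) (at t)"
      "(k has_derivative (\<lambda>h. c * h + d * cnj h)) (at t)"
    using assms by (auto simp: has_wirtinger_def)
  from has_derivative_add[OF this] show ?thesis
    unfolding has_wirtinger_def by (intro exI[of _ "b + d"]) (simp add: algebra_simps)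
qed

lemma has_wirtinger_mult:
  assumes "has_wirtinger g a t" "has_wirtinger k c t"
  shows "has_wirtinger (\<lambda>t. g t * k t) (a * k t + g t * c) t"
proof -
  obtain b d where "(g has_derivative (\<lambda>h. a * h + b * cnj h)) (at t)"
      "(k has_derivative (\<lambda>h. c * h + d * cnj h)) (at t)"
    using assms by (auto simp: has_wirtinger_def)
  from has_derivative_mult[OF this] show ?thesis
    unfolding has_wirtinger_def by (intro exI[of _ "b * k t + g t * d"]) (simp add: algebra_simps)
qed

lemma has_wirtinger_sum:
  "(\<And>j. j \<in> J \<Longrightarrow> has_wirtinger (g j) (a j) t) \<Longrightarrow> has_wirtinger (\<lambda>t. \<Sum>j\<in>J. g j t) (\<Sum>j\<in>J. a j) t"
  by (induction J rule: infinite_finite_induct) (auto intro: has_wirtinger_const has_wirtinger_add)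

lemma has_wirtinger_imp_isCont: "has_wirtinger g a t \<Longrightarrow> isCont g t"
  unfolding has_wirtinger_def using has_derivative_continuous by blast

text \<open>
  A real differential is the sum of its (1,0)-part and the conjugate of that part, whence the factor 1/2.
\<close>

lemma has_wirtinger_Re:
  fixes F :: "complex \<Rightarrow> real"
  assumes "(F has_derivative (\<lambda>h. Re (\<alpha> * h))) (at t)"
  shows "has_wirtinger (\<lambda>t. of_real (F t)) (\<alpha> / 2) t"
proof -
  have "((\<lambda>t. complex_of_real (F t)) has_derivative (\<lambda>h. of_real (Re (\<alpha> * h)))) (at t)"
    by (rule has_derivative_of_real[OF assms])
  moreover have "of_real (Re (\<alpha> * h)) = \<alpha> / 2 * h + cnj \<alpha> / 2 * cnj h" for h
    by (simp add: complex_eq_iff field_simps)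
  ultimately show ?thesis unfolding has_wirtinger_def by (intro exI[of _ "cnj \<alpha> / 2"]) (simp only:)
qed

text \<open>
  S holds the possible poles of the logarithmic forms; \<open>\<Omega>\<close> may omit further points.
\<close>

locale punctured_plane =
  fixes S \<Omega> :: "complex set"
  assumes finite_S: "finite S" and open_\<Omega>: "open \<Omega>" and finite_compl_\<Omega>: "finite (- \<Omega>)"
    and \<Omega>_S: "\<Omega> \<inter> S = {}"
begin

definition log_form :: "(complex \<Rightarrow> complex) \<Rightarrow> complex \<Rightarrow> complex" where
  "log_form c t = (\<Sum>p\<in>S. c p / (t - p))"

lemma rational_log_form: "rational (log_form c)"
  unfolding log_form_def[abs_def] by (intro rational_sum rational_inverse_linear)

lemma eventually_cofinite_\<Omega>: "\<forall>\<^sub>F t in cofinite. t \<in> \<Omega>"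
  using finite_compl_\<Omega> by (simp add: eventually_cofinite Compl_eq)

text \<open>
  Iterated primitives of logarithmic forms: the derivative of k is a combination of unipotent
  functions with coefficients \<open>log_form c\<close>, and the recursion ends with functions that have an
  empty combination as derivative.
\<close>

inductive unipotent :: "(complex \<Rightarrow> complex) \<Rightarrow> bool" where
  unipotentI: "(\<And>c g. (c, g) \<in> set l \<Longrightarrow> unipotent g) \<Longrightarrow>
     (\<And>t. t \<in> \<Omega> \<Longrightarrow> has_wirtinger k (\<Sum>(c, g)\<leftarrow>l. log_form c t * g t) t) \<Longrightarrow> unipotent k"

definition fun_span :: "(complex \<Rightarrow> complex) list \<Rightarrow> (complex \<Rightarrow> complex) set" where
  "fun_span gs = {k. \<exists>d. \<forall>t\<in>\<Omega>. k t = (\<Sum>j<length gs. d j * (gs ! j) t)}"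

text \<open>
  A linearly independent list in which the derivative of every function is a combination, with logarithmic
  forms as coefficients, of the functions before it. Finite sets of unipotent functions lie in the span of a flag.
\<close>

definition flag :: "(complex \<Rightarrow> complex) list \<Rightarrow> bool" where
  "flag gs \<longleftrightarrow> (\<forall>i<length gs. gs ! i \<notin> fun_span (take i gs) \<and>
     (\<exists>c. \<forall>t\<in>\<Omega>. has_wirtinger (gs ! i) (\<Sum>j<i. log_form (c j) t * (gs ! j) t) t))"

lemma flag_butlast: "flag (gs @ [g]) \<Longrightarrow> flag gs"
  unfolding flag_def
proof (intro allI impI)
  fix i assume f: "\<forall>i<length (gs @ [g]). (gs @ [g]) ! i \<notin> fun_span (take i (gs @ [g])) \<and>
     (\<exists>c. \<forall>t\<in>\<Omega>. has_wirtinger ((gs @ [g]) ! i) (\<Sum>j<i. log_form (c j) t * ((gs @ [g]) ! j) t) t)"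
    and i: "i < length gs"
  have "(\<Sum>j<i. log_form (c j) t * ((gs @ [g]) ! j) t) = (\<Sum>j<i. log_form (c j) t * (gs ! j) t)" for c t
    using i by (intro sum.cong) (auto simp: nth_append)
  then show "gs ! i \<notin> fun_span (take i gs) \<and>
     (\<exists>c. \<forall>t\<in>\<Omega>. has_wirtinger (gs ! i) (\<Sum>j<i. log_form (c j) t * (gs ! j) t) t)"
    using spec[OF f, of i] i by (simp add: nth_append)
qed

lemma fun_span_append: "k \<in> fun_span gs \<Longrightarrow> k \<in> fun_span (gs @ hs)"
proof -
  assume "k \<in> fun_span gs"
  then obtain d where d: "\<forall>t\<in>\<Omega>. k t = (\<Sum>j<length gs. d j * (gs ! j) t)" by (auto simp: fun_span_def)
  have "(\<Sum>j<length gs. d j * (gs ! j) t)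
      = (\<Sum>j<length (gs @ hs). (if j < length gs then d j else 0) * ((gs @ hs) ! j) t)" for t
    by (intro sum.mono_neutral_cong_left) (auto simp: nth_append)
  then show ?thesis using d unfolding fun_span_def by (intro CollectI exI[of _ "\<lambda>j. if j < length gs then d j else 0"]) simp
qed

text \<open>
  Expressing all functions g in the list gs rewrites a combination with logarithmic coefficients. The point of
  the second conjunct is that the new residues C j are determined by the old ones, independently of t.
\<close>

lemma fun_span_combination:
  assumes "\<And>c g. (c, g) \<in> set l \<Longrightarrow> g \<in> fun_span gs"
  shows "\<exists>C. \<forall>t\<in>\<Omega>.
      (\<Sum>(c, g)\<leftarrow>l. log_form c t * g t) = (\<Sum>j<length gs. log_form (C j) t * (gs ! j) t) \<and>
      (\<forall>p. (\<Sum>(c, g)\<leftarrow>l. c p * g t) = (\<Sum>j<length gs. C j p * (gs ! j) t))"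
proof -
  have "\<forall>x\<in>set l. \<exists>d. \<forall>t\<in>\<Omega>. snd x t = (\<Sum>j<length gs. d j * (gs ! j) t)"
    using assms by (fastforce simp: fun_span_def)
  then obtain d where d: "\<And>x t. x \<in> set l \<Longrightarrow> t \<in> \<Omega> \<Longrightarrow> snd x t = (\<Sum>j<length gs. d x j * (gs ! j) t)"
    by metis
  define C where "C j p = (\<Sum>x\<leftarrow>l. fst x p * d x j)" for j p
  have C: "log_form (C j) t = (\<Sum>x\<leftarrow>l. log_form (fst x) t * d x j)" for j t
  proof -
    have "(\<Sum>p\<in>S. (\<Sum>x\<leftarrow>l'. fst x p * d x j) / (t - p)) = (\<Sum>x\<leftarrow>l'. (\<Sum>p\<in>S. fst x p / (t - p)) * d x j)" for l'
      by (induction l') (simp_all add: add_divide_distrib sum.distrib sum_distrib_right)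
    then show ?thesis by (simp add: log_form_def C_def)
  qed
  have expand: "(\<Sum>x\<leftarrow>l. a x * snd x t) = (\<Sum>j<length gs. (\<Sum>x\<leftarrow>l. a x * d x j) * (gs ! j) t)"
    if t: "t \<in> \<Omega>" for t and a :: "(complex \<Rightarrow> complex) \<times> (complex \<Rightarrow> complex) \<Rightarrow> complex"
  proof -
    have "(\<Sum>x\<leftarrow>l'. a x * snd x t) = (\<Sum>j<length gs. (\<Sum>x\<leftarrow>l'. a x * d x j) * (gs ! j) t)"
      if "set l' \<subseteq> set l" for l'
      using that
    proof (induction l')
      case (Cons x l')
      have "a x * snd x t = (\<Sum>j<length gs. a x * d x j * (gs ! j) t)"
        using d[of x t] Cons.prems t by (simp add: sum_distrib_left mult.assoc)
      then show ?case using Cons by (simp add: distrib_right sum.distrib)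
    qed simp
    then show ?thesis by blast
  qed
  show ?thesis
  proof (intro exI[of _ C] ballI conjI allI)
    fix t assume t: "t \<in> \<Omega>"
    show "(\<Sum>(c, g)\<leftarrow>l. log_form c t * g t) = (\<Sum>j<length gs. log_form (C j) t * (gs ! j) t)"
      using expand[OF t, of "\<lambda>x. log_form (fst x) t"] by (simp add: C case_prod_unfold)
    show "(\<Sum>(c, g)\<leftarrow>l. c p * g t) = (\<Sum>j<length gs. C j p * (gs ! j) t)" for p
      using expand[OF t, of "\<lambda>x. fst x p"] by (simp add: C_def case_prod_unfold)
  qed
qed

lemma flag_extend_list:
  assumes "\<And>c g gs. (c, g) \<in> set l \<Longrightarrow> flag gs \<Longrightarrow> \<exists>hs. flag (gs @ hs) \<and> g \<in> fun_span (gs @ hs)"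
    and "flag gs"
  shows "\<exists>hs. flag (gs @ hs) \<and> (\<forall>(c, g)\<in>set l. g \<in> fun_span (gs @ hs))"
  using assms(1)
proof (induction l)
  case Nil
  show ?case using assms(2) by (intro exI[of _ "[]"]) simp
next
  case (Cons x l)
  obtain c g where x: "x = (c, g)" by (cases x)
  have "\<exists>hs. flag (gs @ hs) \<and> (\<forall>(c, g)\<in>set l. g \<in> fun_span (gs @ hs))"
    by (rule Cons.IH) (use Cons.prems in auto)
  then obtain hs where hs: "flag (gs @ hs)" "\<forall>(c, g)\<in>set l. g \<in> fun_span (gs @ hs)" by blast
  obtain hs' where hs': "flag ((gs @ hs) @ hs')" "g \<in> fun_span ((gs @ hs) @ hs')"
    using Cons.prems[of c g "gs @ hs"] hs(1) x by auto
  show ?case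
  proof (intro exI[of _ "hs @ hs'"] conjI)
    show "flag (gs @ hs @ hs')" using hs' by simp
    show "\<forall>(c, g)\<in>set (x # l). g \<in> fun_span (gs @ hs @ hs')"
      using hs'(2) hs(2) fun_span_append[of _ "gs @ hs" hs'] x by auto
  qed
qed

text \<open>
  By induction over the construction of k: the functions in the derivative of k can be added to the flag, and then k
  itself either lies in the span or may be appended.
\<close>

lemma unipotent_in_flag:
  assumes "unipotent k" "flag gs"
  shows "\<exists>hs. flag (gs @ hs) \<and> k \<in> fun_span (gs @ hs)"
  using assms
proof (induction k arbitrary: gs rule: unipotent.induct)
  case (unipotentI l k)
  obtain hs where hs: "flag (gs @ hs)" "\<And>c g. (c, g) \<in> set l \<Longrightarrow> g \<in> fun_span (gs @ hs)"
    using flag_extend_list[of l gs] unipotentI.IH unipotentI.prems by blast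
  let ?gs = "gs @ hs"
  show ?case
  proof (cases "k \<in> fun_span ?gs")
    case True
    then show ?thesis using hs by blast
  next
    case False
    obtain C where C: "\<And>t. t \<in> \<Omega> \<Longrightarrow> (\<Sum>(c, g)\<leftarrow>l. log_form c t * g t) = (\<Sum>j<length ?gs. log_form (C j) t * (?gs ! j) t)"
    proof -
      have "\<exists>C. \<forall>t\<in>\<Omega>.
          (\<Sum>(c, g)\<leftarrow>l. log_form c t * g t) = (\<Sum>j<length ?gs. log_form (C j) t * (?gs ! j) t) \<and>
          (\<forall>p. (\<Sum>(c, g)\<leftarrow>l. c p * g t) = (\<Sum>j<length ?gs. C j p * (?gs ! j) t))"
        by (rule fun_span_combination) (rule hs(2))
      then show ?thesis using that by blast
    qed
    have "flag (?gs @ [k])"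
      unfolding flag_def
    proof (intro allI impI)
      fix i assume i: "i < length (?gs @ [k])"
      show "(?gs @ [k]) ! i \<notin> fun_span (take i (?gs @ [k])) \<and>
        (\<exists>c. \<forall>t\<in>\<Omega>. has_wirtinger ((?gs @ [k]) ! i) (\<Sum>j<i. log_form (c j) t * ((?gs @ [k]) ! j) t) t)"
      proof (cases "i < length ?gs")
        case True
        have eq: "(\<Sum>j<i. log_form (c j) t * ((?gs @ [k]) ! j) t) = (\<Sum>j<i. log_form (c j) t * (?gs ! j) t)" for c t
          using True by (intro sum.cong) (auto simp: nth_append)
        have "(?gs @ [k]) ! i = ?gs ! i" "take i (?gs @ [k]) = take i ?gs" using True by (auto simp: nth_append)
        then show ?thesis unfolding eq using hs(1) True unfolding flag_def by metis
      next
        case False': False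
        then have i: "i = length ?gs" using i by simp
        have nth: "(?gs @ [k]) ! i = k" "take i (?gs @ [k]) = ?gs"
          unfolding i by (simp_all only: nth_append_length append_eq_conv_conj[symmetric]) simp
        have "(\<Sum>j<i. log_form (C j) t * ((?gs @ [k]) ! j) t) = (\<Sum>(c, g)\<leftarrow>l. log_form c t * g t)" if "t \<in> \<Omega>" for t
          unfolding C[OF that] i by (intro sum.cong) (auto simp: nth_append)
        then show ?thesis unfolding nth using False unipotentI.hyps by (auto intro!: exI[of _ C])
      qed
    qed
    moreover have "k \<in> fun_span (?gs @ [k])"
      unfolding fun_span_def
      by (intro CollectI exI[of _ "\<lambda>j. if j = length ?gs then 1 else 0"]) simp
    ultimately show ?thesis by (intro exI[of _ "hs @ [k]"]) simp
  qed
qed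

lemma eventually_cofinite_at:
  assumes "\<forall>\<^sub>F t in cofinite. P (t::complex)"
  shows "\<forall>\<^sub>F t in at q. P t"
proof -
  have "open (- ({t. \<not> P t} - {q}))"
    using assms by (intro open_Compl finite_imp_closed) (simp add: eventually_cofinite)
  then have "\<forall>\<^sub>F t in at q. t \<in> - ({t. \<not> P t} - {q}) - {q}"
    by (intro eventually_at_in_open) auto
  then show ?thesis by (rule eventually_mono) auto
qed

lemma sum_triangle_swap:
  "(\<Sum>j<m. \<Sum>i<j. h j i) = (\<Sum>i<m. \<Sum>j\<in>{i<..<m}. h j (i::nat) :: complex)"
proof -
  have "(\<Sum>j<m. \<Sum>i<j. h j i) = (\<Sum>(j, i)\<in>(SIGMA j:{..<m}. {..<j}). h j i)"
    by (simp add: sum.Sigma)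
  also have "\<dots> = (\<Sum>(i, j)\<in>(SIGMA i:{..<m}. {i<..<m}). h j i)"
    by (rule sum.reindex_bij_witness[of _ "\<lambda>(i, j). (j, i)" "\<lambda>(j, i). (i, j)"]) auto
  also have "\<dots> = (\<Sum>i<m. \<Sum>j\<in>{i<..<m}. h j i)"
    by (simp add: sum.Sigma)
  finally show ?thesis .
qed

lemma log_form_diff_sum:
  "log_form (\<lambda>p. c p - (\<Sum>i\<in>J. k i * d i p)) t = log_form c t - (\<Sum>i\<in>J. k i * log_form (d i) t)"
proof -
  have "(\<Sum>i\<in>J. k i * log_form (d i) t) = (\<Sum>p\<in>S. (\<Sum>i\<in>J. k i * d i p) / (t - p))"
    unfolding log_form_def sum_distrib_left sum_divide_distrib by (subst sum.swap) simp
  then show ?thesis by (simp add: log_form_def diff_divide_distrib sum_subtractf)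
qed

text \<open>
  This is the argument of Kolchin and Ostrowski: linear independence over the complex numbers implies
  linear independence over the rational functions. In a shortest counterexample the last function g is a combination
  of the earlier ones with rational coefficients \<open>\<rho> j\<close>. Comparing derivatives yields a relation among the
  earlier functions, whose coefficients must vanish by induction. From the top index
  downwards this says that the derivative of \<open>\<rho> j\<close> is a logarithmic form; being the derivative of
  a rational function, it has no residues, so \<open>\<rho> j\<close> is constant. Hence g is a linear combination of the earlier
  functions, a contradiction.
\<close>

lemma flag_rational_independent:
  assumes "flag gs" "\<And>j. j < length gs \<Longrightarrow> rational (r j)"
    and "\<forall>\<^sub>F t in cofinite. (\<Sum>j<length gs. r j t * (gs ! j) t) = 0"
    and "j < length gs"
  shows "\<forall>\<^sub>F t in cofinite. r j t = 0"
  using assms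
proof (induction gs arbitrary: r j rule: rev_induct)
  case (snoc g ys)
  define m where "m = length ys"
  have ys: "flag ys" using snoc.prems(1) by (rule flag_butlast)
  note IH = snoc.IH[OF ys, folded m_def]
  have rat: "rational (r j)" if "j \<le> m" for j using snoc.prems(2)[of j] that by (simp add: m_def)
  have split: "(\<Sum>j<length (ys @ [g]). r j t * ((ys @ [g]) ! j) t) = (\<Sum>j<m. r j t * (ys ! j) t) + r m t * g t" for t
    by (simp add: m_def nth_append)
  note rel = snoc.prems(3)[unfolded split]
  have "\<forall>\<^sub>F t in cofinite. r m t = 0"
  proof (rule ccontr)
    assume nz: "\<not> (\<forall>\<^sub>F t in cofinite. r m t = 0)"
    define \<rho> where "\<rho> j t = (-1) * (r j t * inverse (r m t))" for j t
    have \<rho>: "rational (\<rho> j)" if "j < m" for j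
      unfolding \<rho>_def[abs_def] using that
      by (intro rational_mult rational_const rational_inverse(1)[OF _ nz] rat) auto
    have g: "\<forall>\<^sub>F t in cofinite. g t = (\<Sum>j<m. \<rho> j t * (ys ! j) t)"
      using rel rational_inverse(2)[OF rat nz, OF order_refl]
    proof eventually_elim
      case (elim t)
      have "(\<Sum>j<m. \<rho> j t * (ys ! j) t) = - inverse (r m t) * (\<Sum>j<m. r j t * (ys ! j) t)"
        unfolding \<rho>_def sum_distrib_left by (intro sum.cong) auto
      also have "(\<Sum>j<m. r j t * (ys ! j) t) = - (r m t * g t)"
        using elim(1) by (simp add: eq_neg_iff_add_eq_0)
      finally show ?case using elim(2) by simp
    qed
    have "\<forall>j. \<exists>\<rho>'. j < m \<longrightarrow> rational \<rho>' \<and> (\<forall>\<^sub>F t in cofinite. (\<rho> j has_field_derivative \<rho>' t) (at t))"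
      using rational_has_derivative[OF \<rho>] by metis
    then obtain \<rho>' where \<rho>': "\<And>j. j < m \<Longrightarrow> rational (\<rho>' j)"
        "\<And>j. j < m \<Longrightarrow> \<forall>\<^sub>F t in cofinite. (\<rho> j has_field_derivative \<rho>' j t) (at t)"
      by metis
    have "\<forall>i. \<exists>c. i < m \<longrightarrow> (\<forall>t\<in>\<Omega>. has_wirtinger (ys ! i) (\<Sum>j<i. log_form (c j) t * (ys ! j) t) t)"
      using ys unfolding flag_def m_def by blast
    then obtain c where c: "\<And>i t. i < m \<Longrightarrow> t \<in> \<Omega> \<Longrightarrow>
        has_wirtinger (ys ! i) (\<Sum>j<i. log_form (c i j) t * (ys ! j) t) t"
      by metis
    have nth: "(ys @ [g]) ! m = g" "take m (ys @ [g]) = ys" by (simp_all add: m_def)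
    have "m < length (ys @ [g])" by (simp add: m_def)
    with snoc.prems(1) have "(ys @ [g]) ! m \<notin> fun_span (take m (ys @ [g]))"
      "\<exists>d. \<forall>t\<in>\<Omega>. has_wirtinger ((ys @ [g]) ! m) (\<Sum>j<m. log_form (d j) t * ((ys @ [g]) ! j) t) t"
      unfolding flag_def by blast+
    then obtain d where g_new: "g \<notin> fun_span ys"
      and d: "\<And>t. t \<in> \<Omega> \<Longrightarrow> has_wirtinger g (\<Sum>j<m. log_form (d j) t * ((ys @ [g]) ! j) t) t"
      unfolding nth by blast
    have d_sum: "(\<Sum>j<m. log_form (d j) t * ((ys @ [g]) ! j) t) = (\<Sum>j<m. log_form (d j) t * (ys ! j) t)" for t
      by (intro sum.cong) (auto simp: m_def nth_append)
    \<comment> \<open>The coefficients of the relation obtained by differentiating g in two ways.\<close>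
    define s where "s j t = (\<rho>' j t + (\<Sum>i\<in>{j<..<m}. \<rho> i t * log_form (c i j) t)) + (-1) * log_form (d j) t" for j t
    have "\<forall>\<^sub>F t in cofinite. (\<Sum>j<m. s j t * (ys ! j) t) = 0"
    proof -
      have "\<forall>\<^sub>F t in cofinite. \<forall>j\<in>{..<m}. (\<rho> j has_field_derivative \<rho>' j t) (at t)"
        using \<rho>'(2) by (intro eventually_ball_finite) auto
      then show ?thesis
        using eventually_cofinite_nhds[OF g] eventually_cofinite_\<Omega>
      proof eventually_elim
        case (elim t)
        have "has_wirtinger (\<lambda>t. \<Sum>j<m. \<rho> j t * (ys ! j) t)
            (\<Sum>j<m. \<rho>' j t * (ys ! j) t + \<rho> j t * (\<Sum>i<j. log_form (c j i) t * (ys ! i) t)) t"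
          using elim by (intro has_wirtinger_sum has_wirtinger_mult has_wirtinger_field_derivative c) auto
        moreover have "\<forall>\<^sub>F t in nhds t. (\<Sum>j<m. \<rho> j t * (ys ! j) t) = g t"
          using elim(2) by (auto elim: eventually_mono)
        ultimately have "has_wirtinger g
            (\<Sum>j<m. \<rho>' j t * (ys ! j) t + \<rho> j t * (\<Sum>i<j. log_form (c j i) t * (ys ! i) t)) t"
          by (rule has_wirtinger_transform)
        from has_wirtinger_unique[OF this d[OF elim(3)]]
        have "(\<Sum>j<m. log_form (d j) t * (ys ! j) t)
            = (\<Sum>j<m. \<rho>' j t * (ys ! j) t) + (\<Sum>j<m. \<Sum>i<j. \<rho> j t * log_form (c j i) t * (ys ! i) t)"
          by (simp add: d_sum sum.distrib sum_distrib_left mult.assoc)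
        also have "\<dots> = (\<Sum>j<m. (\<rho>' j t + (\<Sum>i\<in>{j<..<m}. \<rho> i t * log_form (c i j) t)) * (ys ! j) t)"
          unfolding sum_triangle_swap by (simp add: distrib_right sum.distrib sum_distrib_right)
        finally show ?case by (simp add: s_def left_diff_distrib sum_subtractf)
      qed
    qed
    then have s0: "\<forall>\<^sub>F t in cofinite. s j t = 0" if "j < m" for j
    proof (rule IH[rotated])
      show "rational (s j)" if "j < m" for j
        unfolding s_def[abs_def] using that
        by (intro rational_add rational_sum rational_mult rational_const rational_log_form \<rho> \<rho>'(1)) auto
    qed fact
    have const: "\<exists>k. \<forall>\<^sub>F t in cofinite. \<rho> j t = k" if "j < m" for j
      using that
    \<comment> \<open>Descending induction: the condition at j involves only the coefficients of larger index.\<close>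
    proof (induction "m - j" arbitrary: j rule: less_induct)
      case less
      have "\<forall>i\<in>{j<..<m}. \<exists>k. \<forall>\<^sub>F t in cofinite. \<rho> i t = k"
      proof
        fix i assume "i \<in> {j<..<m}"
        then show "\<exists>k. \<forall>\<^sub>F t in cofinite. \<rho> i t = k" by (intro less.hyps) auto
      qed
      then obtain k where k: "\<And>i. i \<in> {j<..<m} \<Longrightarrow> \<forall>\<^sub>F t in cofinite. \<rho> i t = k i" by metis
      have k': "\<forall>\<^sub>F t in cofinite. \<forall>i\<in>{j<..<m}. \<rho> i t = k i"
        using k by (intro eventually_ball_finite) auto
      show ?case
      proof (rule rational_log_derivative_imp_const[OF \<rho>[OF less.prems] finite_S])
        show "\<forall>\<^sub>F t in cofinite. (\<rho> j has_field_derivative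
            (\<Sum>p\<in>S. (d j p - (\<Sum>i\<in>{j<..<m}. k i * c i j p)) / (t - p))) (at t)"
          using \<rho>'(2)[OF less.prems] s0[OF less.prems] k'
        proof eventually_elim
          case (elim t)
          have "\<rho>' j t = log_form (d j) t - (\<Sum>i\<in>{j<..<m}. k i * log_form (c i j) t)"
            using elim(2,3) by (simp add: s_def algebra_simps)
          also have "\<dots> = (\<Sum>p\<in>S. (d j p - (\<Sum>i\<in>{j<..<m}. k i * c i j p)) / (t - p))"
            unfolding log_form_diff_sum[symmetric] by (simp add: log_form_def)
          finally show ?case using elim(1) by simp
        qed
      qed
    qed
    then obtain k where k: "\<And>j. j < m \<Longrightarrow> \<forall>\<^sub>F t in cofinite. \<rho> j t = k j" by metis
    have "\<forall>\<^sub>F t in cofinite. \<forall>j\<in>{..<m}. \<rho> j t = k j"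
      using k by (intro eventually_ball_finite) auto
    with g have ev: "\<forall>\<^sub>F t in cofinite. g t - (\<Sum>j<m. k j * (ys ! j) t) = 0"
      by eventually_elim simp
    have "g t - (\<Sum>j<m. k j * (ys ! j) t) = 0" if t: "t \<in> \<Omega>" for t
    proof -
      have "isCont (\<lambda>t. g t - (\<Sum>j<m. k j * (ys ! j) t)) t"
        by (intro continuous_intros has_wirtinger_imp_isCont[OF d[OF t]] has_wirtinger_imp_isCont[OF c[OF _ t]]) auto
      then have A: "((\<lambda>t. g t - (\<Sum>j<m. k j * (ys ! j) t)) \<longlongrightarrow> g t - (\<Sum>j<m. k j * (ys ! j) t)) (at t)"
        by (simp add: isCont_def)
      have B: "((\<lambda>t. g t - (\<Sum>j<m. k j * (ys ! j) t)) \<longlongrightarrow> 0) (at t)"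
        by (rule tendsto_eventually[OF eventually_cofinite_at[OF ev]])
      show ?thesis by (rule tendsto_unique[OF _ A B]) simp
    qed
    then have "g \<in> fun_span ys" unfolding fun_span_def m_def by (intro CollectI exI[of _ k]) auto
    then show False using g_new by simp
  qed
  moreover have "\<forall>\<^sub>F t in cofinite. r j t = 0" if "j < m" for j
  proof (rule IH[of r])
    show "\<forall>\<^sub>F t in cofinite. (\<Sum>j<m. r j t * (ys ! j) t) = 0"
      using rel \<open>\<forall>\<^sub>F t in cofinite. r m t = 0\<close> by eventually_elim simp
  qed (use that rat in auto)
  moreover have "j < m \<or> j = m" using snoc.prems(4) by (auto simp: m_def)
  ultimately show ?case by blast
qed simp

text \<open>
  Independence over the rational functions allows coefficients to be compared: after expressing all g in a flag, every
  coefficient is a logarithmic form that vanishes, hence has vanishing residues.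
\<close>

lemma log_form_relation_trivial:
  assumes unip: "\<And>c g. (c, g) \<in> set l \<Longrightarrow> unipotent g"
    and rel: "\<And>t. t \<in> \<Omega> \<Longrightarrow> (\<Sum>(c, g)\<leftarrow>l. log_form c t * g t) = 0"
    and p: "p \<in> S" and t: "t \<in> \<Omega>"
  shows "(\<Sum>(c, g)\<leftarrow>l. c p * g t) = 0"
proof -
  have "flag []" by (simp add: flag_def)
  then obtain gs where gs: "flag gs" "\<And>c g. (c, g) \<in> set l \<Longrightarrow> g \<in> fun_span gs"
  proof -
    have "\<exists>hs. flag ([] @ hs) \<and> (\<forall>(c, g)\<in>set l. g \<in> fun_span ([] @ hs))"
      by (rule flag_extend_list[OF unipotent_in_flag[OF unip] \<open>flag []\<close>])
    then show ?thesis using that by auto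
  qed
  obtain C where C: "\<And>t. t \<in> \<Omega> \<Longrightarrow> (\<Sum>(c, g)\<leftarrow>l. log_form c t * g t) = (\<Sum>j<length gs. log_form (C j) t * (gs ! j) t)"
    "\<And>p t. t \<in> \<Omega> \<Longrightarrow> (\<Sum>(c, g)\<leftarrow>l. c p * g t) = (\<Sum>j<length gs. C j p * (gs ! j) t)"
  proof -
    have "\<exists>C. \<forall>t\<in>\<Omega>.
        (\<Sum>(c, g)\<leftarrow>l. log_form c t * g t) = (\<Sum>j<length gs. log_form (C j) t * (gs ! j) t) \<and>
        (\<forall>p. (\<Sum>(c, g)\<leftarrow>l. c p * g t) = (\<Sum>j<length gs. C j p * (gs ! j) t))"
      by (rule fun_span_combination) (rule gs(2))
    then show ?thesis using that by blast
  qed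
  have "C j p = 0" if "j < length gs" for j
  proof (rule residue_of_rational_derivative[OF rational_const[of 0] finite_S _ p])
    have "\<forall>\<^sub>F t in cofinite. (\<Sum>j<length gs. log_form (C j) t * (gs ! j) t) = 0"
      using eventually_cofinite_\<Omega> by (rule eventually_mono) (use C(1) rel in auto)
    from flag_rational_independent[OF gs(1) _ this that]
    have "\<forall>\<^sub>F t in cofinite. log_form (C j) t = 0" by (simp add: rational_log_form)
    then show "\<forall>\<^sub>F t in cofinite. ((\<lambda>_. 0) has_field_derivative (\<Sum>p\<in>S. C j p / (t - p))) (at t)"
      by (rule eventually_mono) (simp add: log_form_def)
  qed
  then show ?thesis unfolding C(2)[OF t] by simp
qed

end

section \<open>The symbol of a family of functions\<close>

lemma filterlim_ln_cmod_at_bot: "filterlim (\<lambda>t. ln (cmod (t - q))) at_bot (at q)"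
proof (rule filterlim_compose[OF ln_at_0])
  have "((\<lambda>t. cmod (t - q)) \<longlongrightarrow> cmod (q - q)) (at q)" by (intro tendsto_intros)
  then show "filterlim (\<lambda>t. cmod (t - q)) (at_right 0) (at q)"
    by (auto simp: filterlim_at eventually_at_filter)
qed

lemma tendsto_log_pole_imp:
  fixes g :: "complex \<Rightarrow> real"
  assumes lim: "((\<lambda>t. a * ln (cmod (t - q)) + g t) \<longlongrightarrow> L) (at q)" and g: "(g \<longlongrightarrow> \<epsilon>) (at q)"
  shows "a = 0" "\<epsilon> = L"
proof -
  show a: "a = 0"
  proof (rule ccontr)
    assume "a \<noteq> 0"
    then have "((\<lambda>t. ((a * ln (cmod (t - q)) + g t) - g t) / a) \<longlongrightarrow> (L - \<epsilon>) / a) (at q)"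
      by (intro tendsto_intros lim g)
    then have "((\<lambda>t. ln (cmod (t - q))) \<longlongrightarrow> (L - \<epsilon>) / a) (at q)" using \<open>a \<noteq> 0\<close> by simp
    moreover have "filterlim (\<lambda>t. ln (cmod (t - q))) at_infinity (at q)"
      using filterlim_mono[OF filterlim_ln_cmod_at_bot at_bot_le_at_infinity order_refl] .
    ultimately show False
      using not_tendsto_and_filterlim_at_infinity[of "at q"] by auto
  qed
  have "(g \<longlongrightarrow> L) (at q)" using lim a by simp
  then show "\<epsilon> = L" using tendsto_unique[OF _ g] by simp
qed

lemma has_real_derivative_affine_power_mult:
  fixes w A l B l' c d :: real
  shows "((\<lambda>s. w * (A + s * l) ^ Suc a * ((A + s * l) * c - (B + s * l') * d)) has_real_derivative
     w * (real (Suc a) * (A + s * l) ^ a * l * ((A + s * l) * c - (B + s * l') * d)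
        + (A + s * l) ^ Suc a * (l * c - l' * d))) (at s)"
proof -
  have 0: "((\<lambda>s. A + s * l) has_real_derivative l) (at s)"
    by (auto intro!: derivative_eq_intros)
  have 1: "((\<lambda>s. (A + s * l) ^ Suc a) has_real_derivative real (Suc a) * (l * (A + s * l) ^ a)) (at s)"
    using DERIV_power[OF 0, of "Suc a"] by (simp del: power_Suc of_nat_Suc)
  have 2: "((\<lambda>s. (A + s * l) * c - (B + s * l') * d) has_real_derivative l * c - l' * d) (at s)"
    by (auto intro!: derivative_eq_intros)
  show ?thesis
    using DERIV_cmult[OF DERIV_mult[OF 1 2], of w]
    by (simp add: mult_ac del: power_Suc of_nat_Suc)
qed

text \<open>
  The intended family consists of rational functions, with v and v' the divisors of f and of 1 - f, and
  e and e' the logarithms of the absolute values of their leading coefficients. The orders are real numbers because the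
  inductions over the weight multiply the real coefficients of a sum by them.
\<close>

locale log_family = punctured_plane S \<Omega> for S \<Omega> :: "complex set" +
  fixes I :: "'i set"
    and f :: "'i \<Rightarrow> complex \<Rightarrow> complex"
    and v v' :: "'i \<Rightarrow> complex \<Rightarrow> real" and e e' :: "'i \<Rightarrow> real"
  assumes finite_I: "finite I"
    and f_regular: "i \<in> I \<Longrightarrow> t \<in> \<Omega> \<Longrightarrow> f i t \<noteq> 0 \<and> f i t \<noteq> 1"
    and f_differentiable: "i \<in> I \<Longrightarrow> t \<in> \<Omega> \<Longrightarrow> f i field_differentiable (at t)"
    and ln_f: "i \<in> I \<Longrightarrow> t \<in> \<Omega> \<Longrightarrow> ln (cmod (f i t)) = e i + (\<Sum>p\<in>S. v i p * ln (cmod (t - p)))"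
    and ln_1_minus_f: "i \<in> I \<Longrightarrow> t \<in> \<Omega> \<Longrightarrow>
          ln (cmod (1 - f i t)) = e' i + (\<Sum>p\<in>S. v' i p * ln (cmod (t - p)))"
    and v_outside: "i \<in> I \<Longrightarrow> p \<notin> S \<Longrightarrow> v i p = 0" "i \<in> I \<Longrightarrow> p \<notin> S \<Longrightarrow> v' i p = 0"
begin

text \<open>
  The affine function of variables \<open>y p\<close> that gives \<open>log|f|\<close> at t when every
  \<open>y p\<close> is \<open>log|t - p|\<close>. Allowing arbitrary y separates the algebra from the point t.
\<close>

definition L :: "'i \<Rightarrow> (complex \<Rightarrow> real) \<Rightarrow> real" where
  "L i y = e i + (\<Sum>p\<in>S. v i p * y p)"

definition L' :: "'i \<Rightarrow> (complex \<Rightarrow> real) \<Rightarrow> real" where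
  "L' i y = e' i + (\<Sum>p\<in>S. v' i p * y p)"

text \<open>
  At the punctures themselves the value 0 regularises \<open>log 0\<close>; the choice does not affect the
  conclusion of \<open>tame_symbol_trivial\<close>.
\<close>

definition log_point :: "complex \<Rightarrow> complex \<Rightarrow> real" where
  "log_point t p = (if p = t then 0 else ln (cmod (t - p)))"

lemma ln_f_eq_L: "i \<in> I \<Longrightarrow> t \<in> \<Omega> \<Longrightarrow> ln (cmod (f i t)) = L i (log_point t)"
  and ln_1_minus_f_eq_L': "i \<in> I \<Longrightarrow> t \<in> \<Omega> \<Longrightarrow> ln (cmod (1 - f i t)) = L' i (log_point t)"
  using ln_f[of i t] ln_1_minus_f[of i t] \<Omega>_S
  by (auto simp: L_def L'_def log_point_def intro!: sum.cong)

lemma eventually_in_\<Omega>: "\<forall>\<^sub>F t in at q. t \<in> \<Omega>"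
  by (rule eventually_cofinite_at[OF eventually_cofinite_\<Omega>])

lemma log_expansion:
  assumes "q \<in> S" "t \<noteq> q"
  shows "c + (\<Sum>p\<in>S. u p * ln (cmod (t - p)))
    = u q * ln (cmod (t - q)) + (c + (\<Sum>p\<in>S - {q}. u p * ln (cmod (t - p))))"
  using finite_S assms by (simp add: sum.remove)

lemma log_expansion_tendsto:
  "((\<lambda>t. c + (\<Sum>p\<in>S - {q}. u p * ln (cmod (t - p)))) \<longlongrightarrow> c + (\<Sum>p\<in>S. u p * log_point q p)) (at q)"
proof -
  have "((\<lambda>t. c + (\<Sum>p\<in>S - {q}. u p * ln (cmod (t - p)))) \<longlongrightarrow> c + (\<Sum>p\<in>S - {q}. u p * ln (cmod (q - p)))) (at q)"
    by (intro tendsto_intros) auto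
  moreover have "(\<Sum>p\<in>S - {q}. u p * ln (cmod (q - p))) = (\<Sum>p\<in>S. u p * log_point q p)"
    using finite_S by (intro sum.mono_neutral_cong_left) (auto simp: log_point_def)
  ultimately show ?thesis by simp
qed

lemma log_expansion_at_limit:
  assumes q: "q \<in> S" and F: "\<And>t. t \<in> \<Omega> \<Longrightarrow> ln (cmod (F t)) = c + (\<Sum>p\<in>S. u p * ln (cmod (t - p)))"
    and "(F \<longlongrightarrow> l) (at q)" "l \<noteq> 0"
  shows "u q = 0" "c + (\<Sum>p\<in>S. u p * log_point q p) = ln (cmod l)"
proof -
  have "((\<lambda>t. ln (cmod (F t))) \<longlongrightarrow> ln (cmod l)) (at q)"
    using assms(3,4) by (intro tendsto_intros) auto
  then have "((\<lambda>t. u q * ln (cmod (t - q)) + (c + (\<Sum>p\<in>S - {q}. u p * ln (cmod (t - p))))) \<longlongrightarrow> ln (cmod l)) (at q)"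
  proof (rule Lim_transform_eventually)
    have "\<forall>\<^sub>F t in at q. t \<in> \<Omega> \<and> t \<noteq> q"
      using eventually_in_\<Omega> by (auto simp: eventually_conj_iff eventually_at_filter)
    then show "\<forall>\<^sub>F t in at q. ln (cmod (F t)) = u q * ln (cmod (t - q)) + (c + (\<Sum>p\<in>S - {q}. u p * ln (cmod (t - p))))"
      by (rule eventually_mono) (use F log_expansion[OF q] in auto)
  qed
  from tendsto_log_pole_imp[OF this log_expansion_tendsto]
  show "u q = 0" "c + (\<Sum>p\<in>S. u p * log_point q p) = ln (cmod l)" by auto
qed

text \<open>
  Near q only the summand of index q can be unbounded, so the sign of the order u q decides the behaviour.
\<close>

lemma filterlim_of_log_expansion:
  assumes q: "q \<in> S" and F: "\<And>t. t \<in> \<Omega> \<Longrightarrow> ln (cmod (F t)) = c + (\<Sum>p\<in>S. u p * ln (cmod (t - p)))"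
    and F_nz: "\<And>t. t \<in> \<Omega> \<Longrightarrow> F t \<noteq> 0"
  shows "u q > 0 \<Longrightarrow> (F \<longlongrightarrow> 0) (at q)"
    and "u q < 0 \<Longrightarrow> filterlim F at_infinity (at q)"
    and "u q = 0 \<Longrightarrow> ((\<lambda>t. cmod (F t)) \<longlongrightarrow> exp (c + (\<Sum>p\<in>S. u p * log_point q p))) (at q)"
proof -
  define g where "g t = c + (\<Sum>p\<in>S - {q}. u p * ln (cmod (t - p)))" for t
  have g: "(g \<longlongrightarrow> c + (\<Sum>p\<in>S. u p * log_point q p)) (at q)"
    unfolding g_def by (rule log_expansion_tendsto)
  have ev: "\<forall>\<^sub>F t in at q. exp (u q * ln (cmod (t - q)) + g t) = cmod (F t)"
  proof -
    have "\<forall>\<^sub>F t in at q. t \<in> \<Omega> \<and> t \<noteq> q"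
      using eventually_in_\<Omega> by (auto simp: eventually_conj_iff eventually_at_filter)
    then show ?thesis
    proof (rule eventually_mono)
      fix t assume t: "t \<in> \<Omega> \<and> t \<noteq> q"
      then have "u q * ln (cmod (t - q)) + g t = ln (cmod (F t))"
        using F[of t] log_expansion[OF q, of t c u] by (simp add: g_def)
      then show "exp (u q * ln (cmod (t - q)) + g t) = cmod (F t)" using F_nz t by simp
    qed
  qed
  show "(F \<longlongrightarrow> 0) (at q)" if "u q > 0"
  proof -
    have "filterlim (\<lambda>t. u q * ln (cmod (t - q))) at_bot (at q)"
      by (rule filterlim_tendsto_pos_mult_at_bot[OF tendsto_const that filterlim_ln_cmod_at_bot])
    from filterlim_compose[OF exp_at_bot this]
    have "((\<lambda>t. exp (u q * ln (cmod (t - q))) * exp (g t)) \<longlongrightarrow> 0 * exp (c + (\<Sum>p\<in>S. u p * log_point q p))) (at q)"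
      by (intro tendsto_intros g)
    then have "((\<lambda>t. exp (u q * ln (cmod (t - q)) + g t)) \<longlongrightarrow> 0) (at q)"
      by (simp add: exp_add)
    then have "((\<lambda>t. cmod (F t)) \<longlongrightarrow> 0) (at q)"
      by (rule Lim_transform_eventually) (rule ev)
    then show ?thesis by (simp add: tendsto_norm_zero_iff)
  qed
  show "filterlim F at_infinity (at q)" if "u q < 0"
  proof -
    have "filterlim (\<lambda>t. u q * ln (cmod (t - q))) at_top (at q)"
      unfolding filterlim_uminus_at_top
      using filterlim_tendsto_pos_mult_at_bot[OF tendsto_const[of "- u q"] _ filterlim_ln_cmod_at_bot] that
      by simp
    then have "filterlim (\<lambda>t. g t + u q * ln (cmod (t - q))) at_top (at q)"
      by (rule filterlim_tendsto_add_at_top[OF g])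
    then have "filterlim (\<lambda>t. exp (u q * ln (cmod (t - q)) + g t)) at_top (at q)"
      using filterlim_compose[OF exp_at_top] by (simp add: add.commute)
    then have "filterlim (\<lambda>t. cmod (F t)) at_top (at q)"
      using filterlim_cong[OF refl refl ev] by simp
    then show ?thesis by (rule filterlim_norm_at_top_imp_at_infinity)
  qed
  show "((\<lambda>t. cmod (F t)) \<longlongrightarrow> exp (c + (\<Sum>p\<in>S. u p * log_point q p))) (at q)" if "u q = 0"
  proof -
    have "((\<lambda>t. exp (u q * ln (cmod (t - q)) + g t)) \<longlongrightarrow> exp (c + (\<Sum>p\<in>S. u p * log_point q p))) (at q)"
      using that by (auto intro!: tendsto_intros g)
    then show ?thesis by (rule Lim_transform_eventually) (rule ev)
  qed
qed

text \<open>
  This says that the tame symbol of f and 1 - f at q has absolute value 1. If f vanishes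
  at q, then 1 - f tends to 1; if f has a pole, then (1 - f) / f tends to -1; if
  f is a nonzero constant to leading order, then 1 - f can only vanish at q when f tends to 1, and it cannot have a pole.
\<close>

lemma tame_symbol_trivial:
  assumes i: "i \<in> I"
  shows "L i (log_point q) * v' i q = L' i (log_point q) * v i q"
proof (cases "q \<in> S")
  case False
  then show ?thesis using v_outside[OF i] by simp
next
  case q: True
  have F: "ln (cmod (f i t)) = e i + (\<Sum>p\<in>S. v i p * ln (cmod (t - p)))"
    and F': "ln (cmod (1 - f i t)) = e' i + (\<Sum>p\<in>S. v' i p * ln (cmod (t - p)))"
    and nz: "f i t \<noteq> 0" "1 - f i t \<noteq> 0" if "t \<in> \<Omega>" for t
    using f_regular[OF i that] ln_f[OF i that] ln_1_minus_f[OF i that] by auto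
  have lim: "v i q > 0 \<Longrightarrow> (f i \<longlongrightarrow> 0) (at q)" "v i q < 0 \<Longrightarrow> filterlim (f i) at_infinity (at q)"
      "v i q = 0 \<Longrightarrow> ((\<lambda>t. cmod (f i t)) \<longlongrightarrow> exp (e i + (\<Sum>p\<in>S. v i p * log_point q p))) (at q)"
    using filterlim_of_log_expansion[OF q, of "f i" "e i" "v i"] F nz by blast+
  have lim': "v' i q > 0 \<Longrightarrow> ((\<lambda>t. 1 - f i t) \<longlongrightarrow> 0) (at q)"
      "v' i q < 0 \<Longrightarrow> filterlim (\<lambda>t. 1 - f i t) at_infinity (at q)"
    using filterlim_of_log_expansion[OF q, of "\<lambda>t. 1 - f i t" "e' i" "v' i"] F' nz by blast+
  consider "v i q > 0" | "v i q < 0" | "v i q = 0" "v' i q > 0" | "v i q = 0" "v' i q < 0"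
    | "v i q = 0" "v' i q = 0" by linarith
  then show ?thesis
  proof cases
    case 1
    have "((\<lambda>t. 1 - f i t) \<longlongrightarrow> 1 - 0) (at q)" by (intro tendsto_intros lim(1) 1)
    then show ?thesis
      using log_expansion_at_limit[OF q, of "\<lambda>t. 1 - f i t" "e' i" "v' i" 1] F' by (simp add: L'_def)
  next
    case 2
    have "((\<lambda>t. inverse (f i t)) \<longlongrightarrow> 0) (at q)"
      by (rule filterlim_compose[OF tendsto_inverse_0 lim(2)[OF 2]])
    then have "((\<lambda>t. inverse (f i t) - 1) \<longlongrightarrow> 0 - 1) (at q)" by (intro tendsto_intros)
    moreover have "ln (cmod (inverse (f i t) - 1)) = (e' i - e i) + (\<Sum>p\<in>S. (v' i p - v i p) * ln (cmod (t - p)))"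
      if t: "t \<in> \<Omega>" for t
    proof -
      have "inverse (f i t) - 1 = (1 - f i t) / f i t" using nz(1)[OF t] by (simp add: field_simps)
      then have "ln (cmod (inverse (f i t) - 1)) = ln (cmod (1 - f i t)) - ln (cmod (f i t))"
        using nz[OF t] by (simp add: norm_divide ln_div)
      then show ?thesis using F[OF t] F'[OF t] by (simp add: left_diff_distrib sum_subtractf)
    qed
    ultimately have "v' i q - v i q = 0" "(e' i - e i) + (\<Sum>p\<in>S. (v' i p - v i p) * log_point q p) = ln (cmod (0 - 1))"
      using log_expansion_at_limit[OF q, of "\<lambda>t. inverse (f i t) - 1" "e' i - e i" "\<lambda>p. v' i p - v i p" "0 - 1"] by auto
    then have "v' i q = v i q" "L' i (log_point q) = L i (log_point q)"
      by (auto simp: L_def L'_def left_diff_distrib sum_subtractf)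
    then show ?thesis by simp
  next
    case 3
    have "((\<lambda>t. 1 - (1 - f i t)) \<longlongrightarrow> 1 - 0) (at q)" by (intro tendsto_intros lim'(1) 3)
    then have "(f i \<longlongrightarrow> 1) (at q)" by simp
    then show ?thesis
      using log_expansion_at_limit[OF q, of "f i" "e i" "v i" 1] F 3 by (simp add: L_def)
  next
    case 4
    have "filterlim (\<lambda>t. cmod (1 - f i t)) at_top (at q)"
      by (rule filterlim_at_infinity_imp_norm_at_top[OF lim'(2)[OF 4(2)]])
    then have "filterlim (\<lambda>t. 1 + cmod (f i t)) at_top (at q)"
    proof (rule filterlim_at_top_mono)
      show "\<forall>\<^sub>F t in at q. cmod (1 - f i t) \<le> 1 + cmod (f i t)"
        using norm_triangle_ineq4[of 1 "f i _"] by (auto intro!: always_eventually)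
    qed
    then have "filterlim (\<lambda>t. 1 + cmod (f i t)) at_infinity (at q)"
      using filterlim_mono[OF _ at_top_le_at_infinity order_refl] by blast
    moreover have "((\<lambda>t. 1 + cmod (f i t)) \<longlongrightarrow> 1 + exp (e i + (\<Sum>p\<in>S. v i p * log_point q p))) (at q)"
      by (intro tendsto_intros lim(3) 4)
    ultimately have False
      using not_tendsto_and_filterlim_at_infinity[of "at q"] by auto
    then show ?thesis ..
  qed simp
qed

text \<open>
  The closedness condition for weight a + 2: up to multinomial factors these are the coefficients of the weighted
  sum of the 2-forms \<open>l ^ a dl \<and> dl'\<close>, where l and l' are the linear parts of L and L'.
\<close>

definition integrable_symbol :: "nat \<Rightarrow> ('i \<Rightarrow> real) \<Rightarrow> bool" where
  "integrable_symbol a w \<longleftrightarrow> (\<forall>m p q. size m = a \<longrightarrow>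
     (\<Sum>i\<in>I. w i * (\<Prod>r\<in>#m. v i r) * (v i p * v' i q - v i q * v' i p)) = 0)"

text \<open>
  Contracting with one basis vector lowers the weight by one. This drives all inductions over the weight.
\<close>

lemma integrable_symbol_contract:
  "integrable_symbol (Suc a) w \<longleftrightarrow> (\<forall>p. integrable_symbol a (\<lambda>i. w i * v i p))"
proof
  assume w: "integrable_symbol (Suc a) w"
  show "\<forall>p. integrable_symbol a (\<lambda>i. w i * v i p)"
    unfolding integrable_symbol_def
  proof (intro allI impI)
    fix r p q :: complex and m :: "complex multiset" assume "size m = a"
    then have "size (add_mset r m) = Suc a" by simp
    then have "(\<Sum>i\<in>I. w i * (\<Prod>r\<in>#add_mset r m. v i r) * (v i p * v' i q - v i q * v' i p)) = 0"
      using w unfolding integrable_symbol_def by blast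
    then show "(\<Sum>i\<in>I. w i * v i r * (\<Prod>r\<in>#m. v i r) * (v i p * v' i q - v i q * v' i p)) = 0"
      by (simp add: mult_ac)
  qed
next
  assume w: "\<forall>p. integrable_symbol a (\<lambda>i. w i * v i p)"
  show "integrable_symbol (Suc a) w"
    unfolding integrable_symbol_def
  proof (intro allI impI)
    fix m :: "complex multiset" and p q assume "size m = Suc a"
    from size_eq_Suc_imp_eq_union[OF this] obtain r m' where "m = add_mset r m'" by blast
    with \<open>size m = Suc a\<close> have m: "m = add_mset r m'" "size m' = a" by auto
    then have "(\<Sum>i\<in>I. w i * v i r * (\<Prod>r\<in>#m'. v i r) * (v i p * v' i q - v i q * v' i p)) = 0"
      using w unfolding integrable_symbol_def by blast
    then show "(\<Sum>i\<in>I. w i * (\<Prod>r\<in>#m. v i r) * (v i p * v' i q - v i q * v' i p)) = 0"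
      by (simp add: m mult_ac)
  qed
qed

lemma L_line: "L i (\<lambda>p. y p + s * d p) = L i y + s * (\<Sum>p\<in>S. v i p * d p)"
  and L'_line: "L' i (\<lambda>p. y p + s * d p) = L' i y + s * (\<Sum>p\<in>S. v' i p * d p)"
  by (simp_all add: L_def L'_def sum.distrib sum_distrib_left algebra_simps)

text \<open>
  Closedness only concerns the linear parts of L and L', but the polylogarithms involve the affine functions,
  constants included. The constants are controlled as follows: as a function of y the left side has
  vanishing gradient, by closedness and by the induction hypothesis applied to the contractions, and at the point
  \<open>log_point q\<close> every summand is 0 by triviality of the tame symbol at q.
\<close>

lemma symbol_1_form_vanishes:
  assumes "integrable_symbol a w"
  shows "(\<Sum>i\<in>I. w i * L i y ^ a * (L i y * v' i q - L' i y * v i q)) = 0"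
  using assms
proof (induction a arbitrary: w y q)
  case 0
  have base: "(\<Sum>i\<in>I. w i * (L i (log_point q) * v' i q - L' i (log_point q) * v i q)) = 0"
    by (rule sum.neutral) (simp add: tame_symbol_trivial)
  define d where "d p = y p - log_point q p" for p
  have "y = (\<lambda>p. log_point q p + 1 * d p)" by (simp add: d_def)
  then have "L i y * v' i q - L' i y * v i q = (L i (log_point q) * v' i q - L' i (log_point q) * v i q)
      + (\<Sum>p\<in>S. d p * (v i p * v' i q - v i q * v' i p))" for i
    by (simp only: L_line L'_line) (simp add: algebra_simps sum_distrib_left sum_subtractf)
  then have "(\<Sum>i\<in>I. w i * (L i y * v' i q - L' i y * v i q))
      = (\<Sum>i\<in>I. \<Sum>p\<in>S. d p * (w i * (v i p * v' i q - v i q * v' i p)))"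
    using base by (simp add: distrib_left sum.distrib sum_distrib_left mult_ac)
  also have "\<dots> = (\<Sum>p\<in>S. d p * (\<Sum>i\<in>I. w i * (v i p * v' i q - v i q * v' i p)))"
    by (subst sum.swap) (simp add: sum_distrib_left)
  also have "\<dots> = 0"
    using 0 by (intro sum.neutral) (auto simp: integrable_symbol_def)
  finally show ?case by simp
next
  case (Suc a)
  have H: "(\<Sum>i\<in>I. w i * v i p * L i y ^ a * (L i y * v' i q - L' i y * v i q)) = 0" for p q y
    using Suc.prems by (intro Suc.IH) (simp add: integrable_symbol_contract)
  have A: "(\<Sum>i\<in>I. w i * L i y ^ Suc a * (v i p * v' i q - v i q * v' i p)) = 0" for p q y
  proof -
    have "(\<Sum>i\<in>I. w i * L i y ^ Suc a * (v i p * v' i q - v i q * v' i p))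
        = (\<Sum>i\<in>I. w i * v i p * L i y ^ a * (L i y * v' i q - L' i y * v i q))
          - (\<Sum>i\<in>I. w i * v i q * L i y ^ a * (L i y * v' i p - L' i y * v i p))"
      by (simp add: sum_subtractf[symmetric] algebra_simps)
    then show ?thesis by (simp add: H)
  qed
  \<comment> \<open>The function g is the sum along the segment from the base point to y.\<close>
  define y0 where "y0 = log_point q"
  define d where "d p = y p - y0 p" for p
  define g where "g s = (\<Sum>i\<in>I. w i * L i (\<lambda>p. y0 p + s * d p) ^ Suc a *
      (L i (\<lambda>p. y0 p + s * d p) * v' i q - L' i (\<lambda>p. y0 p + s * d p) * v i q))" for s
  have "(g has_real_derivative 0) (at s)" for s
  proof -
    define z where "z = (\<lambda>p. y0 p + s * d p)"
    define l where "l i = (\<Sum>p\<in>S. v i p * d p)" for i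
    define l' where "l' i = (\<Sum>p\<in>S. v' i p * d p)" for i
    have "(g has_real_derivative (\<Sum>i\<in>I. w i * (real (Suc a) * L i z ^ a * l i * (L i z * v' i q - L' i z * v i q)
        + L i z ^ Suc a * (l i * v' i q - l' i * v i q)))) (at s)"
      unfolding g_def[abs_def] L_line L'_line z_def l_def l'_def
      by (intro DERIV_sum has_real_derivative_affine_power_mult)
    also have "(\<Sum>i\<in>I. w i * (real (Suc a) * L i z ^ a * l i * (L i z * v' i q - L' i z * v i q)
        + L i z ^ Suc a * (l i * v' i q - l' i * v i q)))
      = (\<Sum>i\<in>I. \<Sum>p\<in>S. real (Suc a) * d p * (w i * v i p * L i z ^ a * (L i z * v' i q - L' i z * v i q))
          + d p * (w i * L i z ^ Suc a * (v i p * v' i q - v i q * v' i p)))"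
      unfolding l_def l'_def
      by (intro sum.cong refl) (simp add: sum_distrib_left sum_distrib_right sum.distrib sum_subtractf algebra_simps del: of_nat_Suc)
    also have "\<dots> = (\<Sum>p\<in>S. real (Suc a) * d p * (\<Sum>i\<in>I. w i * v i p * L i z ^ a * (L i z * v' i q - L' i z * v i q))
          + d p * (\<Sum>i\<in>I. w i * L i z ^ Suc a * (v i p * v' i q - v i q * v' i p)))"
      by (subst sum.swap) (simp only: sum.distrib sum_distrib_left)
    also have "\<dots> = 0" unfolding A H by simp
    finally show ?thesis .
  qed
  then have "g 1 = g 0" by (intro DERIV_isconst_all) auto
  moreover have "g 0 = 0"
    unfolding g_def y0_def by (intro sum.neutral) (simp add: tame_symbol_trivial)
  ultimately show ?case by (simp add: g_def d_def)
qed

lemma symbol_2_form_vanishes: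
  assumes "integrable_symbol a w"
  shows "(\<Sum>i\<in>I. w i * L i y ^ a * (v i p * v' i q - v i q * v' i p)) = 0"
proof (cases a)
  case 0
  then show ?thesis using assms by (simp add: integrable_symbol_def)
next
  case (Suc b)
  have H: "(\<Sum>i\<in>I. w i * v i p * L i y ^ b * (L i y * v' i q - L' i y * v i q)) = 0" for p q
    using assms Suc by (intro symbol_1_form_vanishes) (simp add: integrable_symbol_contract)
  have "(\<Sum>i\<in>I. w i * L i y ^ a * (v i p * v' i q - v i q * v' i p))
      = (\<Sum>i\<in>I. w i * v i p * L i y ^ b * (L i y * v' i q - L' i y * v i q))
        - (\<Sum>i\<in>I. w i * v i q * L i y ^ b * (L i y * v' i p - L' i y * v i p))"
    by (simp add: Suc sum_subtractf[symmetric] algebra_simps)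
  then show ?thesis by (simp add: H)
qed

text \<open>
  The condition survives replacing a factors l by the values of the affine functions L at a fixed y. This makes it possible to freeze the
  powers of \<open>log|f|\<close> that occur in the differential and to regard them as weights.
\<close>

lemma integrable_symbol_specialize:
  assumes "integrable_symbol (a + b) w"
  shows "integrable_symbol b (\<lambda>i. w i * L i y ^ a)"
  using assms
proof (induction b arbitrary: w)
  case 0
  then show ?case using symbol_2_form_vanishes[of a w] by (simp add: integrable_symbol_def)
next
  case (Suc b)
  have "integrable_symbol b (\<lambda>i. w i * v i p * L i y ^ a)" for p
    using Suc.prems by (intro Suc.IH) (simp add: integrable_symbol_contract)
  then show ?case unfolding integrable_symbol_contract[of b] by (simp add: mult_ac)
qed

end

section \<open>Closed symbols give constant sums\<close>

text \<open>
  The complex number that represents the real form \<open>polylog_form\<close> as the real part of a multiple of the tangent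
  vector.
\<close>

definition polylog_coeff :: "nat \<Rightarrow> real \<Rightarrow> (nat \<Rightarrow> real) \<Rightarrow> complex \<Rightarrow> complex \<Rightarrow> complex" where
  "polylog_coeff n x M \<omega> \<omega>' =
     (if n = 2 then - \<i> * (of_real x * \<omega>' + of_real (M 1) * \<omega>)
      else - \<i> * of_real (Re_Im_sign n * M (n - 1)) * \<omega>
         - (\<Sum>k = 2..<n - 1. of_real (zagier_beta k * x ^ (k - 1) * M (n - k))) * \<omega>
         - of_real (zagier_beta (n - 1) * x ^ (n - 2)) * (of_real x * \<omega>' + of_real (M 1) * \<omega>))"

lemma polylog_form_eq_Re:
  "polylog_form n x M (\<omega> * h) (\<omega>' * h) = Re (polylog_coeff n x M \<omega> \<omega>' * h)"
  by (simp add: polylog_form_def polylog_coeff_def algebra_simps)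

context punctured_plane
begin

lemma log_form_scale: "log_form (\<lambda>p. a * c p) t = a * log_form c t"
  by (simp add: log_form_def sum_distrib_left)

lemma unipotent_const: "unipotent (\<lambda>_. c)"
  by (rule unipotentI[of "[]"]) (auto intro: has_wirtinger_const)

text \<open>
  Double induction: the product rule lists products in which one factor has been replaced by a function from
  its derivative.
\<close>

lemma unipotent_mult:
  assumes "unipotent g" "unipotent k"
  shows "unipotent (\<lambda>t. g t * k t)"
  using assms
proof (induction g arbitrary: k rule: unipotent.induct)
  case (unipotentI l g)
  have g: "unipotent g"
    by (rule unipotent.unipotentI[of l]) (erule unipotentI.hyps(1), erule unipotentI.hyps(2))
  note IH1 = unipotentI.IH and hyps1 = unipotentI.hyps
  from \<open>unipotent k\<close> show ?case
  proof (induction k rule: unipotent.induct)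
    case (unipotentI l2 k)
    have k: "unipotent k"
      by (rule unipotent.unipotentI[of l2]) (erule unipotentI.hyps(1), erule unipotentI.hyps(2))
    show ?case
    proof (rule unipotent.unipotentI[of "map (\<lambda>(c, g'). (c, \<lambda>t. g' t * k t)) l @ map (\<lambda>(c, k'). (c, \<lambda>t. g t * k' t)) l2"])
      fix c h assume "(c, h) \<in> set (map (\<lambda>(c, g'). (c, \<lambda>t. g' t * k t)) l @ map (\<lambda>(c, k'). (c, \<lambda>t. g t * k' t)) l2)"
      then have "(\<exists>g'. (c, g') \<in> set l \<and> h = (\<lambda>t. g' t * k t)) \<or> (\<exists>k'. (c, k') \<in> set l2 \<and> h = (\<lambda>t. g t * k' t))"
        by auto
      then show "unipotent h" using IH1[OF _ k] unipotentI.IH by blast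
    next
      fix t assume t: "t \<in> \<Omega>"
      have "(\<Sum>(c, g)\<leftarrow>map (\<lambda>(c, g'). (c, \<lambda>t. g' t * k t)) l. log_form c t * g t) = (\<Sum>(c, g)\<leftarrow>l. log_form c t * g t) * k t" for l
        by (induction l) (auto simp: algebra_simps)
      moreover have "(\<Sum>(c, g)\<leftarrow>map (\<lambda>(c, k'). (c, \<lambda>t. g t * k' t)) l. log_form c t * g t) = g t * (\<Sum>(c, g)\<leftarrow>l. log_form c t * g t)" for l
        by (induction l) (auto simp: algebra_simps)
      ultimately show "has_wirtinger (\<lambda>t. g t * k t) (\<Sum>(c, g)\<leftarrow>map (\<lambda>(c, g'). (c, \<lambda>t. g' t * k t)) l @ map (\<lambda>(c, k'). (c, \<lambda>t. g t * k' t)) l2. log_form c t * g t) t"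
        using has_wirtinger_mult[OF hyps1(2)[OF t] unipotentI.hyps(2)[OF t]] by simp
    qed
  qed
qed

lemma unipotent_power: "unipotent g \<Longrightarrow> unipotent (\<lambda>t. g t ^ n)"
  by (induction n) (simp_all add: unipotent_const unipotent_mult)

lemma has_derivative_log_sum:
  assumes t: "t \<in> \<Omega>"
  shows "((\<lambda>t. c + (\<Sum>p\<in>S. u p * ln (cmod (t - p)))) has_derivative
     (\<lambda>h. Re (log_form (\<lambda>p. of_real (u p)) t * h))) (at t)"
proof -
  have ln: "((\<lambda>t. ln (cmod (t - p))) has_derivative (\<lambda>h. Re (h / (t - p)))) (at t)" if "p \<in> S" for p
  proof (rule has_derivative_compose[of "\<lambda>t. t - p" "\<lambda>h. h"])
    show "((\<lambda>t. t - p) has_derivative (\<lambda>h. h)) (at t)"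
      by (auto intro!: derivative_eq_intros)
    show "((\<lambda>z. ln (cmod z)) has_derivative (\<lambda>h. Re (h / (t - p)))) (at (t - p))"
      by (rule has_derivative_ln_cmod) (use that t \<Omega>_S in auto)
  qed
  have "((\<lambda>t. c + (\<Sum>p\<in>S. u p * ln (cmod (t - p)))) has_derivative
     (\<lambda>h. 0 + (\<Sum>p\<in>S. u p * Re (h / (t - p))))) (at t)"
    by (intro has_derivative_add has_derivative_const has_derivative_sum has_derivative_mult_right ln)
  moreover have "0 + (\<Sum>p\<in>S. u p * Re (h / (t - p))) = Re (log_form (\<lambda>p. of_real (u p)) t * h)" for h
  proof -
    have "Re (of_real (u p) / (t - p) * h) = u p * Re (h / (t - p))" for p
    proof -
      have "of_real (u p) / (t - p) * h = of_real (u p) * (h / (t - p))" by simp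
      then show ?thesis by (simp only: Re_complex_of_real times_complex.sel Im_complex_of_real)
    qed
    then show ?thesis by (simp add: log_form_def sum_distrib_right)
  qed
  ultimately show ?thesis by simp
qed

end

context log_family
begin

abbreviation \<omega> :: "'i \<Rightarrow> complex \<Rightarrow> complex" where
  "\<omega> i \<equiv> log_form (\<lambda>p. of_real (v i p))"

abbreviation \<omega>' :: "'i \<Rightarrow> complex \<Rightarrow> complex" where
  "\<omega>' i \<equiv> log_form (\<lambda>p. of_real (v' i p))"

abbreviation x :: "'i \<Rightarrow> complex \<Rightarrow> real" where
  "x i t \<equiv> L i (log_point t)"

abbreviation x' :: "'i \<Rightarrow> complex \<Rightarrow> real" where
  "x' i t \<equiv> L' i (log_point t)"

abbreviation G :: "nat \<Rightarrow> 'i \<Rightarrow> complex \<Rightarrow> real" where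
  "G n i t \<equiv> sv_polylog n (f i t)"

lemma eventually_nhds_\<Omega>: "t \<in> \<Omega> \<Longrightarrow> \<forall>\<^sub>F s in nhds t. s \<in> \<Omega>"
  using open_\<Omega> by (rule eventually_nhds_in_open)

text \<open>
  The real part of the logarithmic derivative is determined by the differential of
  \<open>log|F|\<close>, and a complex linear form is determined by its real part.
\<close>

lemma logarithmic_derivative_unique:
  assumes F: "(F has_field_derivative d) (at t)" and t: "t \<in> \<Omega>" and nz: "F t \<noteq> 0"
    and ln: "\<And>s. s \<in> \<Omega> \<Longrightarrow> ln (cmod (F s)) = c + (\<Sum>p\<in>S. u p * ln (cmod (s - p)))"
  shows "d = F t * log_form (\<lambda>p. of_real (u p)) t"
proof -
  have "((\<lambda>s. ln (cmod (F s))) has_derivative (\<lambda>h. Re (d * h / F t))) (at t)"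
    using F nz by (intro has_derivative_compose[OF _ has_derivative_ln_cmod])
      (simp_all add: has_field_derivative_def)
  moreover have "((\<lambda>s. ln (cmod (F s))) has_derivative (\<lambda>h. Re (log_form (\<lambda>p. of_real (u p)) t * h))) (at t)"
    by (rule has_derivative_transform_within_open[OF has_derivative_log_sum[OF t, of c u] open_\<Omega> t])
      (simp add: ln)
  ultimately have eq: "Re (d * h / F t) = Re (log_form (\<lambda>p. of_real (u p)) t * h)" for h
    using fun_cong[OF has_derivative_unique] by blast
  have "d / F t = log_form (\<lambda>p. of_real (u p)) t"
  proof -
    have "A = B" if "\<And>h. Re (A * h) = Re (B * h)" for A B :: complex
      using that[of 1] that[of \<i>] by (simp add: complex_eq_iff)
    moreover have "d * h / F t = d / F t * h" for h by simp
    ultimately show ?thesis using eq by (simp only:)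
  qed
  then show ?thesis using nz by (simp add: field_simps)
qed

lemma f_has_field_derivative:
  assumes i: "i \<in> I" and t: "t \<in> \<Omega>"
  shows "(f i has_field_derivative f i t * \<omega> i t) (at t)"
    and "f i t * \<omega> i t = - ((1 - f i t) * \<omega>' i t)"
proof -
  obtain d where d: "(f i has_field_derivative d) (at t)"
    using f_differentiable[OF i t] by (auto simp: field_differentiable_def)
  have 1: "d = f i t * \<omega> i t"
    using logarithmic_derivative_unique[OF d t, of "e i" "v i"] f_regular[OF i t] ln_f[OF i] by simp
  then show "(f i has_field_derivative f i t * \<omega> i t) (at t)" using d by simp
  have "((\<lambda>t. 1 - f i t) has_field_derivative - d) (at t)"
    using d by (auto intro!: derivative_eq_intros)
  from logarithmic_derivative_unique[OF this t, of "e' i" "v' i"] f_regular[OF i t] ln_1_minus_f[OF i]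
  have "- d = (1 - f i t) * \<omega>' i t" by auto
  then show "f i t * \<omega> i t = - ((1 - f i t) * \<omega>' i t)" using 1 by (metis minus_minus)
qed

lemma G_1: "i \<in> I \<Longrightarrow> t \<in> \<Omega> \<Longrightarrow> G 1 i t = - x' i t"
  using f_regular[of i t] ln_1_minus_f_eq_L'[of i t] by (subst sv_polylog_1) auto

lemma G_has_derivative:
  assumes n: "n \<ge> 2" and i: "i \<in> I" and t: "t \<in> \<Omega>"
  shows "(G n i has_derivative (\<lambda>h. polylog_form n (x i t) (\<lambda>m. G m i t) (\<omega> i t * h) (\<omega>' i t * h))) (at t)"
proof -
  have f: "f i t \<noteq> 0" "f i t \<noteq> 1" using f_regular[OF i t] by auto
  have "(G n i has_derivative (\<lambda>h. polylog_form n (ln (cmod (f i t))) (\<lambda>m. G m i t)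
      (f i t * \<omega> i t * h / f i t) (- (f i t * \<omega> i t * h) / (1 - f i t)))) (at t)"
    using f_has_field_derivative(1)[OF i t] unfolding has_field_derivative_def
    by (rule has_derivative_compose) (rule sv_polylog_has_derivative[OF n f])
  moreover have "- (f i t * \<omega> i t * h) / (1 - f i t) = \<omega>' i t * h" for h
    unfolding f_has_field_derivative(2)[OF i t] using f by simp
  moreover have "f i t * \<omega> i t * h / f i t = \<omega> i t * h" for h using f by simp
  ultimately show ?thesis using ln_f_eq_L[OF i t] by simp
qed

lemma x_has_derivative:
  assumes i: "i \<in> I" and t: "t \<in> \<Omega>"
  shows "(x i has_derivative (\<lambda>h. Re (\<omega> i t * h))) (at t)"
    and "(x' i has_derivative (\<lambda>h. Re (\<omega>' i t * h))) (at t)"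
proof -
  show "(x i has_derivative (\<lambda>h. Re (\<omega> i t * h))) (at t)"
    by (rule has_derivative_transform_within_open[OF has_derivative_log_sum[OF t, of "e i" "v i"] open_\<Omega> t])
      (simp add: ln_f_eq_L[OF i, symmetric] ln_f[OF i])
  show "(x' i has_derivative (\<lambda>h. Re (\<omega>' i t * h))) (at t)"
    by (rule has_derivative_transform_within_open[OF has_derivative_log_sum[OF t, of "e' i" "v' i"] open_\<Omega> t])
      (simp add: ln_1_minus_f_eq_L'[OF i, symmetric] ln_1_minus_f[OF i])
qed

lemma G_tendsto_0:
  assumes n: "n \<ge> 2" and i: "i \<in> I" and q: "q \<in> S" and v: "v i q \<noteq> 0"
  shows "(G n i \<longlongrightarrow> 0) (at q)"
proof -
  have F: "\<And>t. t \<in> \<Omega> \<Longrightarrow> ln (cmod (f i t)) = e i + (\<Sum>p\<in>S. v i p * ln (cmod (t - p)))"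
    and nz: "\<And>t. t \<in> \<Omega> \<Longrightarrow> f i t \<noteq> 0"
    using ln_f[OF i] f_regular[OF i] by auto
  consider "v i q > 0" | "v i q < 0" using v by linarith
  then show ?thesis
  proof cases
    case 1
    have "(f i \<longlongrightarrow> 0) (at q)" using filterlim_of_log_expansion(1)[OF q, of "f i" "e i" "v i"] F nz 1 by blast
    moreover have "\<forall>\<^sub>F t in at q. f i t \<noteq> 0" using eventually_in_\<Omega> by (rule eventually_mono) (rule nz)
    ultimately have "filterlim (f i) (at 0) (at q)" by (simp add: filterlim_at)
    then show ?thesis by (rule filterlim_compose[OF sv_polylog_tendsto_0])
  next
    case 2
    have "filterlim (f i) at_infinity (at q)" using filterlim_of_log_expansion(2)[OF q, of "f i" "e i" "v i"] F nz 2 by blast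
    then show ?thesis by (rule filterlim_compose[OF sv_polylog_tendsto_infinity[OF n]])
  qed
qed

text \<open>
  As t tends to p, every f i with v i p nonzero tends to 0 or to infinity, where the polylogarithm tends to 0; the other
  summands have weight 0. So the constant is 0.
\<close>

lemma contracted_constant_imp_zero:
  assumes n: "n \<ge> 2" and const: "(\<lambda>t. \<Sum>i\<in>I. w i * v i p * G n i t) constant_on \<Omega>" and t: "t \<in> \<Omega>"
  shows "(\<Sum>i\<in>I. w i * v i p * G n i t) = 0"
proof (cases "p \<in> S")
  case False
  then show ?thesis using v_outside(1) by (intro sum.neutral) auto
next
  case p: True
  obtain c where c: "\<And>t. t \<in> \<Omega> \<Longrightarrow> (\<Sum>i\<in>I. w i * v i p * G n i t) = c"
    using const by (auto simp: constant_on_def)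
  have "((\<lambda>t. w i * v i p * G n i t) \<longlongrightarrow> 0) (at p)" if "i \<in> I" for i
  proof (cases "v i p = 0")
    case False
    then have "((\<lambda>t. w i * v i p * G n i t) \<longlongrightarrow> w i * v i p * 0) (at p)"
      by (intro tendsto_intros G_tendsto_0 n that p)
    then show ?thesis by simp
  qed simp
  then have A: "((\<lambda>t. \<Sum>i\<in>I. w i * v i p * G n i t) \<longlongrightarrow> (\<Sum>i\<in>I. 0)) (at p)"
    by (intro tendsto_sum) auto
  have B: "((\<lambda>t. \<Sum>i\<in>I. w i * v i p * G n i t) \<longlongrightarrow> c) (at p)"
    by (rule tendsto_eventually, rule eventually_mono[OF eventually_in_\<Omega>]) (rule c)
  have "c = 0" using tendsto_unique[OF _ B A] by simp
  then show ?thesis using c[OF t] by simp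
qed

lemma Re_log_form: "Re (log_form (\<lambda>p. of_real (u p)) t * h) = (\<Sum>p\<in>S. u p * Re (h / (t - p)))"
  and Im_log_form: "Im (log_form (\<lambda>p. of_real (u p)) t * h) = (\<Sum>p\<in>S. u p * Im (h / (t - p)))"
proof -
  have "of_real (u p) / (t - p) * h = of_real (u p) * (h / (t - p))" for p by simp
  then have eq: "log_form (\<lambda>p. of_real (u p)) t * h = (\<Sum>p\<in>S. of_real (u p) * (h / (t - p)))"
    unfolding log_form_def sum_distrib_right by (simp only:)
  show "Re (log_form (\<lambda>p. of_real (u p)) t * h) = (\<Sum>p\<in>S. u p * Re (h / (t - p)))"
       "Im (log_form (\<lambda>p. of_real (u p)) t * h) = (\<Sum>p\<in>S. u p * Im (h / (t - p)))"
    unfolding eq by (simp_all only: Re_sum Im_sum times_complex.sel Re_complex_of_real Im_complex_of_real) simp_all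
qed

lemma sum_weighted_forms:
  "(\<Sum>i\<in>I. a i * (\<Sum>p\<in>S. u i p * r p)) = (\<Sum>p\<in>S. r p * (\<Sum>i\<in>I. a i * u i p))" for r :: "complex \<Rightarrow> real"
proof -
  have "(\<Sum>i\<in>I. a i * (\<Sum>p\<in>S. u i p * r p)) = (\<Sum>i\<in>I. \<Sum>p\<in>S. r p * (a i * u i p))"
    by (simp add: sum_distrib_left mult_ac)
  also have "\<dots> = (\<Sum>p\<in>S. r p * (\<Sum>i\<in>I. a i * u i p))"
    by (subst sum.swap) (simp add: sum_distrib_left)
  finally show ?thesis .
qed

lemma connected_\<Omega>: "connected \<Omega>"
proof -
  have "connected (UNIV - (- \<Omega>))"
    by (rule connected_open_diff_countable)
      (use finite_compl_\<Omega> in \<open>auto simp: countable_finite connected_UNIV\<close>)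
  then show ?thesis by (simp add: Diff_eq)
qed

text \<open>
  By induction over the weight the differential of the sum vanishes. In the summand with
  \<open>x ^ (k - 1)\<close> and the polylogarithm of weight n - k, the coefficient of
  dlog (t - p) is, with the powers of x frozen at t, a weighted sum of lower weight. Its weights again satisfy
  the closedness condition and contain the factor v i p, so it is constant by induction and then 0. The summand with
  \<open>x dlog (1 - f) - x' dlog f\<close> is exactly what \<open>symbol_1_form_vanishes\<close> treats.
\<close>

lemma integrable_symbol_imp_constant:
  assumes "integrable_symbol a w"
  shows "(\<lambda>t. \<Sum>i\<in>I. w i * G (a + 2) i t) constant_on \<Omega>"
  using assms
proof (induction a arbitrary: w rule: less_induct)
  case (less a)
  let ?n = "a + 2"
  have zero: "(\<Sum>i\<in>I. w i * polylog_form ?n (x i t) (\<lambda>m. G m i t) (\<omega> i t * h) (\<omega>' i t * h)) = 0"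
    if t: "t \<in> \<Omega>" for t h
  proof (cases a)
    case 0
    have form: "polylog_form ?n (x i t) (\<lambda>m. G m i t) (\<omega> i t * h) (\<omega>' i t * h)
        = x i t * Im (\<omega>' i t * h) - x' i t * Im (\<omega> i t * h)" if "i \<in> I" for i
      using G_1[OF that t] by (simp add: 0 polylog_form_def)
    have "(\<Sum>i\<in>I. w i * polylog_form ?n (x i t) (\<lambda>m. G m i t) (\<omega> i t * h) (\<omega>' i t * h))
        = (\<Sum>i\<in>I. (w i * x i t) * (\<Sum>p\<in>S. v' i p * Im (h / (t - p))))
          - (\<Sum>i\<in>I. (w i * x' i t) * (\<Sum>p\<in>S. v i p * Im (h / (t - p))))"
      unfolding sum_subtractf[symmetric]
      by (rule sum.cong[OF refl], simp only: form Im_log_form, simp only: right_diff_distrib mult.assoc)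
    also have "\<dots> = (\<Sum>p\<in>S. Im (h / (t - p)) * (\<Sum>i\<in>I. w i * (x i t * v' i p - x' i t * v i p)))"
      unfolding sum_weighted_forms by (simp add: sum_subtractf right_diff_distrib mult.assoc)
    also have "\<dots> = 0"
      using symbol_1_form_vanishes[OF less.prems, of "log_point t"] by (simp add: 0)
    finally show ?thesis .
  next
    case (Suc b)
    have T1: "(\<Sum>i\<in>I. (w i * G (?n - 1) i t) * (\<Sum>p\<in>S. v i p * Im (h / (t - p)))) = 0"
    proof -
      have "(\<Sum>i\<in>I. w i * v i p * G (b + 2) i t) = 0" for p
        using less.prems Suc
        by (intro contracted_constant_imp_zero[OF _ less.IH t]) (auto simp: integrable_symbol_contract)
      then show ?thesis unfolding sum_weighted_forms by (simp add: Suc mult_ac)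
    qed
    have T2: "(\<Sum>i\<in>I. (w i * x i t ^ (k - 1) * G (?n - k) i t) * (\<Sum>p\<in>S. v i p * Re (h / (t - p)))) = 0"
      if k: "k \<in> {2..<?n - 1}" for k
    proof -
      have "a = (k - 1) + Suc (a - k)" using k by auto
      with less.prems have "integrable_symbol (Suc (a - k)) (\<lambda>i. w i * x i t ^ (k - 1))"
        by (intro integrable_symbol_specialize) simp
      then have "integrable_symbol (a - k) (\<lambda>i. w i * x i t ^ (k - 1) * v i p)" for p
        by (simp add: integrable_symbol_contract)
      moreover have "a - k < a" using k by auto
      ultimately have "(\<Sum>i\<in>I. w i * x i t ^ (k - 1) * v i p * G (a - k + 2) i t) = 0" for p
        by (intro contracted_constant_imp_zero[OF _ less.IH t]) auto
      moreover have "a - k + 2 = ?n - k" using k by auto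
      ultimately show ?thesis unfolding sum_weighted_forms by (simp add: mult_ac)
    qed
    have T3: "(\<Sum>i\<in>I. (w i * x i t ^ a * x i t) * (\<Sum>p\<in>S. v' i p * Re (h / (t - p))))
        - (\<Sum>i\<in>I. (w i * x i t ^ a * x' i t) * (\<Sum>p\<in>S. v i p * Re (h / (t - p)))) = 0"
    proof -
      have "(\<Sum>i\<in>I. (w i * x i t ^ a * x i t) * (\<Sum>p\<in>S. v' i p * Re (h / (t - p))))
        - (\<Sum>i\<in>I. (w i * x i t ^ a * x' i t) * (\<Sum>p\<in>S. v i p * Re (h / (t - p))))
        = (\<Sum>p\<in>S. Re (h / (t - p)) * (\<Sum>i\<in>I. w i * x i t ^ a * (x i t * v' i p - x' i t * v i p)))"
        unfolding sum_weighted_forms by (simp add: sum_subtractf right_diff_distrib mult.assoc)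
      also have "\<dots> = 0"
        using symbol_1_form_vanishes[OF less.prems, of "log_point t"] by simp
      finally show ?thesis .
    qed
    have form: "polylog_form ?n (x i t) (\<lambda>m. G m i t) (\<omega> i t * h) (\<omega>' i t * h)
        = Re_Im_sign ?n * G (?n - 1) i t * Im (\<omega> i t * h)
          - (\<Sum>k = 2..<?n - 1. zagier_beta k * x i t ^ (k - 1) * G (?n - k) i t) * Re (\<omega> i t * h)
          - zagier_beta (?n - 1) * x i t ^ a * (x i t * Re (\<omega>' i t * h) - x' i t * Re (\<omega> i t * h))"
      if "i \<in> I" for i
      using G_1[OF that t] by (simp add: Suc polylog_form_def)
    have "(\<Sum>i\<in>I. w i * polylog_form ?n (x i t) (\<lambda>m. G m i t) (\<omega> i t * h) (\<omega>' i t * h))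
        = (\<Sum>i\<in>I. Re_Im_sign ?n * ((w i * G (?n - 1) i t) * (\<Sum>p\<in>S. v i p * Im (h / (t - p))))
           - (\<Sum>k = 2..<?n - 1. zagier_beta k * ((w i * x i t ^ (k - 1) * G (?n - k) i t) * (\<Sum>p\<in>S. v i p * Re (h / (t - p)))))
           - zagier_beta (?n - 1) * ((w i * x i t ^ a * x i t) * (\<Sum>p\<in>S. v' i p * Re (h / (t - p)))
               - (w i * x i t ^ a * x' i t) * (\<Sum>p\<in>S. v i p * Re (h / (t - p)))))"
      by (rule sum.cong[OF refl], simp only: form Im_log_form[symmetric] Re_log_form[symmetric])
        (simp only: sum_distrib_left sum_distrib_right right_diff_distrib mult_ac)
    also have "\<dots> = Re_Im_sign ?n * (\<Sum>i\<in>I. (w i * G (?n - 1) i t) * (\<Sum>p\<in>S. v i p * Im (h / (t - p))))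
        - (\<Sum>k = 2..<?n - 1. zagier_beta k * (\<Sum>i\<in>I. (w i * x i t ^ (k - 1) * G (?n - k) i t) * (\<Sum>p\<in>S. v i p * Re (h / (t - p)))))
        - zagier_beta (?n - 1) * ((\<Sum>i\<in>I. (w i * x i t ^ a * x i t) * (\<Sum>p\<in>S. v' i p * Re (h / (t - p))))
               - (\<Sum>i\<in>I. (w i * x i t ^ a * x' i t) * (\<Sum>p\<in>S. v i p * Re (h / (t - p)))))"
    proof -
      have "(\<Sum>i\<in>I. \<Sum>k = 2..<?n - 1. g i k) = (\<Sum>k = 2..<?n - 1. \<Sum>i\<in>I. g i k)" for g :: "'i \<Rightarrow> nat \<Rightarrow> real"
        by (rule sum.swap)
      then show ?thesis by (simp only: sum_subtractf sum_distrib_left right_diff_distrib)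
    qed
    also have "\<dots> = 0"
    proof -
      have "(\<Sum>k = 2..<?n - 1. zagier_beta k * (\<Sum>i\<in>I. (w i * x i t ^ (k - 1) * G (?n - k) i t) * (\<Sum>p\<in>S. v i p * Re (h / (t - p))))) = 0"
        by (rule sum.neutral) (use T2 in simp)
      then show ?thesis unfolding T1 T3 by simp
    qed
    finally show ?thesis .
  qed
  have "((\<lambda>t. \<Sum>i\<in>I. w i * G ?n i t) has_derivative (\<lambda>h. 0)) (at t)" if t: "t \<in> \<Omega>" for t
  proof -
    have "((\<lambda>t. \<Sum>i\<in>I. w i * G ?n i t) has_derivative
        (\<lambda>h. \<Sum>i\<in>I. w i * polylog_form ?n (x i t) (\<lambda>m. G m i t) (\<omega> i t * h) (\<omega>' i t * h))) (at t)"
      by (intro has_derivative_sum has_derivative_mult_right G_has_derivative t) auto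
    then show ?thesis by (simp only: zero[OF t])
  qed
  then show ?case
    by (intro has_derivative_zero_connected_constant_on[of _ "{}"] connected_\<Omega> open_\<Omega>
        continuous_at_imp_continuous_on)
      (auto intro: has_derivative_at_withinI has_derivative_continuous)
qed

section \<open>Constant sums have closed symbols\<close>

text \<open>
  The derivative of the polylogarithm of f as a list of pairs of residues and functions. The same list can be paired with the
  logarithmic forms at t, which yields the derivative, or with the residues at p alone.
\<close>

definition deriv_terms :: "nat \<Rightarrow> 'i \<Rightarrow> ((complex \<Rightarrow> complex) \<times> (complex \<Rightarrow> complex)) list" where
  "deriv_terms n i = (let V = \<lambda>a p. a * of_real (v i p); V' = \<lambda>a p. a * of_real (v' i p);
       X = \<lambda>t. complex_of_real (x i t); M = \<lambda>m t. complex_of_real (G m i t) in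
     if n = 2 then [(V' (- \<i> / 2), X), (V (- \<i> / 2), M 1)]
     else (V (- \<i> * of_real (Re_Im_sign n) / 2), M (n - 1))
        # map (\<lambda>k. (V (- of_real (zagier_beta k) / 2), \<lambda>t. X t ^ (k - 1) * M (n - k) t)) [2..<n - 1]
        @ [(V' (- of_real (zagier_beta (n - 1)) / 2), \<lambda>t. X t ^ (n - 2) * X t),
           (V (- of_real (zagier_beta (n - 1)) / 2), \<lambda>t. X t ^ (n - 2) * M 1 t)])"

text \<open>
  The pairing \<open>\<phi>\<close> only needs to be homogeneous; it is used for both pairings just mentioned.
\<close>

lemma deriv_terms_sum:
  assumes hom: "\<And>a u. \<phi> (\<lambda>p. a * u p) = a * \<phi> u"
  shows "(\<Sum>(c, g)\<leftarrow>deriv_terms n i. \<phi> c * g t)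
    = polylog_coeff n (x i t) (\<lambda>m. G m i t) (\<phi> (\<lambda>p. of_real (v i p))) (\<phi> (\<lambda>p. of_real (v' i p))) / 2"
proof -
  let ?A = "\<phi> (\<lambda>p. of_real (v i p))" and ?B = "\<phi> (\<lambda>p. of_real (v' i p))"
  let ?X = "complex_of_real (x i t)" and ?M = "\<lambda>m. complex_of_real (G m i t)"
  let ?b = "\<lambda>k. complex_of_real (zagier_beta k)"
  show ?thesis
  proof (cases "n = 2")
    case True
    have "(\<Sum>(c, g)\<leftarrow>deriv_terms n i. \<phi> c * g t) = (- \<i> / 2 * ?B) * ?X + ((- \<i> / 2 * ?A) * ?M 1 + 0)"
      by (simp only: deriv_terms_def Let_def if_P[OF True] list.map sum_list.Cons sum_list.Nil prod.case hom)
    also have "\<dots> = polylog_coeff n (x i t) (\<lambda>m. G m i t) ?A ?B / 2"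
      using True by (simp add: polylog_coeff_def field_simps)
    finally show ?thesis .
  next
    case False
    have "(\<Sum>(c, g)\<leftarrow>deriv_terms n i. \<phi> c * g t)
        = (- \<i> * of_real (Re_Im_sign n) / 2 * ?A) * ?M (n - 1)
          + ((\<Sum>k\<leftarrow>[2..<n - 1]. (- ?b k / 2 * ?A) * (?X ^ (k - 1) * ?M (n - k)))
             + ((- ?b (n - 1) / 2 * ?B) * (?X ^ (n - 2) * ?X) + ((- ?b (n - 1) / 2 * ?A) * (?X ^ (n - 2) * ?M 1) + 0)))"
      by (simp only: deriv_terms_def Let_def if_not_P[OF False] append_Cons append_Nil list.map map_append map_map comp_def
          sum_list.Cons sum_list.Nil sum_list_append prod.case hom)
    also have "(\<Sum>k\<leftarrow>[2..<n - 1]. (- ?b k / 2 * ?A) * (?X ^ (k - 1) * ?M (n - k)))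
        = - (\<Sum>k = 2..<n - 1. of_real (zagier_beta k * x i t ^ (k - 1) * G (n - k) i t)) * ?A / 2"
    proof -
      have "(\<Sum>k\<leftarrow>[2..<n - 1]. (- ?b k / 2 * ?A) * (?X ^ (k - 1) * ?M (n - k)))
          = (\<Sum>k = 2..<n - 1. (- ?b k / 2 * ?A) * (?X ^ (k - 1) * ?M (n - k)))"
        by (simp add: interv_sum_list_conv_sum_set_nat del: upt_Suc)
      also have "\<dots> = - (\<Sum>k = 2..<n - 1. of_real (zagier_beta k * x i t ^ (k - 1) * G (n - k) i t)) * ?A / 2"
        unfolding sum_negf[symmetric] sum_distrib_right sum_divide_distrib by (rule sum.cong) simp_all
      finally show ?thesis .
    qed
    finally have "(\<Sum>(c, g)\<leftarrow>deriv_terms n i. \<phi> c * g t)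
        = (- \<i> * of_real (Re_Im_sign n) / 2 * ?A) * ?M (n - 1)
          + (- (\<Sum>k = 2..<n - 1. of_real (zagier_beta k * x i t ^ (k - 1) * G (n - k) i t)) * ?A / 2
             + ((- ?b (n - 1) / 2 * ?B) * (?X ^ (n - 2) * ?X) + ((- ?b (n - 1) / 2 * ?A) * (?X ^ (n - 2) * ?M 1) + 0)))" .
    also have "\<dots> = polylog_coeff n (x i t) (\<lambda>m. G m i t) ?A ?B / 2"
    proof -
      have "(- \<i> * s / 2 * A) * m + (- T * A / 2 + ((- b / 2 * B) * (Xn * X) + ((- b / 2 * A) * (Xn * M1) + 0)))
          = (- \<i> * (s * m) * A - T * A - (b * Xn) * (X * B + M1 * A)) / 2" for s m A B T b Xn X M1 :: complex
        by (simp add: field_simps)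
      then show ?thesis
        unfolding polylog_coeff_def if_not_P[OF False] of_real_mult of_real_power .
    qed
    finally show ?thesis .
  qed
qed

lemma G_has_wirtinger:
  assumes "n \<ge> 2" "i \<in> I" "t \<in> \<Omega>"
  shows "has_wirtinger (\<lambda>t. of_real (G n i t)) (\<Sum>(c, g)\<leftarrow>deriv_terms n i. log_form c t * g t) t"
  unfolding deriv_terms_sum[of "\<lambda>c. log_form c t", OF log_form_scale]
  using G_has_derivative[OF assms] unfolding polylog_form_eq_Re by (rule has_wirtinger_Re)

lemma x_has_wirtinger:
  assumes "i \<in> I" "t \<in> \<Omega>"
  shows "has_wirtinger (\<lambda>t. of_real (x i t)) (\<omega> i t / 2) t"
    and "has_wirtinger (\<lambda>t. of_real (x' i t)) (\<omega>' i t / 2) t"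
  using x_has_derivative[OF assms] by (auto intro: has_wirtinger_Re)

lemma unipotent_x: "i \<in> I \<Longrightarrow> unipotent (\<lambda>t. of_real (x i t))"
proof (rule unipotentI[of "[(\<lambda>p. 1 / 2 * of_real (v i p), \<lambda>_. 1)]"])
  fix t assume "i \<in> I" "t \<in> \<Omega>"
  moreover have "(\<Sum>(c, g)\<leftarrow>[(\<lambda>p. 1 / 2 * of_real (v i p), \<lambda>_. 1)]. log_form c t * g t) = \<omega> i t / 2"
    using log_form_scale[of "1 / 2" "\<lambda>p. of_real (v i p)" t] by simp
  ultimately show "has_wirtinger (\<lambda>t. of_real (x i t))
      (\<Sum>(c, g)\<leftarrow>[(\<lambda>p. 1 / 2 * of_real (v i p), \<lambda>_. 1)]. log_form c t * g t) t"
    using x_has_wirtinger(1)[of i t] by (simp only:)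
qed (auto intro: unipotent_const)

lemma unipotent_G:
  assumes i: "i \<in> I" and "n \<ge> 1"
  shows "unipotent (\<lambda>t. of_real (G n i t))"
  using assms(2)
proof (induction n rule: less_induct)
  case (less n)
  show ?case
  proof (cases "n = 1")
    case True
    show ?thesis
    proof (rule unipotentI[of "[(\<lambda>p. - 1 / 2 * of_real (v' i p), \<lambda>_. 1)]"])
      fix t assume t: "t \<in> \<Omega>"
      have "has_wirtinger (\<lambda>t. (-1) * of_real (x' i t)) (0 * of_real (x' i t) + (-1) * (\<omega>' i t / 2)) t"
        by (intro has_wirtinger_mult has_wirtinger_const x_has_wirtinger i t)
      then have "has_wirtinger (\<lambda>t. of_real (G 1 i t)) (0 * of_real (x' i t) + (-1) * (\<omega>' i t / 2)) t"
        by (rule has_wirtinger_transform)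
          (use eventually_nhds_\<Omega>[OF t] G_1[OF i] in \<open>auto elim!: eventually_mono\<close>)
      then show "has_wirtinger (\<lambda>t. of_real (G n i t))
          (\<Sum>(c, g)\<leftarrow>[(\<lambda>p. - 1 / 2 * of_real (v' i p), \<lambda>_. 1)]. log_form c t * g t) t"
        using True log_form_scale[of "- 1 / 2" "\<lambda>p. of_real (v' i p)" t] by simp
    qed (auto intro: unipotent_const)
  next
    case False
    then have n: "n \<ge> 2" using less.prems by simp
    show ?thesis
    proof (rule unipotentI[of "deriv_terms n i"])
      fix c g assume "(c, g) \<in> set (deriv_terms n i)"
      then show "unipotent g"
        using n less.IH unipotent_x[OF i]
        by (auto simp: deriv_terms_def Let_def split: if_splits
            intro!: unipotent_mult unipotent_power)
    qed (rule G_has_wirtinger[OF n i])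
  qed
qed

text \<open>
  The derivative of a constant is 0, and by \<open>log_form_relation_trivial\<close> a vanishing combination of unipotent functions with logarithmic
  coefficients vanishes already residue by residue. So in the derivative the forms dlog f and
  dlog (1 - f) may be replaced by the orders of f and 1 - f at p.
\<close>

lemma constant_sum_log_forms_vanish:
  assumes n: "n \<ge> 2" and const: "(\<lambda>t. \<Sum>i\<in>I. w i * G n i t) constant_on \<Omega>"
    and p: "p \<in> S" and t: "t \<in> \<Omega>"
  shows "(\<Sum>i\<in>I. of_real (w i) *
     polylog_coeff n (x i t) (\<lambda>m. G m i t) (of_real (v i p)) (of_real (v' i p))) = 0"
proof -
  obtain js where js: "set js = I" "distinct js"
    using finite_distinct_list[OF finite_I] by blast
  define l where "l = concat (map (\<lambda>i. map (\<lambda>(c, g). (\<lambda>p. of_real (w i) * c p, g)) (deriv_terms n i)) js)"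
  have l_sum: "(\<Sum>(c, g)\<leftarrow>l. \<phi> c * g t)
     = (\<Sum>i\<in>I. of_real (w i) * (\<Sum>(c, g)\<leftarrow>deriv_terms n i. \<phi> c * g t))"
    if hom: "\<And>a u. \<phi> (\<lambda>p. a * u p) = a * \<phi> u" for \<phi> t
  proof -
    have 1: "(\<Sum>(c, g)\<leftarrow>map (\<lambda>(c, g). (\<lambda>p. a * c p, g)) l'. \<phi> c * g t) = a * (\<Sum>(c, g)\<leftarrow>l'. \<phi> c * g t)" for a l'
      by (induction l') (auto simp: hom algebra_simps)
    have 2: "sum_list (map h (concat (map k js))) = (\<Sum>j\<leftarrow>js. sum_list (map h (k j)))"
      for h :: "_ \<Rightarrow> complex" and k and js :: "'i list"
      by (induction js) auto
    have "(\<Sum>(c, g)\<leftarrow>l. \<phi> c * g t) = (\<Sum>i\<leftarrow>js. of_real (w i) * (\<Sum>(c, g)\<leftarrow>deriv_terms n i. \<phi> c * g t))"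
      unfolding l_def 2 1 ..
    also have "\<dots> = (\<Sum>i\<in>I. of_real (w i) * (\<Sum>(c, g)\<leftarrow>deriv_terms n i. \<phi> c * g t))"
      using js by (simp add: sum_list_distinct_conv_sum_set)
    finally show ?thesis .
  qed
  have "(\<Sum>(c, g)\<leftarrow>l. c p * g t) = 0"
  proof (rule log_form_relation_trivial[OF _ _ p t])
    fix c g assume "(c, g) \<in> set l"
    then obtain i c' where i: "i \<in> I" "(c', g) \<in> set (deriv_terms n i)"
      using js by (auto simp: l_def)
    then show "unipotent g"
      using n unipotent_G[OF i(1)] unipotent_x[OF i(1)]
      by (auto simp: deriv_terms_def Let_def split: if_splits intro!: unipotent_mult unipotent_power)
  next
    fix t assume t: "t \<in> \<Omega>"
    obtain k where k: "\<And>t. t \<in> \<Omega> \<Longrightarrow> (\<Sum>i\<in>I. w i * G n i t) = k"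
      using const by (auto simp: constant_on_def)
    have "has_wirtinger (\<lambda>t. \<Sum>i\<in>I. of_real (w i) * of_real (G n i t))
       (\<Sum>i\<in>I. 0 * of_real (G n i t) + of_real (w i) * (\<Sum>(c, g)\<leftarrow>deriv_terms n i. log_form c t * g t)) t"
      by (intro has_wirtinger_sum has_wirtinger_mult has_wirtinger_const G_has_wirtinger n t)
    then have "has_wirtinger (\<lambda>t. of_real k)
       (\<Sum>i\<in>I. 0 * of_real (G n i t) + of_real (w i) * (\<Sum>(c, g)\<leftarrow>deriv_terms n i. log_form c t * g t)) t"
    proof (rule has_wirtinger_transform)
      show "\<forall>\<^sub>F t in nhds t. (\<Sum>i\<in>I. of_real (w i) * of_real (G n i t)) = complex_of_real k"
        using eventually_nhds_\<Omega>[OF t]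
      proof (rule eventually_mono)
        fix t assume "t \<in> \<Omega>"
        from k[OF this] have "complex_of_real (\<Sum>i\<in>I. w i * G n i t) = of_real k" by (rule arg_cong)
        then show "(\<Sum>i\<in>I. of_real (w i) * of_real (G n i t)) = complex_of_real k" by simp
      qed
    qed
    from has_wirtinger_unique[OF this has_wirtinger_const]
    show "(\<Sum>(c, g)\<leftarrow>l. log_form c t * g t) = 0"
      by (simp add: l_sum[of "\<lambda>c. log_form c t", OF log_form_scale])
  qed
  then show ?thesis
    unfolding l_sum[of "\<lambda>c. c p", OF refl] deriv_terms_sum[of "\<lambda>c. c p", OF refl]
    by (simp add: sum_divide_distrib[symmetric])
qed

lemma log_sum_constant_imp_zero:
  assumes const: "(\<lambda>t. \<Sum>i\<in>I. a i * x i t + b i * x' i t) constant_on \<Omega>"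
  shows "(\<Sum>i\<in>I. a i * v i q + b i * v' i q) = 0"
proof (cases "q \<in> S")
  case False
  then show ?thesis using v_outside by (intro sum.neutral) auto
next
  case q: True
  have "infinite \<Omega>"
  proof
    assume "finite \<Omega>"
    then have "finite (\<Omega> \<union> - \<Omega>)" using finite_compl_\<Omega> by (rule finite_UnI)
    then show False using infinite_UNIV_char_0[where 'a = complex] by simp
  qed
  then have "\<Omega> \<noteq> {}" by auto
  then obtain t0 where t0: "t0 \<in> \<Omega>" by blast
  obtain k where k: "\<And>t. t \<in> \<Omega> \<Longrightarrow> (\<Sum>i\<in>I. a i * x i t + b i * x' i t) = k"
    using const by (auto simp: constant_on_def)
  define c where "c p = (\<Sum>i\<in>I. of_real (a i) / 2 * of_real (v i p) + of_real (b i) / 2 * complex_of_real (v' i p))" for p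
  have "(\<Sum>(c, g)\<leftarrow>[(c, \<lambda>_. 1)]. c q * g t0) = 0"
  proof (rule log_form_relation_trivial[OF _ _ q t0])
    fix t assume t: "t \<in> \<Omega>"
    have "has_wirtinger (\<lambda>t. \<Sum>i\<in>I. of_real (a i) * of_real (x i t) + of_real (b i) * of_real (x' i t))
        (\<Sum>i\<in>I. (0 * of_real (x i t) + of_real (a i) * (\<omega> i t / 2)) + (0 * of_real (x' i t) + of_real (b i) * (\<omega>' i t / 2))) t"
      by (intro has_wirtinger_sum has_wirtinger_mult has_wirtinger_add has_wirtinger_const x_has_wirtinger t)
    then have "has_wirtinger (\<lambda>t. of_real k)
        (\<Sum>i\<in>I. (0 * of_real (x i t) + of_real (a i) * (\<omega> i t / 2)) + (0 * of_real (x' i t) + of_real (b i) * (\<omega>' i t / 2))) t"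
    proof (rule has_wirtinger_transform)
      show "\<forall>\<^sub>F t in nhds t. (\<Sum>i\<in>I. of_real (a i) * of_real (x i t) + of_real (b i) * of_real (x' i t)) = complex_of_real k"
        using eventually_nhds_\<Omega>[OF t]
      proof (rule eventually_mono)
        fix t assume "t \<in> \<Omega>"
        from k[OF this] have "complex_of_real (\<Sum>i\<in>I. a i * x i t + b i * x' i t) = of_real k" by (rule arg_cong)
        then show "(\<Sum>i\<in>I. of_real (a i) * of_real (x i t) + of_real (b i) * of_real (x' i t)) = complex_of_real k" by simp
      qed
    qed
    from has_wirtinger_unique[OF this has_wirtinger_const]
    have "(\<Sum>i\<in>I. of_real (a i) / 2 * \<omega> i t + of_real (b i) / 2 * \<omega>' i t) = 0"
      by simp
    also have "(\<Sum>i\<in>I. of_real (a i) / 2 * \<omega> i t + of_real (b i) / 2 * \<omega>' i t)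
        = (\<Sum>i\<in>I. \<Sum>p\<in>S. (of_real (a i) / 2 * of_real (v i p) + of_real (b i) / 2 * of_real (v' i p)) / (t - p))"
      by (simp add: log_form_def sum_distrib_left sum.distrib add_divide_distrib)
    also have "\<dots> = log_form c t"
      unfolding log_form_def c_def sum_divide_distrib by (rule sum.swap)
    finally show "(\<Sum>(c, g)\<leftarrow>[(c, \<lambda>_. 1)]. log_form c t * g t) = 0" by simp
  qed (auto intro: unipotent_const)
  then have "c q = 0" by simp
  moreover have "c q = of_real ((\<Sum>i\<in>I. a i * v i q + b i * v' i q) / 2)"
    by (simp add: c_def sum_divide_distrib add_divide_distrib)
  ultimately show ?thesis by (simp only: of_real_eq_0_iff)
qed

text \<open>
  In weight at least 3 the imaginary part of the relation at p isolates the sum of the polylogarithms of the next lower weight with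
  coefficients multiplied by v i p; it vanishes, hence is constant, and induction applies. In weight 2 the relation at
  p is a linear combination of the logarithms \<open>x\<close> and \<open>x'\<close> that vanishes, and its
  residues at q are the required coefficients.
\<close>

lemma constant_imp_integrable_symbol:
  assumes "(\<lambda>t. \<Sum>i\<in>I. w i * G (a + 2) i t) constant_on \<Omega>"
  shows "integrable_symbol a w"
  using assms
proof (induction a arbitrary: w)
  case 0
  have E: "(\<Sum>i\<in>I. w i * (x i t * v' i p - x' i t * v i p)) = 0" if p: "p \<in> S" and t: "t \<in> \<Omega>" for p t
  proof -
    have "(\<Sum>i\<in>I. of_real (w i) * polylog_coeff 2 (x i t) (\<lambda>m. G m i t) (of_real (v i p)) (of_real (v' i p))) = 0"
      using 0 p t by (intro constant_sum_log_forms_vanish) (simp_all only: add_0)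
    moreover have "of_real (w i) * polylog_coeff 2 (x i t) (\<lambda>m. G m i t) (of_real (v i p)) (of_real (v' i p))
        = - \<i> * of_real (w i * (x i t * v' i p - x' i t * v i p))" if "i \<in> I" for i
      using G_1[OF that t] by (simp add: polylog_coeff_def algebra_simps)
    ultimately have "- \<i> * of_real (\<Sum>i\<in>I. w i * (x i t * v' i p - x' i t * v i p)) = 0"
      by (simp add: sum_distrib_left)
    then show ?thesis by (simp only: mult_eq_0_iff of_real_eq_0_iff) simp
  qed
  have "(\<Sum>i\<in>I. w i * (v i q * v' i p - v i p * v' i q)) = 0" for p q
  proof (cases "p \<in> S")
    case False
    then show ?thesis using v_outside by (intro sum.neutral) auto
  next
    case True
    have "(\<lambda>t. \<Sum>i\<in>I. w i * v' i p * x i t + (- w i * v i p) * x' i t) constant_on \<Omega>"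
      unfolding constant_on_def using E[OF True] by (auto simp: algebra_simps intro!: exI[of _ 0])
    from log_sum_constant_imp_zero[OF this, of q] show ?thesis by (simp add: algebra_simps)
  qed
  then show ?case by (simp add: integrable_symbol_def)
next
  case (Suc a)
  have "(\<Sum>i\<in>I. w i * v i p * G (a + 2) i t) = 0" if t: "t \<in> \<Omega>" for p t
  proof (cases "p \<in> S")
    case False
    then show ?thesis using v_outside(1) by (intro sum.neutral) auto
  next
    case p: True
    let ?c = "\<lambda>i. polylog_coeff (Suc a + 2) (x i t) (\<lambda>m. G m i t) (of_real (v i p)) (of_real (v' i p))"
    have "(\<Sum>i\<in>I. of_real (w i) * ?c i) = 0"
      using constant_sum_log_forms_vanish[OF _ Suc.prems p t] by simp
    then have "Im (\<Sum>i\<in>I. of_real (w i) * ?c i) = 0" by simp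
    moreover have "Im (of_real (w i) * ?c i) = - Re_Im_sign (Suc a + 2) * (w i * v i p * G (a + 2) i t)" for i
      by (simp add: polylog_coeff_def Im_sum algebra_simps)
    ultimately have "- Re_Im_sign (Suc a + 2) * (\<Sum>i\<in>I. w i * v i p * G (a + 2) i t) = 0"
      by (simp only: Im_sum sum_distrib_left)
    then show ?thesis by (simp add: Re_Im_sign_def split: if_splits)
  qed
  then have "(\<lambda>t. \<Sum>i\<in>I. w i * v i p * G (a + 2) i t) constant_on \<Omega>" for p
    unfolding constant_on_def by blast
  then have "integrable_symbol a (\<lambda>i. w i * v i p)" for p by (rule Suc.IH)
  then show ?case by (simp add: integrable_symbol_contract)
qed

end

section \<open>Families of rational functions\<close>

lemma ln_cmod_poly:
  fixes f :: "complex poly"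
  assumes "f \<noteq> 0" "poly f t \<noteq> 0" "finite S" "{p. poly f p = 0} \<subseteq> S"
  shows "ln (cmod (poly f t)) = ln (cmod (lead_coeff f)) + (\<Sum>p\<in>S. real (Polynomial.order p f) * ln (cmod (t - p)))"
proof -
  let ?Z = "{p. poly f p = 0}"
  have pos: "cmod (t - z) > 0" if "z \<in> ?Z" for z using that assms(2) by auto
  have "poly f t = poly (smult (lead_coeff f) (\<Prod>z\<in>?Z. [:-z, 1:] ^ Polynomial.order z f)) t"
    by (simp add: complex_poly_decompose)
  also have "\<dots> = lead_coeff f * (\<Prod>z\<in>?Z. (t - z) ^ Polynomial.order z f)"
    by (simp add: poly_prod)
  finally have "cmod (poly f t) = cmod (lead_coeff f) * (\<Prod>z\<in>?Z. cmod (t - z) ^ Polynomial.order z f)"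
    by (simp add: norm_mult norm_power flip: prod_norm)
  then have "ln (cmod (poly f t)) = ln (cmod (lead_coeff f) * (\<Prod>z\<in>?Z. cmod (t - z) ^ Polynomial.order z f))"
    by simp
  also have "\<dots> = ln (cmod (lead_coeff f)) + ln (\<Prod>z\<in>?Z. cmod (t - z) ^ Polynomial.order z f)"
    using assms(1) pos by (intro ln_mult_pos prod_pos) auto
  also have "ln (\<Prod>z\<in>?Z. cmod (t - z) ^ Polynomial.order z f) = (\<Sum>z\<in>?Z. ln (cmod (t - z) ^ Polynomial.order z f))"
    using assms(1) pos by (intro ln_prod) (auto simp: poly_roots_finite)
  also have "\<dots> = (\<Sum>z\<in>?Z. real (Polynomial.order z f) * ln (cmod (t - z)))"
    using pos by (intro sum.cong) (auto simp: ln_realpow)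
  also have "\<dots> = (\<Sum>p\<in>S. real (Polynomial.order p f) * ln (cmod (t - p)))"
    using assms by (intro sum.mono_neutral_left) (auto simp: order_0I)
  finally show ?thesis .
qed

lemma lookup_poly_divisor:
  assumes "f \<noteq> 0"
  shows "Poly_Mapping.lookup (poly_divisor f) p = of_nat (Polynomial.order p f)"
proof -
  have "Poly_Mapping.lookup (poly_divisor f) p = (\<Sum>q | poly f q = 0. if q = p then of_nat (Polynomial.order p f) else 0)"
    unfolding poly_divisor_def lookup_sum by (intro sum.cong) (auto simp: lookup_single)
  then show ?thesis using poly_roots_finite[OF assms] by (auto simp: order_0I)
qed

lemma ratfun_denom_nz: "ratfun_denom \<phi> \<noteq> 0"
  by (simp add: ratfun_denom_def)

lemma ratfun_num_nz: "\<phi> \<noteq> 0 \<Longrightarrow> ratfun_num \<phi> \<noteq> 0"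
  by (simp add: ratfun_num_def)

lemma lookup_ratfun_divisor:
  "\<phi> \<noteq> 0 \<Longrightarrow> Poly_Mapping.lookup (ratfun_divisor \<phi>) p
     = of_nat (Polynomial.order p (ratfun_num \<phi>)) - of_nat (Polynomial.order p (ratfun_denom \<phi>))"
  by (simp add: ratfun_divisor_def lookup_minus lookup_poly_divisor ratfun_num_nz ratfun_denom_nz)

lemma ratfun_one_minus:
  "ratfun_num (1 - \<phi>) = ratfun_denom \<phi> - ratfun_num \<phi>" "ratfun_denom (1 - \<phi>) = ratfun_denom \<phi>"
proof -
  let ?a = "ratfun_num \<phi>" and ?b = "ratfun_denom \<phi>"
  have "coprime ?a ?b" unfolding ratfun_num_def ratfun_denom_def by (rule coprime_quot_of_fract)
  then have "coprime (?b - ?a) ?b"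
    using gcd_diff2[of ?b ?a] by (simp add: coprime_iff_gcd_eq_1)
  then have "(?b - ?a, ?b) \<in> normalized_fracts"
    by (simp add: normalized_fracts_def ratfun_denom_def unit_factor_snd_quot_of_fract)
  from quot_of_fract_quot_to_fract'[OF this] 
  have "quot_of_fract (Fract (?b - ?a) ?b) = (?b - ?a, ?b)"
    by (simp add: quot_to_fract_def ratfun_denom_nz)
  moreover have "Fract (?b - ?a) ?b = 1 - \<phi>"
  proof -
    have "1 - \<phi> = Fract 1 1 - Fract ?a ?b"
      by (simp add: One_fract_def ratfun_num_def ratfun_denom_def)
    then show ?thesis by (simp add: ratfun_denom_nz)
  qed
  ultimately have "quot_of_fract (1 - \<phi>) = (?b - ?a, ?b)" by simp
  then show "ratfun_num (1 - \<phi>) = ?b - ?a" "ratfun_denom (1 - \<phi>) = ?b"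
    by (simp_all add: ratfun_num_def[of "1 - \<phi>"] ratfun_denom_def[of "1 - \<phi>"])
qed

definition ratfun_ord :: "ratfun \<Rightarrow> complex \<Rightarrow> real" where
  "ratfun_ord \<phi> p = of_rat (Poly_Mapping.lookup (ratfun_divisor \<phi>) p)"

definition ratfun_log_lead :: "ratfun \<Rightarrow> real" where
  "ratfun_log_lead \<phi> = ln (cmod (lead_coeff (ratfun_num \<phi>))) - ln (cmod (lead_coeff (ratfun_denom \<phi>)))"

lemma ln_cmod_ratfun_eval:
  assumes "\<phi> \<noteq> 0" "finite S" "{p. poly (ratfun_num \<phi>) p = 0} \<subseteq> S" "{p. poly (ratfun_denom \<phi>) p = 0} \<subseteq> S" "t \<notin> S"
  shows "ln (cmod (ratfun_eval \<phi> t)) = ratfun_log_lead \<phi> + (\<Sum>p\<in>S. ratfun_ord \<phi> p * ln (cmod (t - p)))"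
proof -
  have nz: "poly (ratfun_num \<phi>) t \<noteq> 0" "poly (ratfun_denom \<phi>) t \<noteq> 0" using assms by auto
  then have "ln (cmod (ratfun_eval \<phi> t)) = ln (cmod (poly (ratfun_num \<phi>) t)) - ln (cmod (poly (ratfun_denom \<phi>) t))"
    by (simp add: ratfun_eval_def norm_divide ln_div)
  also have "\<dots> = ratfun_log_lead \<phi> + (\<Sum>p\<in>S. (real (Polynomial.order p (ratfun_num \<phi>))
      - real (Polynomial.order p (ratfun_denom \<phi>))) * ln (cmod (t - p)))"
    using assms nz by (simp add: ln_cmod_poly[OF _ _ assms(2)] ratfun_num_nz ratfun_denom_nz
        ratfun_log_lead_def left_diff_distrib sum_subtractf)
  finally show ?thesis
    using assms(1) by (simp add: ratfun_ord_def lookup_ratfun_divisor of_rat_diff)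
qed

text \<open>
  The zeros and poles of all \<open>\<phi>\<close> and \<open>1 - \<phi>\<close>; the poles of the two coincide.
\<close>

definition special_points :: "ratfun set \<Rightarrow> complex set" where
  "special_points \<Phi> = (\<Union>\<phi>\<in>\<Phi>. {p. poly (ratfun_num \<phi>) p = 0} \<union> {p. poly (ratfun_denom \<phi>) p = 0}
      \<union> {p. poly (ratfun_num (1 - \<phi>)) p = 0})"

lemma regular_points_eq: "regular_points \<Phi> = - special_points \<Phi>"
  by (auto simp: regular_points_def special_points_def ratfun_pole_def ratfun_eval_def ratfun_one_minus) metis

lemma log_family_ratfun:
  assumes fin: "finite \<Phi>" and \<Phi>: "0 \<notin> \<Phi>" "1 \<notin> \<Phi>"
  shows "log_family (special_points \<Phi>) (regular_points \<Phi>) \<Phi> ratfun_eval ratfun_ord (\<lambda>\<phi>. ratfun_ord (1 - \<phi>))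
    ratfun_log_lead (\<lambda>\<phi>. ratfun_log_lead (1 - \<phi>))"
proof -
  let ?S = "special_points \<Phi>"
  have nz: "\<phi> \<noteq> 0" "1 - \<phi> \<noteq> 0" if "\<phi> \<in> \<Phi>" for \<phi> using that \<Phi> by auto
  have finS: "finite ?S"
    unfolding special_points_def using fin nz
    by (auto intro!: poly_roots_finite simp: ratfun_num_nz ratfun_denom_nz)
  have sub: "{p. poly (ratfun_num \<phi>) p = 0} \<subseteq> ?S" "{p. poly (ratfun_denom \<phi>) p = 0} \<subseteq> ?S"
      "{p. poly (ratfun_num (1 - \<phi>)) p = 0} \<subseteq> ?S" "{p. poly (ratfun_denom (1 - \<phi>)) p = 0} \<subseteq> ?S"
    if "\<phi> \<in> \<Phi>" for \<phi>
    using that by (auto simp: special_points_def ratfun_one_minus)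
  show ?thesis
  proof
    show "finite ?S" by fact
    show "open (regular_points \<Phi>)" "finite (- regular_points \<Phi>)" "regular_points \<Phi> \<inter> ?S = {}"
      using finS by (auto simp: regular_points_eq finite_imp_closed open_Compl)
    show "finite \<Phi>" by fact
  next
    fix \<phi> t assume \<phi>: "\<phi> \<in> \<Phi>" and t: "t \<in> regular_points \<Phi>"
    then have pole: "poly (ratfun_denom \<phi>) t \<noteq> 0" and tS: "t \<notin> ?S"
      by (auto simp: regular_points_def ratfun_pole_def regular_points_eq[symmetric]) (auto simp: regular_points_eq[symmetric] regular_points_def ratfun_pole_def special_points_def ratfun_eval_def ratfun_one_minus)
    show "ratfun_eval \<phi> t \<noteq> 0 \<and> ratfun_eval \<phi> t \<noteq> 1"
      using \<phi> t by (auto simp: regular_points_def)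
    have "(\<lambda>t. poly (ratfun_num \<phi>) t / poly (ratfun_denom \<phi>) t) field_differentiable at t"
      using pole by (intro field_differentiable_divide) (auto intro!: derivative_intros simp: field_differentiable_def intro: poly_DERIV)
    then show "ratfun_eval \<phi> field_differentiable at t"
      by (simp add: ratfun_eval_def[abs_def])
    show "ln (cmod (ratfun_eval \<phi> t)) = ratfun_log_lead \<phi> + (\<Sum>p\<in>?S. ratfun_ord \<phi> p * ln (cmod (t - p)))"
      by (rule ln_cmod_ratfun_eval[OF nz(1)[OF \<phi>] finS sub(1,2)[OF \<phi>] tS])
    have "1 - ratfun_eval \<phi> t = ratfun_eval (1 - \<phi>) t"
      using pole by (simp add: ratfun_eval_def ratfun_one_minus diff_divide_distrib)
    then show "ln (cmod (1 - ratfun_eval \<phi> t))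
        = ratfun_log_lead (1 - \<phi>) + (\<Sum>p\<in>?S. ratfun_ord (1 - \<phi>) p * ln (cmod (t - p)))"
      using ln_cmod_ratfun_eval[OF nz(2)[OF \<phi>] finS sub(3,4)[OF \<phi>] tS] by simp
  next
    fix \<phi> p assume \<phi>: "\<phi> \<in> \<Phi>" and p: "p \<notin> ?S"
    have "poly (ratfun_num \<phi>) p \<noteq> 0" "poly (ratfun_denom \<phi>) p \<noteq> 0" "poly (ratfun_num (1 - \<phi>)) p \<noteq> 0"
        "poly (ratfun_denom (1 - \<phi>)) p \<noteq> 0"
      using sub[OF \<phi>] p by auto
    then show "ratfun_ord \<phi> p = 0" "ratfun_ord (1 - \<phi>) p = 0"
      using nz[OF \<phi>] by (simp_all add: ratfun_ord_def lookup_ratfun_divisor order_0I)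
  qed
qed

text \<open>
  Exactness in the middle, in terms of representatives. In weight 1 the sum is a linear combination of the functions
  \<open>log|t - p|\<close> up to a constant, with the coefficients of the total divisor. In higher weight both sides are equivalent to the
  closedness condition, which is rational for rational coefficients.
\<close>

lemma A_space_iff:
  fixes x :: "ratfun \<Rightarrow>\<^sub>0 rat"
  assumes n: "n \<ge> 1"
  shows "x \<in> A_space n \<longleftrightarrow> lin_ext (J_gen n) x \<in> S_relations n"
proof -
  define \<Phi> where "\<Phi> = Poly_Mapping.keys x - {0, 1}"
  define w where "w \<phi> = real_of_rat (Poly_Mapping.lookup x \<phi>)" for \<phi>
  interpret log_family "special_points \<Phi>" "regular_points \<Phi>" \<Phi> ratfun_eval ratfun_ord
      "\<lambda>\<phi>. ratfun_ord (1 - \<phi>)" ratfun_log_lead "\<lambda>\<phi>. ratfun_log_lead (1 - \<phi>)"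
    by (rule log_family_ratfun) (auto simp: \<Phi>_def)
  have A: "x \<in> A_space n \<longleftrightarrow>
      (\<lambda>t. \<Sum>\<phi>\<in>\<Phi>. w \<phi> * zagier_polylog n (ratfun_eval \<phi> t)) constant_on regular_points \<Phi>"
    by (simp add: A_space_def \<Phi>_def w_def Let_def)
  show ?thesis
  proof (cases "n = 1")
    case True
    have z: "(\<Sum>\<phi>\<in>\<Phi>. w \<phi> * zagier_polylog n (ratfun_eval \<phi> t)) = (\<Sum>\<phi>\<in>\<Phi>. w \<phi> * L \<phi> (log_point t))"
      if "t \<in> regular_points \<Phi>" for t
      using that by (intro sum.cong) (auto simp: True zagier_polylog_def ln_f_eq_L)
    have "x \<in> A_space n \<longleftrightarrow> (\<forall>p. (\<Sum>\<phi>\<in>\<Phi>. w \<phi> * ratfun_ord \<phi> p) = 0)"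
    proof
      assume "x \<in> A_space n"
      then have "(\<lambda>t. \<Sum>\<phi>\<in>\<Phi>. w \<phi> * L \<phi> (log_point t) + 0 * L' \<phi> (log_point t)) constant_on regular_points \<Phi>"
        unfolding A constant_on_def using z by simp
      from log_sum_constant_imp_zero[OF this] show "\<forall>p. (\<Sum>\<phi>\<in>\<Phi>. w \<phi> * ratfun_ord \<phi> p) = 0" by simp
    next
      assume zero: "\<forall>p. (\<Sum>\<phi>\<in>\<Phi>. w \<phi> * ratfun_ord \<phi> p) = 0"
      have "(\<Sum>\<phi>\<in>\<Phi>. w \<phi> * L \<phi> y) = (\<Sum>\<phi>\<in>\<Phi>. w \<phi> * ratfun_log_lead \<phi>)" for y
      proof -
        have "(\<Sum>\<phi>\<in>\<Phi>. w \<phi> * L \<phi> y) = (\<Sum>\<phi>\<in>\<Phi>. w \<phi> * ratfun_log_lead \<phi>)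
            + (\<Sum>\<phi>\<in>\<Phi>. w \<phi> * (\<Sum>p\<in>special_points \<Phi>. ratfun_ord \<phi> p * y p))"
          by (simp add: L_def distrib_left sum.distrib)
        then show ?thesis unfolding sum_weighted_forms using zero by simp
      qed
      then show "x \<in> A_space n" unfolding A constant_on_def using z by auto
    qed
    also have "\<dots> \<longleftrightarrow> (\<forall>p. (\<Sum>\<phi>\<in>\<Phi>. Poly_Mapping.lookup x \<phi> * Poly_Mapping.lookup (ratfun_divisor \<phi>) p) = 0)"
      unfolding w_def ratfun_ord_def of_rat_mult[symmetric] of_rat_sum[symmetric] by simp
    also have "\<dots> \<longleftrightarrow> lin_ext (J_gen n) x = 0"
    proof -
      have "Poly_Mapping.lookup (lin_ext (J_gen n) x) (m, p)
          = (if m = {#} then (\<Sum>\<phi>\<in>\<Phi>. Poly_Mapping.lookup x \<phi> * Poly_Mapping.lookup (ratfun_divisor \<phi>) p) else 0)" for m p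
      proof -
        have "Poly_Mapping.lookup (lin_ext (J_gen n) x) (m, p)
            = (\<Sum>\<phi>\<in>\<Phi>. if m = {#} then Poly_Mapping.lookup x \<phi> * Poly_Mapping.lookup (ratfun_divisor \<phi>) p else 0)"
          unfolding lookup_lin_ext \<Phi>_def
          by (intro sum.mono_neutral_cong_right) (auto simp: J_gen_def True lookup_tensor lookup_one)
        then show ?thesis by simp
      qed
      then show ?thesis by (auto simp: poly_mapping_eq_iff fun_eq_iff)
    qed
    finally show ?thesis by (simp add: S_relations_def True)
  next
    case False
    define a where "a = n - 2"
    have n: "n = a + 2" using n False by (simp add: a_def)
    have "x \<in> A_space n \<longleftrightarrow> (\<lambda>t. \<Sum>\<phi>\<in>\<Phi>. w \<phi> * sv_polylog (a + 2) (ratfun_eval \<phi> t)) constant_on regular_points \<Phi>"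
      unfolding A by (simp add: n zagier_polylog_eq_sv_polylog)
    also have "\<dots> \<longleftrightarrow> integrable_symbol a w"
      using integrable_symbol_imp_constant constant_imp_integrable_symbol by blast
    also have "\<dots> \<longleftrightarrow> (\<forall>m p q. size m = n - 2 \<longrightarrow>
      (\<Sum>\<phi>\<in>\<Phi>. Poly_Mapping.lookup x \<phi> * (\<Prod>r\<in>#m. Poly_Mapping.lookup (ratfun_divisor \<phi>) r)
         * (Poly_Mapping.lookup (ratfun_divisor \<phi>) p * Poly_Mapping.lookup (ratfun_divisor (1 - \<phi>)) q
            - Poly_Mapping.lookup (ratfun_divisor \<phi>) q * Poly_Mapping.lookup (ratfun_divisor (1 - \<phi>)) p)) = 0)"
    proof -
      have prod: "(\<Prod>r\<in>#m. ratfun_ord \<phi> r) = of_rat (\<Prod>r\<in>#m. Poly_Mapping.lookup (ratfun_divisor \<phi>) r)" for m \<phi>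
        by (induction m) (auto simp: ratfun_ord_def of_rat_mult)
      show ?thesis
        unfolding integrable_symbol_def prod w_def
        unfolding ratfun_ord_def of_rat_mult[symmetric] of_rat_diff[symmetric] of_rat_sum[symmetric]
        by (simp add: n)
    qed
    also have "\<dots> \<longleftrightarrow> lin_ext (J_gen n) x \<in> S_relations n"
      unfolding \<Phi>_def by (rule lin_ext_J_gen_in_S_relations_iff[symmetric]) (simp add: n)
    finally show ?thesis .
  qed
qed

section \<open>The exact sequence\<close>

lemma lin_ext_qscale: "lin_ext f (qscale c x) = qscale c (lin_ext f x)"
proof (rule poly_mapping_eqI)
  fix k
  have "Poly_Mapping.keys (qscale c x) \<subseteq> Poly_Mapping.keys x" by (auto simp: in_keys_iff)
  then show "Poly_Mapping.lookup (lin_ext f (qscale c x)) k = Poly_Mapping.lookup (qscale c (lin_ext f x)) k"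
    by (simp add: lookup_lin_ext_superset[of "Poly_Mapping.keys x"] sum_distrib_left mult_ac)
qed

lemma module_qscale: "module (qscale :: rat \<Rightarrow> ('s \<Rightarrow>\<^sub>0 rat) \<Rightarrow> _)"
  unfolding module_def
  by (intro conjI allI poly_mapping_eqI) (simp_all add: lookup_add algebra_simps)

abbreviation (input) rat_subspace :: "('s \<Rightarrow>\<^sub>0 rat) set \<Rightarrow> bool" where
  "rat_subspace \<equiv> module.subspace qscale"

lemma rat_subspace_iff:
  "rat_subspace U \<longleftrightarrow> 0 \<in> U \<and> (\<forall>x\<in>U. \<forall>y\<in>U. x + y \<in> U) \<and> (\<forall>c. \<forall>x\<in>U. qscale c x \<in> U)"
  by (rule module.subspace_def[OF module_qscale])

lemmas rat_subspace_uminus = module.subspace_neg[OF module_qscale]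

lemma comm_group_add_group:
  assumes "rat_subspace U"
  shows "comm_group (add_group U)"
proof (rule comm_groupI)
  fix x assume "x \<in> carrier (add_group U)"
  then show "\<exists>y\<in>carrier (add_group U). y \<otimes>\<^bsub>add_group U\<^esub> x = \<one>\<^bsub>add_group U\<^esub>"
    using rat_subspace_uminus[OF assms, of x] by (intro bexI[of _ "- x"]) (auto simp: add_group_def)
qed (use assms in \<open>auto simp: add_group_def rat_subspace_iff add_ac\<close>)

lemma rat_subspace_qspan: "rat_subspace (qspan S)"
proof -
  have "Poly_Mapping.keys (x + y) \<subseteq> S" if "Poly_Mapping.keys x \<subseteq> S" "Poly_Mapping.keys y \<subseteq> S" for x y :: "'a \<Rightarrow>\<^sub>0 rat"
    using that Poly_Mapping.keys_add[of x y] by blast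
  moreover have "Poly_Mapping.keys (qscale c x) \<subseteq> Poly_Mapping.keys x" for c and x :: "'a \<Rightarrow>\<^sub>0 rat"
    by (auto simp: in_keys_iff)
  ultimately show ?thesis unfolding rat_subspace_iff qspan_def by (simp, blast)
qed

lemma rat_subspace_S_relations: "rat_subspace (S_relations n)"
proof (cases "n = 1")
  case True
  then show ?thesis by (auto simp: S_relations_def rat_subspace_iff intro: poly_mapping_eqI)
next
  case False
  have Sym: "rat_subspace (Sym n :: ('a multiset \<Rightarrow>\<^sub>0 rat) set)"
    unfolding Sym_def by (rule rat_subspace_qspan)
  have "rat_subspace (sym_embed ` (Sym n :: ('a multiset \<Rightarrow>\<^sub>0 rat) set))"
    unfolding rat_subspace_iff
  proof (intro conjI ballI allI)
    have "sym_embed 0 = 0" by (simp add: sym_embed_def lin_ext_def)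
    then show "0 \<in> sym_embed ` (Sym n :: ('a multiset \<Rightarrow>\<^sub>0 rat) set)"
      using Sym by (intro image_eqI[of _ _ 0]) (simp_all add: rat_subspace_iff)
  next
    fix x y :: "'a multiset \<times> 'a \<Rightarrow>\<^sub>0 rat" assume "x \<in> sym_embed ` Sym n" "y \<in> sym_embed ` Sym n"
    then obtain x' y' where xy: "x' \<in> Sym n" "y' \<in> Sym n" "x = sym_embed x'" "y = sym_embed y'" by blast
    then show "x + y \<in> sym_embed ` Sym n"
      using Sym by (intro image_eqI[of _ _ "x' + y'"]) (simp_all add: sym_embed_def lin_ext_add rat_subspace_iff)
  next
    fix c x assume "x \<in> sym_embed ` (Sym n :: ('a multiset \<Rightarrow>\<^sub>0 rat) set)"
    then obtain x' where x: "x' \<in> Sym n" "x = sym_embed x'" by blast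
    then show "qscale c x \<in> sym_embed ` Sym n"
      using Sym by (intro image_eqI[of _ _ "qscale c x'"]) (simp_all add: sym_embed_def lin_ext_qscale rat_subspace_iff)
  qed
  then show ?thesis using False by (simp add: S_relations_def)
qed

lemma S_relations_subset: "S_relations n \<subseteq> Sym_tensor (n - 1)"
proof
  fix x assume x: "x \<in> S_relations n"
  show "x \<in> Sym_tensor (n - 1)"
  proof (cases "n = 1")
    case True
    then show ?thesis using x by (simp add: S_relations_def Sym_tensor_def qspan_def)
  next
    case False
    then obtain y where y: "x = sym_embed y" "y \<in> Sym n" using x by (auto simp: S_relations_def)
    have "size m = n - 1" if "(m, p) \<in> Poly_Mapping.keys x" for m p
    proof -
      have "Poly_Mapping.lookup y (add_mset p m) \<noteq> 0"
        using that by (auto simp: y(1) in_keys_iff lookup_sym_embed)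
      then have "add_mset p m \<in> Poly_Mapping.keys y" by (simp add: in_keys_iff)
      then have "size (add_mset p m) = n" using y(2) unfolding Sym_def qspan_def by blast
      then show ?thesis by simp
    qed
    then show ?thesis unfolding Sym_tensor_def qspan_def by auto
  qed
qed

lemma S_relations_normal:
  "(S_relations n :: ('p multiset \<times> 'p \<Rightarrow>\<^sub>0 rat) set) \<lhd> add_group (Sym_tensor (n - 1))"
proof -
  have "rat_subspace (Sym_tensor (n - 1) :: ('p multiset \<times> 'p \<Rightarrow>\<^sub>0 rat) set)"
    unfolding Sym_tensor_def by (rule rat_subspace_qspan)
  then interpret G: comm_group "add_group (Sym_tensor (n - 1) :: ('p multiset \<times> 'p \<Rightarrow>\<^sub>0 rat) set)" by (rule comm_group_add_group)
  have "subgroup (S_relations n :: ('p multiset \<times> 'p \<Rightarrow>\<^sub>0 rat) set) (add_group (Sym_tensor (n - 1)))"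
  proof (rule G.subgroupI)
    show "S_relations n \<subseteq> carrier (add_group (Sym_tensor (n - 1)))"
      using S_relations_subset[of n] by (simp add: add_group_def)
    show "S_relations n \<noteq> {}" using rat_subspace_S_relations[of n] unfolding rat_subspace_iff by blast
    fix a b :: "'p multiset \<times> 'p \<Rightarrow>\<^sub>0 rat" assume a: "a \<in> S_relations n"
    have m: "- a \<in> S_relations n" by (rule rat_subspace_uminus[OF rat_subspace_S_relations a])
    have "a \<in> Sym_tensor (n - 1)" "- a \<in> Sym_tensor (n - 1)"
      using a m S_relations_subset[of n] by blast+
    then have "inv\<^bsub>add_group (Sym_tensor (n - 1))\<^esub> a = - a"
      by (intro G.inv_equality) (simp_all add: add_group_def)
    then show "inv\<^bsub>add_group (Sym_tensor (n - 1))\<^esub> a \<in> S_relations n" using m by simp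
    assume "b \<in> S_relations n"
    then show "a \<otimes>\<^bsub>add_group (Sym_tensor (n - 1))\<^esub> b \<in> S_relations n"
      using a rat_subspace_S_relations[of n, where 'a = 'p] unfolding rat_subspace_iff
      by (simp add: add_group_def)
  qed
  then show ?thesis by (rule G.subgroup_imp_normal)
qed

text \<open>
  The map is the composition of a linear map into the tensor product with the projection to a quotient, so
  its kernel is the preimage of the relations.
\<close>

lemma group_hom_J_map:
  assumes "n \<ge> 1"
  shows "group_hom (add_group UNIV) (S_star n) (J_map n)"
    and "kernel (add_group UNIV) (S_star n) (J_map n) = {x. lin_ext (J_gen n) x \<in> S_relations n}"
proof -
  interpret N: normal "S_relations n" "add_group (Sym_tensor (n - 1))" by (rule S_relations_normal)
  have in_carrier: "lin_ext (J_gen n) x \<in> carrier (add_group (Sym_tensor (n - 1)))" for x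
    using lin_ext_J_gen_in_Sym_tensor[OF assms, of x] by (simp add: add_group_def)
  have "J_map n \<in> hom (add_group UNIV) (S_star n)"
  proof (rule homI)
    fix x y
    show "J_map n x \<in> carrier (S_star n)"
      using hom_in_carrier[OF N.r_coset_hom_Mod in_carrier] by (simp add: J_map_def S_star_def)
    show "J_map n (x \<otimes>\<^bsub>add_group UNIV\<^esub> y) = J_map n x \<otimes>\<^bsub>S_star n\<^esub> J_map n y"
      using hom_mult[OF N.r_coset_hom_Mod in_carrier in_carrier, of x y]
      by (simp add: J_map_def S_star_def add_group_def lin_ext_add)
  qed
  moreover have "rat_subspace (UNIV :: (ratfun \<Rightarrow>\<^sub>0 rat) set)" by (simp add: rat_subspace_iff)
  then have "group (add_group (UNIV :: (ratfun \<Rightarrow>\<^sub>0 rat) set))"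
    using comm_group_add_group comm_group.axioms(2) by blast
  moreover have "group (S_star n :: (complex multiset \<times> complex \<Rightarrow>\<^sub>0 rat) set monoid)"
    unfolding S_star_def by (rule N.factorgroup_is_group)
  ultimately show "group_hom (add_group UNIV) (S_star n) (J_map n)"
    by (simp add: group_hom_def group_hom_axioms_def)
  have "J_map n x = S_relations n \<longleftrightarrow> lin_ext (J_gen n) x \<in> S_relations n" for x
    unfolding J_map_def
    using N.coset_join1[OF _ in_carrier N.subgroup_axioms] N.coset_join2[OF in_carrier N.subgroup_axioms] by blast
  then show "kernel (add_group UNIV) (S_star n) (J_map n) = {x. lin_ext (J_gen n) x \<in> S_relations n}"
    by (simp add: kernel_def S_star_def FactGroup_def add_group_def)
qed

theorem theorem1p4:
  fixes n :: nat
  assumes "n \<ge> 1"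
  shows "module.subspace qscale (A_space n) \<and>
    exact_at (singleton_group 0) (\<lambda>_. 0) (add_group (A_space n)) (I_map n) (add_group UNIV) \<and>
    exact_at (add_group (A_space n)) (I_map n) (add_group UNIV) (J_map n) (S_star n)"
proof -
  have A: "A_space n = {x. lin_ext (J_gen n) x \<in> S_relations n}"
    using A_space_iff[OF assms] by blast
  have sub: "rat_subspace (A_space n)"
    using rat_subspace_S_relations[of n, where 'a = complex]
    unfolding A rat_subspace_iff by (auto simp: lin_ext_add lin_ext_qscale lin_ext_def[of _ 0])
  have G: "group (add_group (A_space n))" "group (add_group (UNIV :: (ratfun \<Rightarrow>\<^sub>0 rat) set))"
    using comm_group_add_group[OF sub] comm_group_add_group[of "UNIV :: (ratfun \<Rightarrow>\<^sub>0 rat) set"]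
    by (auto simp: rat_subspace_iff comm_group_def)
  have "I_map n \<in> hom (add_group (A_space n)) (add_group UNIV)"
    by (intro homI) (simp_all add: add_group_def I_map_def)
  then have I: "group_hom (add_group (A_space n)) (add_group UNIV) (I_map n)"
    using G by (simp add: group_hom_def group_hom_axioms_def)
  have "exact_at (singleton_group 0) (\<lambda>_. 0) (add_group (A_space n)) (I_map n) (add_group UNIV)"
  proof -
    have "(\<lambda>_. 0) \<in> hom (singleton_group 0) (add_group (A_space n))"
      using sub by (intro homI) (simp_all add: add_group_def rat_subspace_iff)
    then have "group_hom (singleton_group 0) (add_group (A_space n)) (\<lambda>_. 0)"
      using G by (simp add: group_hom_def group_hom_axioms_def)
    moreover have "(\<lambda>_. 0) ` carrier (singleton_group 0) = kernel (add_group (A_space n)) (add_group UNIV) (I_map n)"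
      using sub by (auto simp: kernel_def add_group_def I_map_def rat_subspace_iff)
    ultimately show ?thesis using I by (simp add: exact_at_def)
  qed
  moreover have "exact_at (add_group (A_space n)) (I_map n) (add_group UNIV) (J_map n) (S_star n)"
  proof -
    have "I_map n ` carrier (add_group (A_space n)) = A_space n" by (simp add: add_group_def I_map_def)
    also have "\<dots> = kernel (add_group UNIV) (S_star n) (J_map n)"
      using group_hom_J_map(2)[OF assms] A by simp
    finally show ?thesis using I group_hom_J_map(1)[OF assms] by (simp add: exact_at_def)
  qed
  ultimately show ?thesis using sub by blast
qed

end
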